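(* For any arbitrarily small constant $\epsilon>0$, there exists an algorithm for the MKU problem that runs in $r^{O(mr/\epsilon)}+n^{O(m^5/\epsilon^5)}$ time and returns a solution with objective value no smaller than $\mathrm{OPT}-\epsilon$, where $\mathrm{OPT}\in[0,1]$ is the optimal objective value of the MKU problem.
   Context: MKU problem (Multi-block Knapsack with Uncertainty). Input: a knapsack capacity $Q$; items $v_1,\dots,v_n$, item $v_i$ having size $q_i$ and profit $P_i$, an independent random variable with $\Pr(P_i=1)=p_i$ and $\Pr(P_i=0)=1-p_i$; a partition of the items into a constant number $m\ge2$ of subsets $V_1,\dots,V_m$; a quota $\Delta_j$ for each $V_j$ with $\Delta_j\le r+1$ for some positive integer $r$; a positive integer $k\le r+1$; an index $1\le j_0\le m-1$. Output: $I^*\subseteq\{1,\dots,n\}$ such that $\sum_{i\in I^*}q_i\le Q$, $|V(I^* )\cap V_j|\ge\Delta_j$ for all $1\le j\le m-1$ with $j\neq j_0$, $|V(I^* )\cap V_{j_0}|=\Delta_{j_0}$, and $\Pr\left(\sum_{i\in I^*}P_i\ge k\right)$ is maximized, where $V(I^* )=\{v_i: i\in I^*\}$. A solution is an index set satisfying these constraints; its objective value is $\Pr\left(\sum_{i\in I}P_i\ge k\right)$. *)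

theory Defs
  imports "HOL-Probability.Probability"
begin

section \<open>The MKU problem\<close>

text \<open>
  Item \<open>v\<^sub>i\<close> is identified with its index \<open>i \<in> {1..n}\<close>.  The partition \<open>V\<^sub>1, \<dots>, V\<^sub>m\<close> is given by the
  map \<open>blk\<close> sending an item to the index of its block, so that blocks may be empty.  Only the values
  of the functions on \<open>{1..n}\<close> (resp. \<open>{1..m}\<close> for \<open>quota\<close>) are part of the instance.
\<close>

record mku =
  nitems :: nat
  nblocks :: nat
  rbound :: nat
  target :: nat
  exact :: nat
  capacity :: real
  isize :: "nat \<Rightarrow> real"
  iprob :: "nat \<Rightarrow> real"
  blk :: "nat \<Rightarrow> nat"
  quota :: "nat \<Rightarrow> nat"

definition mku_instance :: "mku \<Rightarrow> bool" where
  "mku_instance X \<longleftrightarrow>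
     nblocks X \<ge> 2 \<and>
     rbound X \<ge> 1 \<and>
     1 \<le> target X \<and> target X \<le> rbound X + 1 \<and>
     1 \<le> exact X \<and> exact X \<le> nblocks X - 1 \<and>
     (\<forall>i\<in>{1..nitems X}. 0 \<le> iprob X i \<and> iprob X i \<le> 1) \<and>
     (\<forall>i\<in>{1..nitems X}. blk X i \<in> {1..nblocks X}) \<and>
     (\<forall>j\<in>{1..nblocks X}. quota X j \<le> rbound X + 1)"

definition block :: "mku \<Rightarrow> nat \<Rightarrow> nat set" where
  "block X j = {i \<in> {1..nitems X}. blk X i = j}"

definition mku_solution :: "mku \<Rightarrow> nat set \<Rightarrow> bool" where
  "mku_solution X I \<longleftrightarrow>
     I \<subseteq> {1..nitems X} \<and>
     (\<Sum>i\<in>I. isize X i) \<le> capacity X \<and>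
     (\<forall>j\<in>{1..nblocks X - 1}. j \<noteq> exact X \<longrightarrow> card (I \<inter> block X j) \<ge> quota X j) \<and>
     card (I \<inter> block X (exact X)) = quota X (exact X)"

text \<open>The joint law of the independent profits; \<open>\<omega> i\<close> holds iff \<open>P\<^sub>i = 1\<close>.\<close>

definition profits :: "mku \<Rightarrow> (nat \<Rightarrow> bool) pmf" where
  "profits X = Pi_pmf {1..nitems X} False (\<lambda>i. bernoulli_pmf (iprob X i))"

definition mku_value :: "mku \<Rightarrow> nat set \<Rightarrow> real" where
  "mku_value X I =
     measure_pmf.prob (profits X) {\<omega>. (\<Sum>i\<in>I. of_bool (\<omega> i) :: nat) \<ge> target X}"

definition mku_opt :: "mku \<Rightarrow> real" where
  "mku_opt X = Max (mku_value X ` {I. mku_solution X I})"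


section \<open>Algorithms: a real RAM with unit-cost operations\<close>

text \<open>
  The memory consists of named arrays of natural numbers and named arrays of reals, all of
  unbounded length and with unit-time access; a scalar is entry 0 of an array.  There is no
  floor function or other operation turning a real into a natural number, and the only constants
  are natural numbers, so that a program cannot carry information in a real constant.
\<close>

type_synonym vname = string

datatype nexp =
    NConst nat
  | NRead vname nexp
  | NAdd nexp nexp
  | NSub nexp nexp
  | NMul nexp nexp

datatype rexp =
    ROfNat nexp
  | RRead vname nexp
  | RAdd rexp rexp
  | RSub rexp rexp
  | RMul rexp rexp
  | RDiv rexp rexp

datatype bexp =
    NLe nexp nexp
  | RLe rexp rexp
  | BNot bexp
  | BAnd bexp bexp

datatype com =
    Skip
  | NAssign vname nexp nexp
  | RAssign vname nexp rexp
  | Seq com com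
  | Cond bexp com com
  | While bexp com

record state =
  nmem :: "vname \<Rightarrow> nat \<Rightarrow> nat"
  rmem :: "vname \<Rightarrow> nat \<Rightarrow> real"

primrec nval :: "nexp \<Rightarrow> state \<Rightarrow> nat" where
  "nval (NConst c) s = c"
| "nval (NRead x a) s = nmem s x (nval a s)"
| "nval (NAdd a b) s = nval a s + nval b s"
| "nval (NSub a b) s = nval a s - nval b s"
| "nval (NMul a b) s = nval a s * nval b s"

primrec rval :: "rexp \<Rightarrow> state \<Rightarrow> real" where
  "rval (ROfNat a) s = real (nval a s)"
| "rval (RRead x a) s = rmem s x (nval a s)"
| "rval (RAdd a b) s = rval a s + rval b s"
| "rval (RSub a b) s = rval a s - rval b s"
| "rval (RMul a b) s = rval a s * rval b s"
| "rval (RDiv a b) s = rval a s / rval b s"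

primrec bval :: "bexp \<Rightarrow> state \<Rightarrow> bool" where
  "bval (NLe a b) s \<longleftrightarrow> nval a s \<le> nval b s"
| "bval (RLe a b) s \<longleftrightarrow> rval a s \<le> rval b s"
| "bval (BNot b) s \<longleftrightarrow> \<not> bval b s"
| "bval (BAnd b c) s \<longleftrightarrow> bval b s \<and> bval c s"

text \<open>The cost of an expression is its number of operations, memory accesses and constants.\<close>

primrec ncost :: "nexp \<Rightarrow> nat" where
  "ncost (NConst c) = 1"
| "ncost (NRead x a) = 1 + ncost a"
| "ncost (NAdd a b) = 1 + ncost a + ncost b"
| "ncost (NSub a b) = 1 + ncost a + ncost b"
| "ncost (NMul a b) = 1 + ncost a + ncost b"

primrec rcost :: "rexp \<Rightarrow> nat" where
  "rcost (ROfNat a) = 1 + ncost a"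
| "rcost (RRead x a) = 1 + ncost a"
| "rcost (RAdd a b) = 1 + rcost a + rcost b"
| "rcost (RSub a b) = 1 + rcost a + rcost b"
| "rcost (RMul a b) = 1 + rcost a + rcost b"
| "rcost (RDiv a b) = 1 + rcost a + rcost b"

primrec bcost :: "bexp \<Rightarrow> nat" where
  "bcost (NLe a b) = 1 + ncost a + ncost b"
| "bcost (RLe a b) = 1 + rcost a + rcost b"
| "bcost (BNot b) = 1 + bcost b"
| "bcost (BAnd b c) = 1 + bcost b + bcost c"

definition nupd :: "vname \<Rightarrow> nat \<Rightarrow> nat \<Rightarrow> state \<Rightarrow> state" where
  "nupd x i v s = s\<lparr>nmem := (nmem s)(x := (nmem s x)(i := v))\<rparr>"

definition rupd :: "vname \<Rightarrow> nat \<Rightarrow> real \<Rightarrow> state \<Rightarrow> state" where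
  "rupd x i v s = s\<lparr>rmem := (rmem s)(x := (rmem s x)(i := v))\<rparr>"

text \<open>\<open>runs c s t s'\<close>: started in \<open>s\<close>, the program \<open>c\<close> halts after \<open>t\<close> time units in \<open>s'\<close>.\<close>

inductive runs :: "com \<Rightarrow> state \<Rightarrow> nat \<Rightarrow> state \<Rightarrow> bool" where
  Skip: "runs Skip s 1 s"
| NAssign: "runs (NAssign x a e) s (1 + ncost a + ncost e) (nupd x (nval a s) (nval e s) s)"
| RAssign: "runs (RAssign x a e) s (1 + ncost a + rcost e) (rupd x (nval a s) (rval e s) s)"
| Seq: "runs c s t s' \<Longrightarrow> runs d s' u s'' \<Longrightarrow> runs (Seq c d) s (t + u) s''"
| CondTrue: "bval b s \<Longrightarrow> runs c s t s' \<Longrightarrow> runs (Cond b c d) s (1 + bcost b + t) s'"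
| CondFalse: "\<not> bval b s \<Longrightarrow> runs d s t s' \<Longrightarrow> runs (Cond b c d) s (1 + bcost b + t) s'"
| WhileFalse: "\<not> bval b s \<Longrightarrow> runs (While b c) s (1 + bcost b) s"
| WhileTrue: "bval b s \<Longrightarrow> runs c s t s' \<Longrightarrow> runs (While b c) s' u s'' \<Longrightarrow>
    runs (While b c) s (1 + bcost b + t + u) s''"

inductive_cases runs_SkipE: "runs Skip s t s'"
inductive_cases runs_NAssignE: "runs (NAssign x a e) s t s'"
inductive_cases runs_RAssignE: "runs (RAssign x a e) s t s'"
inductive_cases runs_SeqE: "runs (Seq c d) s t s'"
inductive_cases runs_CondE: "runs (Cond b c d) s t s'"
inductive_cases runs_WhileE: "runs (While b c) s t s'"

lemma runs_deterministic:
  "runs c s t s' \<Longrightarrow> runs c s u s'' \<Longrightarrow> u = t \<and> s'' = s'"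
proof (induction arbitrary: u s'' rule: runs.induct)
  case (Seq c s t s1 d v s2)
  from Seq.prems show ?case by (rule runs_SeqE) (auto dest!: Seq.IH)
next
  case (CondTrue b s c t s1 d)
  from CondTrue.prems show ?case by (rule runs_CondE) (use CondTrue.hyps(1) in \<open>auto dest: CondTrue.IH\<close>)
next
  case (CondFalse b s d t s1 c)
  from CondFalse.prems show ?case by (rule runs_CondE) (use CondFalse.hyps(1) in \<open>auto dest: CondFalse.IH\<close>)
next
  case (WhileFalse b s c)
  from WhileFalse.prems show ?case by (rule runs_WhileE) (use WhileFalse.hyps in auto)
next
  case (WhileTrue b s c t s1 v s2)
  from WhileTrue.prems show ?case by (rule runs_WhileE) (use WhileTrue.hyps(1) in \<open>auto dest!: WhileTrue.IH\<close>)
qed (auto elim: runs_SkipE runs_NAssignE runs_RAssignE)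

text \<open>All memory that does not hold a part of the instance is initially zero.\<close>

definition mku_input :: "mku \<Rightarrow> state" where
  "mku_input X =
     \<lparr>nmem = (\<lambda>_ _. 0)
        (''n'' := (\<lambda>_. 0)(0 := nitems X),
         ''m'' := (\<lambda>_. 0)(0 := nblocks X),
         ''r'' := (\<lambda>_. 0)(0 := rbound X),
         ''k'' := (\<lambda>_. 0)(0 := target X),
         ''j0'' := (\<lambda>_. 0)(0 := exact X),
         ''blk'' := (\<lambda>i. if i \<in> {1..nitems X} then blk X i else 0),
         ''Delta'' := (\<lambda>j. if j \<in> {1..nblocks X} then quota X j else 0)),
      rmem = (\<lambda>_ _. 0)
        (''Q'' := (\<lambda>_. 0)(0 := capacity X),
         ''q'' := (\<lambda>i. if i \<in> {1..nitems X} then isize X i else 0),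
         ''p'' := (\<lambda>i. if i \<in> {1..nitems X} then iprob X i else 0))\<rparr>"

definition mku_output :: "mku \<Rightarrow> state \<Rightarrow> nat set" where
  "mku_output X s = {i \<in> {1..nitems X}. nmem s ''out'' i \<noteq> 0}"

text \<open>
  The bound \<open>r\<^bsup>Cmr/\<epsilon>\<^esup> + n\<^bsup>Cm\<^sup>5/\<epsilon>\<^sup>5\<^esup>\<close>, where \<open>C\<close> is the constant hidden in both exponents.
  The base \<open>n\<close> is replaced by \<open>2\<close> for \<open>n \<le> 1\<close>, since \<open>1\<close> raised to any power would not even leave
  a constant amount of time.
\<close>

definition mku_time :: "real \<Rightarrow> real \<Rightarrow> mku \<Rightarrow> real" where
  "mku_time C \<epsilon> X =
     real (rbound X) powr (C * real (nblocks X) * real (rbound X) / \<epsilon>) +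
     real (max 2 (nitems X)) powr (C * real (nblocks X) ^ 5 / \<epsilon> ^ 5)"

end

theory Submission
  imports Defs
begin

text \<open>The error must not depend on \<open>n\<close>, on the target or on the variance. A first
  difference of the law is only of order \<open>1 / V\<close>, so averaging a class is affordable
  only if the variance it adds is a small fraction of \<open>V\<close> itself. In a class of width
  \<open>1 / K\<close> on one side of 1/2 it is: the squared deviations from the class mean
  \<open>M\<close> are on average at most \<open>(M - a) (b - M)\<close>, where one factor is at
  most \<open>1 / K\<close> and the other at most the distance from \<open>M\<close> to the nearer
  of 0 and 1, so the total is at most \<open>2 / K\<close> times the variance. Hence
  \<open>K\<close> is even, which makes 1/2 a class boundary, and at least 4, so that averaging at
  most doubles the variance. Each of the two sets pays \<open>4 / K\<close> for averaging and
  \<open>1 / K\<close> for rounding, which gives \<open>10 / K\<close>. Sizes are never rounded: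
  keeping the least size for every key makes the capacity constraint hold exactly. The machine has
  no floor, no division of naturals and no powers, so levels, classes and powers are found by loops
  of comparisons and multiplications.\<close>

text \<open>
  Round the success probabilities to multiples of \<open>1 / (K (n + 1))\<close> and group them into \<open>K + 1\<close>
  classes of width \<open>1 / K\<close>. The number of items taken from every block, the number taken from every
  class and the sum of the rounded probabilities in every class are additive over the items, so
  they can be packed into one number, the key of a set of items. Two sets with the same key have
  the same block counts, and their objective values differ by at most \<open>10 / K\<close>: replacing the
  probabilities of a class by their mean leaves the expectation unchanged and changes the tail
  probabilities by at most the change of the variance times the largest first difference of the
  law of the sum, which by Fourier inversion is of the order of the inverse of the variance. It
  therefore suffices to compute, by dynamic programming, a set of least size for every key, and to
  return the best feasible one. There are only \<open>n\<^bsup>O(m / \<epsilon>\<^sup>2)\<^esup>\<close> keys.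
\<close>

section \<open>Sums of independent Bernoulli variables\<close>

lemma has_integral_cis_int:
  fixes c :: int
  shows "((\<lambda>t. cis (of_int c * t)) has_integral (if c = 0 then of_real (2 * pi) else 0)) {-pi..pi}"
proof (cases "c = 0")
  case True
  have "((\<lambda>t::real. 1::complex) has_integral (measure lborel {-pi..pi} *\<^sub>R 1)) {-pi..pi}"
    by (rule has_integral_const_real)
  then show ?thesis using True by (simp add: scaleR_conv_of_real)
next
  case False
  let ?g = "\<lambda>t::real. cis (of_int c * t) / (\<i> * of_int c)"
  have "((\<lambda>t. cis (of_int c * t)) has_integral (?g pi - ?g (-pi))) {-pi..pi}"
  proof (rule fundamental_theorem_of_calculus)
    fix t assume "t \<in> {-pi..pi}"
    show "(?g has_vector_derivative cis (of_int c * t)) (at t within {-pi..pi})"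
    proof -
      have "((\<lambda>z. exp (\<i> * of_int c * z) / (\<i> * of_int c)) has_field_derivative
          exp (\<i> * of_int c * of_real t)) (at (of_real t))"
        using False by (auto intro!: derivative_eq_intros)
      from has_vector_derivative_real_field[OF this] show ?thesis
        by (simp add: cis_conv_exp mult.assoc)
    qed
  qed simp
  moreover have "?g pi - ?g (-pi) = 0"
  proof -
    have "sin (of_int c * pi) = 0"
      by (metis mult.commute sin_zero_iff_int2)
    then have "cis (of_int c * pi) = cis (- (of_int c * pi))"
      by (simp add: complex_eq_iff)
    then show ?thesis by simp
  qed
  ultimately show ?thesis using False by simp
qed

text \<open>Cauchy's coefficient formula on the unit circle: integration against
  \<open>cis (- (j * t))\<close> kills every monomial of \<open>F\<close> except the one of degree
  \<open>j\<close>.\<close>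

lemma has_integral_poly_cis:
  fixes F :: "complex poly"
  shows "((\<lambda>t. poly F (cis t) * cis (- (real j * t))) has_integral (of_real (2 * pi) * coeff F j)) {-pi..pi}"
proof -
  have 1: "poly F (cis t) * cis (- (real j * t)) =
      (\<Sum>a\<le>degree F. coeff F a * cis (of_int (int a - int j) * t))" for t
    unfolding poly_altdef sum_distrib_right
  proof (intro sum.cong refl)
    fix a
    have "cis t ^ a * cis (- (real j * t)) = cis (of_int (int a - int j) * t)"
      by (simp add: Complex.DeMoivre cis_mult left_diff_distrib)
    then show "coeff F a * cis t ^ a * cis (- (real j * t)) = coeff F a * cis (of_int (int a - int j) * t)"
      by (simp only: mult.assoc)
  qed
  have "((\<lambda>t. \<Sum>a\<le>degree F. coeff F a * cis (of_int (int a - int j) * t)) has_integral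
      (\<Sum>a\<le>degree F. coeff F a * (if int a - int j = 0 then of_real (2 * pi) else 0))) {-pi..pi}"
    by (intro has_integral_sum has_integral_mult_right has_integral_cis_int) auto
  moreover have "(\<Sum>a\<le>degree F. coeff F a * (if int a - int j = 0 then of_real (2 * pi) else 0))
      = (\<Sum>a\<le>degree F. if a = j then coeff F j * of_real (2 * pi) else 0)"
    by (intro sum.cong) auto
  moreover have "\<dots> = of_real (2 * pi) * coeff F j"
    by (auto simp: coeff_eq_0)
  ultimately show ?thesis using 1 by simp
qed

lemma norm_coeff_le_integral:
  fixes F :: "complex poly"
  assumes g: "(g has_integral b) {-pi..pi}"
    and le: "\<And>t. t \<in> {-pi..pi} \<Longrightarrow> norm (poly F (cis t)) \<le> g t"
  shows "2 * pi * norm (coeff F j) \<le> b"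
proof -
  note h = has_integral_poly_cis[of F j]
  have "norm (integral {-pi..pi} (\<lambda>t. poly F (cis t) * cis (- (real j * t)))) \<le> integral {-pi..pi} g"
    using h g le by (intro integral_norm_bound_integral) (auto simp: norm_mult has_integral_integrable)
  then show ?thesis
    using integral_unique[OF h] integral_unique[OF g] by (simp add: norm_mult)
qed

text \<open>Jordan's inequality: by concavity \<open>sin\<close> lies above its chord from 0 to
  \<open>pi / 2\<close>.\<close>

lemma half_sin_ge:
  assumes "0 \<le> t" "t \<le> pi"
  shows "t / pi \<le> sin (t / 2)"
proof -
  have "concave_on {0..pi} sin"
    unfolding concave_on_def
  proof (rule f''_ge0_imp_convex)
    show "((\<lambda>x. - sin x) has_real_derivative (- cos x)) (at x)" for x :: real
      by (auto intro!: derivative_eq_intros)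
    show "((\<lambda>x. - cos x) has_real_derivative (sin x)) (at x)" for x :: real
      by (auto intro!: derivative_eq_intros)
    show "0 \<le> sin x" if "x \<in> {0..pi}" for x :: real
      using that by (auto intro: sin_ge_zero)
  qed auto
  then have "sin ((1 - t / pi) *\<^sub>R 0 + (t / pi) *\<^sub>R (pi / 2)) \<ge> (1 - t / pi) * sin 0 + t / pi * sin (pi / 2)"
    using assms by (intro concave_onD) auto
  then show ?thesis by simp
qed

lemma half_sin_square_ge:
  assumes "\<bar>t\<bar> \<le> pi"
  shows "(t / pi)\<^sup>2 \<le> (sin (t / 2))\<^sup>2"
proof -
  have "\<bar>t\<bar> / pi \<le> sin (\<bar>t\<bar> / 2)" using assms by (intro half_sin_ge) auto
  then have "(\<bar>t\<bar> / pi)\<^sup>2 \<le> (sin (\<bar>t\<bar> / 2))\<^sup>2" by (intro power_mono) auto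
  moreover have "(sin (\<bar>t\<bar> / 2))\<^sup>2 = (sin (t / 2))\<^sup>2" by (auto simp: abs_if)
  ultimately show ?thesis by (simp add: power_divide)
qed

lemma cos_conv_half_sin: "cos t = 1 - 2 * (sin (t / 2))\<^sup>2" for t :: real
  using cos_double_sin[of "t / 2"] by simp

text \<open>The chord is no longer than the arc; its exact length is
  \<open>2 * \<bar>sin (t / 2)\<bar>\<close>.\<close>

lemma norm_cis_diff_1: "norm (cis t - 1) \<le> \<bar>t\<bar>"
proof -
  have "(norm (cis t - 1))\<^sup>2 = (cos t - 1)\<^sup>2 + (sin t)\<^sup>2"
    by (simp add: cmod_power2)
  also have "\<dots> = 2 - 2 * cos t"
    using sin_cos_squared_add[of t] by (simp add: power2_eq_square algebra_simps)
  also have "\<dots> = 4 * (sin (t / 2))\<^sup>2" by (simp add: cos_conv_half_sin)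
  also have "\<dots> \<le> 4 * (t / 2)\<^sup>2"
    using abs_sin_x_le_abs_x[of "t / 2"] by (intro mult_left_mono) (auto simp flip: abs_le_square_iff)
  also have "\<dots> = \<bar>t\<bar>\<^sup>2" by (simp add: power_divide)
  finally show ?thesis by (rule power2_le_imp_le) simp
qed

section \<open>Generating functions of Bernoulli sums and their decay on the circle\<close>

text \<open>The generating function of a sum of independent Bernoulli variables; its coefficients are
  complex only because they are extracted by integration over the unit circle.\<close>

definition PB :: "('a \<Rightarrow> real) \<Rightarrow> 'a set \<Rightarrow> complex poly" where
  "PB p S = (\<Prod>i\<in>S. [:1 - of_real (p i), of_real (p i):])"

lemma PB_empty [simp]: "PB p {} = 1"
  by (simp add: PB_def)

lemma PB_insert:
  "finite S \<Longrightarrow> i \<notin> S \<Longrightarrow> PB p (insert i S) = [:1 - of_real (p i), of_real (p i):] * PB p S"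
  by (simp add: PB_def)

lemma PB_cong: "(\<And>i. i \<in> S \<Longrightarrow> p i = q i) \<Longrightarrow> PB p S = PB q S"
  by (auto simp: PB_def intro: prod.cong)

text \<open>Adding a factor replaces each coefficient by a convex combination of two neighbouring
  ones.\<close>

lemma norm_coeff_PB_le_1:
  assumes "finite S" "\<And>i. i \<in> S \<Longrightarrow> 0 \<le> p i \<and> p i \<le> 1"
  shows "norm (coeff (PB p S) j) \<le> 1"
  using assms
proof (induction S arbitrary: j rule: finite_induct)
  case empty
  then show ?case by (simp add: coeff_1)
next
  case (insert i S)
  have p: "0 \<le> p i" "p i \<le> 1" and IH: "norm (coeff (PB p S) j) \<le> 1" for j
    using insert by auto
  have 1: "norm ((1 - complex_of_real (p i)) * coeff (PB p S) j) \<le> 1 - p i" for j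
  proof -
    have "norm ((1 - complex_of_real (p i)) * coeff (PB p S) j) = (1 - p i) * norm (coeff (PB p S) j)"
      using p norm_of_real[of "1 - p i", where 'a = complex] by (simp add: norm_mult)
    then show ?thesis using p IH[of j] by (simp add: mult_left_le)
  qed
  have 2: "norm (complex_of_real (p i) * coeff (PB p S) j) \<le> p i" for j
    using p IH[of j] by (simp add: norm_mult mult_left_le)
  show ?case
  proof (cases j)
    case 0
    then show ?thesis using 1[of 0] p insert.hyps by (simp add: PB_insert)
  next
    case (Suc l)
    show ?thesis
      using norm_triangle_mono[OF 1[of j] 2[of l]] insert.hyps Suc by (simp add: PB_insert)
  qed
qed

text \<open>The squared modulus of this characteristic function is
  \<open>1 - 2 * (p * (1 - p)) * (1 - cos t)\<close>. Jordan's inequality and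
  \<open>1 + x \<le> exp x\<close> turn it into Gaussian decay at the rate of the variance.\<close>

lemma norm_bernoulli_cis_le:
  assumes "0 \<le> p" "p \<le> 1" "\<bar>t\<bar> \<le> pi"
  shows "norm (1 - of_real p + of_real p * cis t) \<le> exp (- (2 * (p * (1 - p)) * (t / pi)\<^sup>2))"
proof -
  have "(norm (1 - of_real p + of_real p * cis t))\<^sup>2 = (1 - p + p * cos t)\<^sup>2 + (p * sin t)\<^sup>2"
    by (simp add: cmod_power2)
  also have "\<dots> = 1 - 2 * (p * (1 - p)) * (1 - cos t)"
    proof -
    have "(p * sin t)\<^sup>2 = p\<^sup>2 * (1 - (cos t)\<^sup>2)"
      by (simp add: power_mult_distrib sin_squared_eq)
    then show ?thesis by (simp add: power2_eq_square algebra_simps)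
  qed
  also have "\<dots> = 1 - 4 * (p * (1 - p)) * (sin (t / 2))\<^sup>2"
    by (simp add: cos_conv_half_sin)
  also have "\<dots> \<le> 1 - 4 * (p * (1 - p)) * (t / pi)\<^sup>2"
    using half_sin_square_ge[OF assms(3)] assms by (simp add: mult_left_mono)
  also have "\<dots> \<le> exp (- (4 * (p * (1 - p)) * (t / pi)\<^sup>2))"
    using exp_ge_add_one_self[of "- (4 * (p * (1 - p)) * (t / pi)\<^sup>2)"] by simp
  also have "\<dots> = (exp (- (2 * (p * (1 - p)) * (t / pi)\<^sup>2)))\<^sup>2"
    by (simp flip: exp_double)
  finally show ?thesis by (rule power2_le_imp_le) simp
qed

definition PBvar :: "('a \<Rightarrow> real) \<Rightarrow> 'a set \<Rightarrow> real" where
  "PBvar p S = (\<Sum>i\<in>S. p i * (1 - p i))"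

lemma norm_poly_PB_cis_le:
  assumes "finite S" "\<And>i. i \<in> S \<Longrightarrow> 0 \<le> p i \<and> p i \<le> 1" "\<bar>t\<bar> \<le> pi"
  shows "norm (poly (PB p S) (cis t)) \<le> exp (- (2 * PBvar p S * (t / pi)\<^sup>2))"
proof -
  have "norm (poly (PB p S) (cis t)) = (\<Prod>i\<in>S. norm (1 - of_real (p i) + of_real (p i) * cis t))"
    by (simp add: PB_def poly_prod prod_norm mult.commute)
  also have "\<dots> \<le> (\<Prod>i\<in>S. exp (- (2 * (p i * (1 - p i)) * (t / pi)\<^sup>2)))"
    using assms by (intro prod_mono) (auto intro: norm_bernoulli_cis_le)
  also have "\<dots> = exp (\<Sum>i\<in>S. - (2 * (p i * (1 - p i)) * (t / pi)\<^sup>2))"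
    using assms(1) by (simp add: exp_sum)
  also have "(\<Sum>i\<in>S. - (2 * (p i * (1 - p i)) * (t / pi)\<^sup>2)) = - (2 * PBvar p S * (t / pi)\<^sup>2)"
    by (simp add: PBvar_def sum_negf sum_distrib_left sum_distrib_right)
  finally show ?thesis .
qed

text \<open>Multiplication by \<open>z - 1\<close> takes first differences. On the circle it
  contributes a factor \<open>\<bar>t\<bar>\<close>, and the integral of
  \<open>\<bar>t\<bar> * exp (- (a * t^2))\<close> is of order \<open>1 / a\<close>; without that
  factor only the inverse square root of the variance would come out, too weak for the exchange
  argument.\<close>

lemma norm_coeff_PB_diff_le:
  assumes fin: "finite S" and p: "\<And>i. i \<in> S \<Longrightarrow> 0 \<le> p i \<and> p i \<le> 1" and V: "PBvar p S > 0"
  shows "norm (coeff ([:-1, 1:] * PB p S) j) \<le> 1 / PBvar p S"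
proof -
  let ?V = "PBvar p S"
  \<comment> \<open>The decay rate in \<open>norm_poly_PB_cis_le\<close>.\<close>
  define a where "a = 2 * ?V / pi\<^sup>2"
  have a: "a > 0" using V by (simp add: a_def)
  let ?h = "\<lambda>t. exp (- (a * t\<^sup>2))"
  \<comment> \<open>\<open>- ?G\<close> is an antiderivative of \<open>t * ?h t\<close>. The
    interval is split at 0 to resolve the absolute value.\<close>
  let ?G = "\<lambda>t. ?h t / (2 * a)"
  have R: "((\<lambda>t. \<bar>t\<bar> * ?h t) has_integral (- ?G pi - - ?G 0)) {0..pi}"
  proof (rule fundamental_theorem_of_calculus)
    fix t assume t: "t \<in> {0..pi}"
    show "((\<lambda>t. - ?G t) has_vector_derivative \<bar>t\<bar> * ?h t) (at t within {0..pi})"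
      unfolding has_real_derivative_iff_has_vector_derivative[symmetric]
      using a t by (auto intro!: derivative_eq_intros)
  qed simp
  have L: "((\<lambda>t. \<bar>t\<bar> * ?h t) has_integral (?G 0 - ?G (-pi))) {-pi..0}"
  proof (rule fundamental_theorem_of_calculus)
    fix t assume t: "t \<in> {-pi..0}"
    show "((\<lambda>t. ?G t) has_vector_derivative \<bar>t\<bar> * ?h t) (at t within {-pi..0})"
      unfolding has_real_derivative_iff_has_vector_derivative[symmetric]
      using a t by (auto intro!: derivative_eq_intros)
  qed simp
  have I: "((\<lambda>t. \<bar>t\<bar> * ?h t) has_integral ((?G 0 - ?G (-pi)) + (- ?G pi - - ?G 0))) {-pi..pi}"
    by (rule has_integral_combine[OF _ _ L R]) auto
  have "2 * pi * norm (coeff ([:-1, 1:] * PB p S) j) \<le> (?G 0 - ?G (-pi)) + (- ?G pi - - ?G 0)"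
  proof (rule norm_coeff_le_integral[OF I])
    fix t assume t: "t \<in> {-pi..pi}"
    then have "norm (poly (PB p S) (cis t)) \<le> exp (- (2 * ?V * (t / pi)\<^sup>2))"
      using fin p by (intro norm_poly_PB_cis_le) auto
    also have "2 * ?V * (t / pi)\<^sup>2 = a * t\<^sup>2" by (simp add: a_def power_divide)
    finally have "norm (cis t - 1) * norm (poly (PB p S) (cis t)) \<le> \<bar>t\<bar> * ?h t"
      using norm_cis_diff_1[of t] by (intro mult_mono) auto
    then show "norm (poly ([:-1, 1:] * PB p S) (cis t)) \<le> \<bar>t\<bar> * ?h t"
      by (simp only: poly_mult norm_mult poly_pCons poly_0) (simp add: norm_minus_commute algebra_simps)
  qed
  also have "\<dots> \<le> 1 / a" using a by (simp add: field_simps)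
  finally have "2 * pi * norm (coeff ([:-1, 1:] * PB p S) j) \<le> pi\<^sup>2 / (2 * ?V)"
    by (simp add: a_def)
  then have "norm (coeff ([:-1, 1:] * PB p S) j) \<le> (pi / 4) / ?V"
    using V by (simp add: field_simps power2_eq_square)
  also have "\<dots> \<le> 1 / ?V" using V pi_less_4 by (intro divide_right_mono) auto
  finally show ?thesis .
qed

section \<open>Distribution functions and the effect of changing the probabilities\<close>

definition csum :: "nat \<Rightarrow> complex poly \<Rightarrow> complex" where
  "csum k F = (\<Sum>j<k. coeff F j)"

lemma csum_0 [simp]: "csum 0 F = 0"
  by (simp add: csum_def)

lemma csum_diff: "csum k (F - G) = csum k F - csum k G"
  by (simp add: csum_def sum_subtractf)

lemma csum_smult: "csum k (smult c F) = c * csum k F"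
  by (simp add: csum_def sum_distrib_left)

text \<open>For a generating function, \<open>csum k\<close> is the probability that the sum stays
  below \<open>k\<close>; multiplying by a Bernoulli factor is conditioning on one further
  variable.\<close>

lemma csum_linear_mult:
  "csum (Suc k) ([:a, b:] * F) = a * csum (Suc k) F + b * csum k F"
proof (induction k)
  case 0
  then show ?case by (simp add: csum_def)
next
  case (Suc k)
  have s: "csum (Suc l) G = csum l G + coeff G l" for l G by (simp add: csum_def)
  show ?case
    unfolding s[of "Suc k"] Suc.IH by (simp add: s algebra_simps)
qed

text \<open>Partial sums of first differences telescope, so a factor \<open>z - 1\<close> reduces a
  distribution function to a single coefficient.\<close>

lemma csum_diff_mult: "csum (Suc k) ([:-1, 1:] * F) = - coeff F k"
  unfolding csum_linear_mult by (simp add: csum_def)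

text \<open>Exchanging the factor of one item costs \<open>\<bar>p i - q i\<bar>\<close> times a
  single coefficient, which is at most 1; the remaining items enter through a convex combination.
  This bound is used only for the rounding error.\<close>

lemma norm_csum_PB_diff_le:
  assumes "finite S" "\<And>i. i \<in> S \<Longrightarrow> 0 \<le> p i \<and> p i \<le> 1" "\<And>i. i \<in> S \<Longrightarrow> 0 \<le> q i \<and> q i \<le> 1"
  shows "norm (csum k (PB p S) - csum k (PB q S)) \<le> (\<Sum>i\<in>S. \<bar>p i - q i\<bar>)"
  using assms
proof (induction S arbitrary: k rule: finite_induct)
  case empty
  then show ?case by simp
next
  case (insert i S)
  let ?e = "\<Sum>i\<in>S. \<bar>p i - q i\<bar>"
  have IH: "norm (csum k (PB p S) - csum k (PB q S)) \<le> ?e" for k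
    using insert by auto
  have p: "0 \<le> p i" "p i \<le> 1" using insert by auto
  show ?case
  proof (cases k)
    case 0
    then show ?thesis by (simp add: sum_nonneg)
  next
    case (Suc l)
    let ?c = "\<lambda>k. csum k (PB p S) - csum k (PB q S)"
    have "csum k (PB q S) = csum l (PB q S) + coeff (PB q S) l"
      by (simp add: csum_def Suc)
    then have "csum k (PB p (insert i S)) - csum k (PB q (insert i S)) =
        of_real (1 - p i) * ?c k + of_real (p i) * ?c l - of_real (p i - q i) * coeff (PB q S) l"
      unfolding Suc PB_insert[OF insert.hyps] csum_linear_mult by (simp add: algebra_simps)
    also have "norm \<dots> \<le> (1 - p i) * ?e + p i * ?e + \<bar>p i - q i\<bar> * 1"
    proof (intro norm_triangle_mono norm_triangle_le_diff add_mono)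
      show "norm (of_real (1 - p i) * ?c k) \<le> (1 - p i) * ?e"
        using p IH[of k] unfolding norm_mult norm_of_real by (intro mult_mono) auto
      show "norm (of_real (p i) * ?c l) \<le> p i * ?e"
        using p IH[of l] unfolding norm_mult norm_of_real by (intro mult_mono) auto
      show "norm (of_real (p i - q i) * coeff (PB q S) l) \<le> \<bar>p i - q i\<bar> * 1"
        unfolding norm_mult norm_of_real using insert
        by (intro mult_mono norm_coeff_PB_le_1) auto
    qed
    also have "\<dots> = (\<Sum>i\<in>insert i S. \<bar>p i - q i\<bar>)"
      using insert.hyps by (simp add: algebra_simps)
    finally show ?thesis .
  qed
qed

lemma PB_split_pair:
  assumes "finite S" "i \<in> S" "j \<in> S" "i \<noteq> j"
  shows "PB p S = [:1 - of_real (p i), of_real (p i):] * [:1 - of_real (p j), of_real (p j):] * PB p (S - {i, j})"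
proof -
  have "PB p S = PB p (insert i (insert j (S - {i, j})))"
    using assms by (intro arg_cong[where f = "PB p"]) auto
  also have "\<dots> = [:1 - of_real (p i), of_real (p i):] * ([:1 - of_real (p j), of_real (p j):] * PB p (S - {i, j}))"
    using assms by (subst PB_insert; (subst PB_insert)?) auto
  finally show ?thesis by (simp only: mult.assoc)
qed

lemma sum_split_pair:
  fixes f :: "'a \<Rightarrow> real"
  assumes "finite S" "i \<in> S" "j \<in> S" "i \<noteq> j"
  shows "sum f S = f i + f j + sum f (S - {i, j})"
proof -
  have "sum f S = sum f (insert i (insert j (S - {i, j})))"
    using assms by (intro arg_cong[where f = "sum f"]) auto
  then show ?thesis using assms by simp
qed

lemma bernoulli_var_le: "x * (1 - x) \<le> 1 / 4" for x :: real
proof -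
  have "0 \<le> (x - 1 / 2)\<^sup>2" by simp
  then show ?thesis by (simp add: power2_eq_square algebra_simps)
qed

text \<open>As \<open>x + y\<close> is fixed, the two quadratic factors differ by
  \<open>(x * y - p i * p j) * (z - 1)^2\<close>. One factor \<open>z - 1\<close> telescopes in
  \<open>csum\<close>, the other yields a first difference of the law of the remaining items, which
  is at most the inverse of their variance.\<close>

lemma norm_csum_PB_exchange_le:
  assumes fin: "finite S" and ij: "i \<in> S" "j \<in> S" "i \<noteq> j"
    and p: "\<And>i. i \<in> S \<Longrightarrow> 0 \<le> p i \<and> p i \<le> 1"
    and xy: "x + y = p i + p j"
    and V: "0 < V" "V \<le> PBvar p S"
  shows "norm (csum k (PB (p(i := x, j := y)) S) - csum k (PB p S)) \<le> 2 / V * \<bar>x * y - p i * p j\<bar>"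
proof (cases k)
  case 0
  then show ?thesis using V by simp
next
  case (Suc l)
  let ?R = "PB p (S - {i, j})" and ?W = "PBvar p (S - {i, j})"
  let ?c = "norm (coeff ([:-1, 1:] * ?R) l)"
  have R: "PB (p(i := x, j := y)) (S - {i, j}) = ?R" by (rule PB_cong) auto
  have y: "y = p i + p j - x" using xy by simp
  have eq: "PB (p(i := x, j := y)) S - PB p S
      = smult (of_real (x * y - p i * p j)) ([:-1, 1:] * ([:-1, 1:] * ?R))"
  proof -
    have e: "[:1 - of_real x, of_real x:] * [:1 - of_real y, of_real y:]
        - [:1 - of_real (p i), of_real (p i):] * [:1 - of_real (p j), of_real (p j):]
        = smult (complex_of_real (x * y - p i * p j)) ([:-1, 1:] * [:-1, 1:])"
      unfolding y by (simp add: algebra_simps)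
    have f: "PB (p(i := x, j := y)) S = [:1 - of_real x, of_real x:] * [:1 - of_real y, of_real y:] * ?R"
      using PB_split_pair[OF fin ij, of "p(i := x, j := y)"] ij(3)
      by (simp only: R fun_upd_apply ij(3) if_True if_False refl)
    have "PB (p(i := x, j := y)) S - PB p S = ([:1 - of_real x, of_real x:] * [:1 - of_real y, of_real y:]
        - [:1 - of_real (p i), of_real (p i):] * [:1 - of_real (p j), of_real (p j):]) * ?R"
      by (simp only: f PB_split_pair[OF fin ij, of p] left_diff_distrib)
    then show ?thesis by (simp only: e mult_smult_left mult.assoc)
  qed
  have "csum k (PB (p(i := x, j := y)) S) - csum k (PB p S)
      = - of_real (x * y - p i * p j) * coeff ([:-1, 1:] * ?R) l"
    unfolding csum_diff[symmetric] eq csum_smult Suc csum_diff_mult by (simp only: mult_minus_left mult_minus_right)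
  then have n: "norm (csum k (PB (p(i := x, j := y)) S) - csum k (PB p S)) = \<bar>x * y - p i * p j\<bar> * ?c"
    by (simp only: norm_mult norm_minus_cancel norm_of_real)
  have W0: "0 \<le> ?W" unfolding PBvar_def using p by (intro sum_nonneg mult_nonneg_nonneg) auto
  have "PBvar p S = p i * (1 - p i) + p j * (1 - p j) + ?W"
    unfolding PBvar_def by (rule sum_split_pair[OF fin ij])
  \<comment> \<open>Removing two items loses at most 1/4 of variance for each.\<close>
  then have VW: "V \<le> ?W + 1 / 2"
    using V bernoulli_var_le[of "p i"] bernoulli_var_le[of "p j"] by linarith
  have c2: "?c \<le> 2"
  proof -
    have b: "norm (coeff ?R a) \<le> 1" for a
      using fin p by (intro norm_coeff_PB_le_1) auto
    have "coeff ([:-1, 1:] * ?R) l = (case l of 0 \<Rightarrow> 0 | Suc a \<Rightarrow> coeff ?R a) - coeff ?R l"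
      by (simp split: nat.splits)
    also have "norm \<dots> \<le> 1 + 1"
      by (intro order_trans[OF norm_triangle_ineq4] add_mono) (auto simp: b split: nat.splits)
    finally show ?thesis by simp
  qed
  have "?W * ?c \<le> 1"
  proof (cases "?W = 0")
    case False
    then have "?c \<le> 1 / ?W" using W0 fin p by (intro norm_coeff_PB_diff_le) auto
    then show ?thesis using False W0 by (simp add: field_simps)
  qed simp
  \<comment> \<open>The trivial bound \<open>?c \<le> 2\<close> pays for the lost 1/2, so that
    \<open>?W\<close> may be arbitrarily small or 0.\<close>
  then have "(?W + 1 / 2) * ?c \<le> 2" using c2 by (simp add: algebra_simps)
  moreover have "V * ?c \<le> (?W + 1 / 2) * ?c" using VW by (intro mult_right_mono) auto
  ultimately have "?c \<le> 2 / V" using V by (simp add: field_simps)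
  then have "\<bar>x * y - p i * p j\<bar> * ?c \<le> \<bar>x * y - p i * p j\<bar> * (2 / V)"
    by (intro mult_left_mono) auto
  then show ?thesis unfolding n by (simp only: mult.commute)
qed

text \<open>Moving two deviations from the mean of a class towards each other until one of them vanishes
  changes the variance and the distribution function by comparable amounts.\<close>

lemma norm_csum_PB_smooth_le:
  fixes cls :: "'a \<Rightarrow> 'b"
  assumes fin: "finite S"
    and p: "\<And>i. i \<in> S \<Longrightarrow> 0 \<le> p i \<and> p i \<le> 1"
    and mean: "\<And>c. (\<Sum>i\<in>{i\<in>S. cls i = c}. p i - M c) = 0"
    and V: "0 < V" "V \<le> PBvar p S"
  shows "norm (csum k (PB (\<lambda>i. M (cls i)) S) - csum k (PB p S)) \<le> 1 / V * (\<Sum>i\<in>S. (p i - M (cls i))\<^sup>2)"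
  using p mean V(2)
\<comment> \<open>Every exchange brings at least one item to its class mean and moves none away from
  it, so the number of deviating items decreases.\<close>
proof (induction "card {i\<in>S. p i \<noteq> M (cls i)}" arbitrary: p rule: less_induct)
  case less
  note p = less.prems(1) and mean = less.prems(2) and Vp = less.prems(3)
  show ?case
  proof (cases "\<forall>i\<in>S. p i = M (cls i)")
    case True
    then have "PB (\<lambda>i. M (cls i)) S = PB p S" by (intro PB_cong) auto
    then show ?thesis using V by (simp add: sum_nonneg)
  next
    case False
    then obtain a where a: "a \<in> S" "p a \<noteq> M (cls a)" by auto
    define C where "C = {i\<in>S. cls i = cls a}"
    have C: "finite C" "(\<Sum>i\<in>C. p i - M (cls a)) = 0" "a \<in> C"
      using fin mean[of "cls a"] a by (auto simp: C_def)
    \<comment> \<open>The deviations in the class of \<open>a\<close> sum to 0 and are not all 0, so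
      both signs occur.\<close>
    have "\<exists>i\<in>C. p i < M (cls a)"
    proof (rule ccontr)
      assume "\<not> ?thesis"
      then have "\<forall>i\<in>C. 0 \<le> p i - M (cls a)" by force
      then have "p a - M (cls a) = 0" using C by (subst (asm) sum_nonneg_eq_0_iff) auto
      then show False using a by simp
    qed
    then obtain i where i: "i \<in> C" "p i < M (cls a)" by auto
    have "\<exists>i\<in>C. M (cls a) < p i"
    proof (rule ccontr)
      assume "\<not> ?thesis"
      then have "\<forall>i\<in>C. 0 \<le> M (cls a) - p i" by force
      moreover have "(\<Sum>i\<in>C. M (cls a) - p i) = 0"
        using C(2) by (simp add: sum_subtractf)
      ultimately have "M (cls a) - p a = 0" using C by (subst (asm) sum_nonneg_eq_0_iff) auto
      then show False using a by simp
    qed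
    then obtain j where j: "j \<in> C" "M (cls a) < p j" by auto
    define m where "m = M (cls a)"
    \<comment> \<open>The smaller of the two gaps: neither value overshoots the mean and one of them
      reaches it.\<close>
    define d where "d = min (m - p i) (p j - m)"
    define x where "x = p i + d"
    define y where "y = p j - d"
    have ij: "i \<in> S" "j \<in> S" "i \<noteq> j" "cls i = cls a" "cls j = cls a"
      using i j by (auto simp: C_def)
    have d: "d > 0" "x \<le> m" "m \<le> y" "x = m \<or> y = m"
      using i j by (auto simp: d_def m_def x_def y_def)
    let ?q = "p(i := x, j := y)"
    have q: "0 \<le> ?q l \<and> ?q l \<le> 1" if "l \<in> S" for l
      using p[OF that] p[OF ij(1)] p[OF ij(2)] d by (auto simp: x_def y_def)
    have delta: "x * y - p i * p j = d * (y - p i)" by (simp add: x_def y_def algebra_simps)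
    have delta0: "0 \<le> x * y - p i * p j"
      unfolding delta using d by (intro mult_nonneg_nonneg) (auto simp: x_def)
    have meanq: "(\<Sum>l\<in>{l\<in>S. cls l = c}. ?q l - M c) = 0" for c
    proof (cases "c = cls a")
      case True
      have "(\<Sum>l\<in>C. ?q l - M c) = (?q i - M c) + (?q j - M c) + (\<Sum>l\<in>C - {i, j}. ?q l - M c)"
        using C(1) i(1) j(1) ij(3) by (intro sum_split_pair) auto
      also have "(\<Sum>l\<in>C - {i, j}. ?q l - M c) = (\<Sum>l\<in>C - {i, j}. p l - M c)"
        by (intro sum.cong) auto
      also have "(?q i - M c) + (?q j - M c) + \<dots> = (p i - M c) + (p j - M c) + (\<Sum>l\<in>C - {i, j}. p l - M c)"
        using ij by (simp add: x_def y_def)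
      also have "\<dots> = (\<Sum>l\<in>C. p l - M c)"
        using C(1) i(1) j(1) ij(3) by (intro sum_split_pair[symmetric]) auto
      finally have "(\<Sum>l\<in>C. ?q l - M c) = (\<Sum>l\<in>C. p l - M c)" .
      then show ?thesis using C(2) unfolding C_def True by (rule trans)
    next
      case False
      then have "(\<Sum>l\<in>{l\<in>S. cls l = c}. ?q l - M c) = (\<Sum>l\<in>{l\<in>S. cls l = c}. p l - M c)"
        using ij by (intro sum.cong) auto
      then show ?thesis using mean by simp
    qed
    have rest: "(\<Sum>l\<in>S - {i, j}. f (?q l) l) = (\<Sum>l\<in>S - {i, j}. f (p l) l)" for f :: "real \<Rightarrow> 'a \<Rightarrow> real"
      by (intro sum.cong) auto
    \<comment> \<open>The variance only grows, so the lower bound \<open>V\<close> is inherited by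
      the next round.\<close>
    have "PBvar ?q S = PBvar p S + 2 * (x * y - p i * p j)"
    proof -
      have "PBvar ?q S = x * (1 - x) + y * (1 - y) + (\<Sum>l\<in>S - {i, j}. p l * (1 - p l))"
        unfolding PBvar_def using ij sum_split_pair[OF fin ij(1-3), of "\<lambda>l. ?q l * (1 - ?q l)"]
          rest[of "\<lambda>v l. v * (1 - v)"] by simp
      moreover have "PBvar p S = p i * (1 - p i) + p j * (1 - p j) + (\<Sum>l\<in>S - {i, j}. p l * (1 - p l))"
        unfolding PBvar_def by (rule sum_split_pair[OF fin ij(1-3)])
      ultimately show ?thesis by (simp add: x_def y_def algebra_simps)
    qed
    then have Vq: "V \<le> PBvar ?q S" using Vp delta0 by simp
    \<comment> \<open>The squared deviations drop by twice the change of the product, which times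
      \<open>1 / V\<close> is exactly the cost of the exchange; the costs of all rounds therefore
      add up to the claimed bound.\<close>
    have dev: "(\<Sum>l\<in>S. (?q l - M (cls l))\<^sup>2) = (\<Sum>l\<in>S. (p l - M (cls l))\<^sup>2) - 2 * (x * y - p i * p j)"
    proof -
      have "(\<Sum>l\<in>S. (?q l - M (cls l))\<^sup>2) = (x - m)\<^sup>2 + (y - m)\<^sup>2 + (\<Sum>l\<in>S - {i, j}. (p l - M (cls l))\<^sup>2)"
        using ij sum_split_pair[OF fin ij(1-3), of "\<lambda>l. (?q l - M (cls l))\<^sup>2"]
          rest[of "\<lambda>v l. (v - M (cls l))\<^sup>2"] by (simp add: m_def)
      moreover have "(\<Sum>l\<in>S. (p l - M (cls l))\<^sup>2) = (p i - m)\<^sup>2 + (p j - m)\<^sup>2 + (\<Sum>l\<in>S - {i, j}. (p l - M (cls l))\<^sup>2)"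
        using ij sum_split_pair[OF fin ij(1-3), of "\<lambda>l. (p l - M (cls l))\<^sup>2"] by (simp add: m_def)
      ultimately show ?thesis by (simp add: x_def y_def power2_eq_square algebra_simps)
    qed
    have sub: "{l\<in>S. ?q l \<noteq> M (cls l)} \<subset> {l\<in>S. p l \<noteq> M (cls l)}"
    proof
      show "{l\<in>S. ?q l \<noteq> M (cls l)} \<subseteq> {l\<in>S. p l \<noteq> M (cls l)}"
      proof
        fix l assume l: "l \<in> {l\<in>S. ?q l \<noteq> M (cls l)}"
        show "l \<in> {l\<in>S. p l \<noteq> M (cls l)}"
        proof (cases "l = i \<or> l = j")
          case True
          then have "p l \<noteq> M (cls l)" using i(2) j(2) ij(4,5) by (metis less_irrefl)
          then show ?thesis using l by simp
        next
          case False
          then show ?thesis using l by simp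
        qed
      qed
      have "i \<in> {l\<in>S. p l \<noteq> M (cls l)}" "j \<in> {l\<in>S. p l \<noteq> M (cls l)}"
        using ij i(2) j(2) by simp_all
      moreover have "i \<notin> {l\<in>S. ?q l \<noteq> M (cls l)} \<or> j \<notin> {l\<in>S. ?q l \<noteq> M (cls l)}"
        using d(4) ij by (simp add: m_def)
      ultimately show "{l\<in>S. ?q l \<noteq> M (cls l)} \<noteq> {l\<in>S. p l \<noteq> M (cls l)}" by metis
    qed
    have card: "card {l\<in>S. ?q l \<noteq> M (cls l)} < card {l\<in>S. p l \<noteq> M (cls l)}"
      using fin sub by (intro psubset_card_mono) auto
    have "norm (csum k (PB (\<lambda>i. M (cls i)) S) - csum k (PB p S)) \<le>
        norm (csum k (PB (\<lambda>i. M (cls i)) S) - csum k (PB ?q S)) + norm (csum k (PB ?q S) - csum k (PB p S))"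
      by (rule norm_diff_triangle_le) auto
    also have "\<dots> \<le> 1 / V * (\<Sum>l\<in>S. (?q l - M (cls l))\<^sup>2) + 2 / V * \<bar>x * y - p i * p j\<bar>"
    proof (rule add_mono)
      show "norm (csum k (PB (\<lambda>i. M (cls i)) S) - csum k (PB ?q S)) \<le> 1 / V * (\<Sum>l\<in>S. (?q l - M (cls l))\<^sup>2)"
        by (rule less.hyps[OF card q meanq Vq])
      show "norm (csum k (PB ?q S) - csum k (PB p S)) \<le> 2 / V * \<bar>x * y - p i * p j\<bar>"
        using fin ij p V Vp by (intro norm_csum_PB_exchange_le) (auto simp: x_def y_def)
    qed
    also have "\<dots> = 1 / V * (\<Sum>i\<in>S. (p i - M (cls i))\<^sup>2)"
      using delta0 V unfolding dev by (simp add: field_simps)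
    finally show ?thesis .
  qed
qed

section \<open>Averaging the probabilities within classes\<close>

lemma sum_class_deviation_eq_0:
  fixes f :: "'b \<Rightarrow> real"
  assumes "finite S" "\<And>c. (\<Sum>i\<in>{i\<in>S. cls i = c}. q i - M c) = 0"
  shows "(\<Sum>i\<in>S. f (cls i) * (q i - M (cls i))) = 0"
proof -
  have "(\<Sum>i\<in>S. f (cls i) * (q i - M (cls i))) =
      (\<Sum>c\<in>cls ` S. \<Sum>i\<in>{i\<in>S. cls i = c}. f (cls i) * (q i - M (cls i)))"
    by (rule sum.image_gen[OF assms(1)])
  also have "\<dots> = (\<Sum>c\<in>cls ` S. f c * (\<Sum>i\<in>{i\<in>S. cls i = c}. q i - M c))"
    by (auto simp: sum_distrib_left intro!: sum.cong)
  finally show ?thesis using assms(2) by simp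
qed

text \<open>Averaging raises the variance by exactly \<open>?D\<close>, and
  \<open>?D \<le> 2 / K * ?V\<close>. As \<open>K \<ge> 4\<close>, at least \<open>?V / 2\<close> is
  present beforehand, so the smoothing bound \<open>1 / (?V / 2) * ?D\<close> is at most
  \<open>4 / K\<close> whatever \<open>?V\<close> is.\<close>

lemma norm_csum_PB_class_mean_le:
  fixes cls :: "'a \<Rightarrow> 'b"
  assumes fin: "finite S" and K: "K \<ge> 4"
    and q: "\<And>i. i \<in> S \<Longrightarrow> a (cls i) \<le> q i \<and> q i \<le> b (cls i)"
    and ab: "\<And>i. i \<in> S \<Longrightarrow> 0 \<le> a (cls i) \<and> b (cls i) \<le> 1 \<and> b (cls i) - a (cls i) \<le> 1 / K
      \<and> (b (cls i) \<le> 1 / 2 \<or> 1 / 2 \<le> a (cls i))"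
    and M: "\<And>i. i \<in> S \<Longrightarrow> a (cls i) \<le> M (cls i) \<and> M (cls i) \<le> b (cls i)"
    and mean: "\<And>c. (\<Sum>i\<in>{i\<in>S. cls i = c}. q i - M c) = 0"
  shows "norm (csum k (PB (\<lambda>i. M (cls i)) S) - csum k (PB q S)) \<le> 4 / K"
proof -
  let ?M = "\<lambda>i. M (cls i)"
  let ?V = "PBvar ?M S" and ?D = "\<Sum>i\<in>S. (q i - ?M i)\<^sup>2"
  \<comment> \<open>Removes every term that is linear in the deviation with a weight depending only
    on the class.\<close>
  note dev0 = sum_class_deviation_eq_0[OF fin mean]
  \<comment> \<open>A pointwise form of the Bhatia-Davis inequality: expanding
    \<open>(q - a) * (b - q) \<ge> 0\<close> around the mean leaves \<open>(M - a) * (b - M)\<close>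
    and a linear term that vanishes in the sum.\<close>
  have pt: "(q i - ?M i)\<^sup>2 \<le> 2 / K * (?M i * (1 - ?M i)) + (a (cls i) + b (cls i) - 2 * ?M i) * (q i - ?M i)"
    if i: "i \<in> S" for i
  proof -
    let ?a = "a (cls i)" and ?b = "b (cls i)"
    have "0 \<le> (q i - ?a) * (?b - q i)" using q[OF i] by (intro mult_nonneg_nonneg) auto
    then have "(q i - ?M i)\<^sup>2 \<le> (?M i - ?a) * (?b - ?M i) + (?a + ?b - 2 * ?M i) * (q i - ?M i)"
      by (simp add: power2_eq_square algebra_simps)
    moreover have "(?M i - ?a) * (?b - ?M i) \<le> 2 / K * (?M i * (1 - ?M i))"
    \<comment> \<open>The factor on the side of the nearer endpoint is at most \<open>?M i\<close>
      or \<open>1 - ?M i\<close>, the other one at most \<open>1 / K\<close>. The complementary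
      probability is at least 1/2, whence the constant 2.\<close>
    proof (cases "?b \<le> 1 / 2")
      case True
      have "(?M i - ?a) * (?b - ?M i) \<le> ?M i * (1 / K)"
        using ab[OF i] M[OF i] K by (intro mult_mono) auto
      also have "\<dots> \<le> ?M i * (1 / K) * (2 * (1 - ?M i))"
        using ab[OF i] M[OF i] K True mult_left_mono[of 1 "2 * (1 - ?M i)" "?M i * (1 / K)"] by auto
      finally show ?thesis by (simp add: algebra_simps)
    next
      case False
      have "(?M i - ?a) * (?b - ?M i) \<le> (1 / K) * (1 - ?M i)"
        using ab[OF i] M[OF i] K by (intro mult_mono) auto
      also have "\<dots> \<le> (1 / K) * (1 - ?M i) * (2 * ?M i)"
        using ab[OF i] M[OF i] K False mult_left_mono[of 1 "2 * ?M i" "(1 / K) * (1 - ?M i)"] by auto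
      finally show ?thesis by (simp add: algebra_simps)
    qed
    ultimately show ?thesis by linarith
  qed
  have "?D \<le> (\<Sum>i\<in>S. 2 / K * (?M i * (1 - ?M i)) + (a (cls i) + b (cls i) - 2 * ?M i) * (q i - ?M i))"
    by (intro sum_mono pt)
  also have "\<dots> = 2 / K * ?V"
    using dev0[of "\<lambda>c. a c + b c - 2 * M c"]
    by (simp add: sum.distrib PBvar_def sum_distrib_left)
  finally have D: "?D \<le> 2 / K * ?V" .
  have V0: "0 \<le> ?V" unfolding PBvar_def
  proof (intro sum_nonneg mult_nonneg_nonneg)
    fix i assume "i \<in> S"
    then show "0 \<le> ?M i" "0 \<le> 1 - ?M i" using ab[of i] M[of i] by auto
  qed
  have "PBvar q S = (\<Sum>i\<in>S. ?M i * (1 - ?M i) + (1 - 2 * ?M i) * (q i - ?M i) - (q i - ?M i)\<^sup>2)"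
    unfolding PBvar_def by (intro sum.cong) (auto simp: power2_eq_square algebra_simps)
  also have "\<dots> = ?V - ?D"
    using dev0[of "\<lambda>c. 1 - 2 * M c"] by (simp add: sum.distrib sum_subtractf PBvar_def)
  finally have Vq: "PBvar q S = ?V - ?D" .
  show ?thesis
  \<comment> \<open>The smoothing lemma needs a positive variance; if it is 0, all deviations
    vanish.\<close>
  proof (cases "?V = 0")
    case True
    then have "?D = 0" using D by (intro antisym sum_nonneg) auto
    then have "\<forall>i\<in>S. (q i - ?M i)\<^sup>2 = 0" using fin by (subst (asm) sum_nonneg_eq_0_iff) auto
    then have "PB ?M S = PB q S" by (intro PB_cong) auto
    then show ?thesis using K by simp
  next
    case False
    then have V: "0 < ?V / 2" using V0 by simp
    have "2 / K * ?V \<le> 1 / 2 * ?V" using V K by (intro mult_right_mono) (auto simp: field_simps)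
    then have "?V / 2 \<le> PBvar q S" using D Vq by simp
    then have "norm (csum k (PB ?M S) - csum k (PB q S)) \<le> 1 / (?V / 2) * ?D"
      by (intro norm_csum_PB_smooth_le[OF fin _ mean V]) (use q ab in \<open>meson order_trans\<close>)
    also have "\<dots> \<le> 1 / (?V / 2) * (2 / K * ?V)" using V D by (intro mult_left_mono) auto
    also have "\<dots> = 4 / K" using V by simp
    finally show ?thesis .
  qed
qed

text \<open>With one probability per class the generating function is a product of powers whose
  exponents are the class sizes.\<close>

lemma PB_class_eq:
  fixes cls :: "'a \<Rightarrow> 'b"
  assumes fin: "finite I" "finite J"
    and cnt: "\<And>c. card {i\<in>I. cls i = c} = card {i\<in>J. cls i = c}"
  shows "PB (\<lambda>i. M (cls i)) I = PB (\<lambda>i. M (cls i)) J"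
proof -
  have *: "PB (\<lambda>i. M (cls i)) A = (\<Prod>c\<in>cls ` (I \<union> J). [:1 - of_real (M c), of_real (M c):] ^ card {i\<in>A. cls i = c})"
    if "A \<subseteq> I \<union> J" for A
  proof -
    have "(\<Prod>c\<in>cls ` (I \<union> J). \<Prod>i\<in>{i\<in>A. cls i = c}. [:1 - complex_of_real (M (cls i)), of_real (M (cls i)):])
        = (\<Prod>i\<in>A. [:1 - of_real (M (cls i)), of_real (M (cls i)):])"
      using that fin by (intro prod.group) (auto intro: finite_subset)
    moreover have "(\<Prod>i\<in>{i\<in>A. cls i = c}. [:1 - complex_of_real (M (cls i)), of_real (M (cls i)):])
        = [:1 - of_real (M c), of_real (M c):] ^ card {i\<in>A. cls i = c}" for c
      by (simp flip: prod_constant)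
    ultimately show ?thesis by (simp add: PB_def)
  qed
  show ?thesis using *[of I] *[of J] cnt by simp
qed

text \<open>Equal class counts and class sums give equal class means, so both sets are compared with
  the same averaged law. Each comparison costs \<open>4 / K\<close> for averaging and at most
  \<open>1 / K\<close> for rounding, since at most \<open>N\<close> probabilities move by at most
  \<open>1 / (K * (N + 1))\<close> each.\<close>

lemma norm_csum_PB_same_classes_le:
  fixes g :: "'a \<Rightarrow> nat" and K N :: nat
  defines "G \<equiv> K * (N + 1)"
  assumes fin: "finite I" "finite J" and card: "card I \<le> N" "card J \<le> N"
    and K: "even K" "K \<ge> 4"
    and p: "\<And>i. i \<in> I \<union> J \<Longrightarrow> 0 \<le> p i \<and> p i \<le> 1"
    and g: "\<And>i. i \<in> I \<union> J \<Longrightarrow> g i \<le> G \<and> \<bar>p i - g i / G\<bar> \<le> 1 / G"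
    and cnt: "\<And>c. card {i\<in>I. g i div (N + 1) = c} = card {i\<in>J. g i div (N + 1) = c}"
    and tot: "\<And>c. (\<Sum>i\<in>{i\<in>I. g i div (N + 1) = c}. g i) = (\<Sum>i\<in>{i\<in>J. g i div (N + 1) = c}. g i)"
  shows "norm (csum k (PB p I) - csum k (PB p J)) \<le> 10 / K"
proof -
  define cls where "cls i = g i div (N + 1)" for i
  define q where "q i = real (g i) / G" for i
  define M where "M c = (\<Sum>i\<in>{i\<in>I. cls i = c}. q i) / card {i\<in>I. cls i = c}" for c
  have G: "G > 0" using K by (simp add: G_def)
  have MJ: "M c = (\<Sum>i\<in>{i\<in>J. cls i = c}. q i) / card {i\<in>J. cls i = c}" for c
    using cnt[of c] arg_cong[OF tot[of c], of real]
    by (simp add: M_def q_def cls_def flip: sum_divide_distrib)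
  have q01: "0 \<le> q i \<and> q i \<le> 1" if "i \<in> I \<union> J" for i
    using g[OF that] G by (auto simp: q_def divide_le_eq)
  have one: "norm (csum k (PB (\<lambda>i. M (cls i)) S) - csum k (PB p S)) \<le> 5 / K"
    if S: "S \<subseteq> I \<union> J" "card S \<le> N"
      and MS: "\<And>c. M c = (\<Sum>i\<in>{i\<in>S. cls i = c}. q i) / card {i\<in>S. cls i = c}" for S
  proof -
    have finS: "finite S" using S fin by (meson finite_Un finite_subset)
    define a where "a c = real c / K" for c
    \<comment> \<open>Class \<open>K\<close> contains only the level \<open>G\<close>, that is the
      value 1; the cap keeps its interval inside the unit interval.\<close>
    define b where "b c = min 1 (real (c + 1) / K)" for c
    have q: "a (cls i) \<le> q i \<and> q i \<le> b (cls i)" if "i \<in> S" for i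
    proof -
      have "g i < N + 1 + g i div (N + 1) * (N + 1)" by (rule dividend_less_div_times) simp
      then have "g i \<le> (cls i + 1) * (N + 1)"
        unfolding cls_def by (simp only: distrib_right mult_1)
      moreover have "cls i * (N + 1) \<le> g i"
        unfolding cls_def by (rule div_times_less_eq_dividend)
      ultimately have "real (cls i * (N + 1)) \<le> g i" "g i \<le> real ((cls i + 1) * (N + 1))"
        by linarith+
      then have "real (cls i * (N + 1)) / G \<le> q i" "q i \<le> real ((cls i + 1) * (N + 1)) / G"
        unfolding q_def by (intro divide_right_mono; simp)+
      then have "a (cls i) \<le> q i" "q i \<le> real (cls i + 1) / K"
        unfolding a_def G_def of_nat_mult by (simp_all del: of_nat_add of_nat_Suc)
      then show ?thesis using q01[of i] that S by (auto simp: b_def)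
    qed
    have ab: "0 \<le> a (cls i) \<and> b (cls i) \<le> 1 \<and> b (cls i) - a (cls i) \<le> 1 / K
      \<and> (b (cls i) \<le> 1 / 2 \<or> 1 / 2 \<le> a (cls i))" for i
    proof -
      \<comment> \<open>Evenness puts 1/2 on the boundary between the classes \<open>h - 1\<close>
        and \<open>h\<close>.\<close>
      obtain h where h: "K = 2 * h" using K by blast
      have "b (cls i) - a (cls i) \<le> real (cls i + 1) / K - real (cls i) / K"
        by (simp add: a_def b_def)
      also have "\<dots> = 1 / K" by (simp add: add_divide_distrib)
      finally have "b (cls i) - a (cls i) \<le> 1 / K" .
      moreover have "0 \<le> a (cls i)" "b (cls i) \<le> 1" by (simp_all add: a_def b_def)
      moreover have "b (cls i) \<le> 1 / 2" if "cls i < h"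
        unfolding b_def using that K h by (intro min.coboundedI2) (simp add: field_simps)
      moreover have "1 / 2 \<le> a (cls i)" if "h \<le> cls i"
        using that K h by (simp add: field_simps a_def)
      ultimately show ?thesis by (cases "cls i < h") auto
    qed
    have mean: "(\<Sum>i\<in>{i\<in>S. cls i = c}. q i - M c) = 0" for c
    proof (cases "{i\<in>S. cls i = c} = {}")
      case False
      then have "card {i\<in>S. cls i = c} \<noteq> 0" using finS by simp
      then show ?thesis using MS[of c] by (simp add: sum_subtractf)
    next
      case True
      show ?thesis unfolding True by simp
    qed
    have Mab: "a (cls i) \<le> M (cls i) \<and> M (cls i) \<le> b (cls i)" if i: "i \<in> S" for i
    proof -
      let ?C = "{j\<in>S. cls j = cls i}"
      have C: "card ?C > 0" using i finS by (auto simp: card_gt_0_iff)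
      have "real (card ?C) * a (cls i) \<le> (\<Sum>j\<in>?C. q j)"
        using q by (intro sum_bounded_below) force
      moreover have "(\<Sum>j\<in>?C. q j) \<le> real (card ?C) * b (cls i)"
        using q by (intro sum_bounded_above) force
      ultimately show ?thesis using C unfolding MS by (simp add: field_simps)
    qed
    have 1: "norm (csum k (PB (\<lambda>i. M (cls i)) S) - csum k (PB q S)) \<le> 4 / K"
      using norm_csum_PB_class_mean_le[OF finS _ q ab Mab mean] K by simp
    have "norm (csum k (PB q S) - csum k (PB p S)) \<le> (\<Sum>i\<in>S. \<bar>q i - p i\<bar>)"
      using finS S p q01 by (intro norm_csum_PB_diff_le) auto
    also have "\<dots> \<le> of_nat (card S) * (1 / G)"
      using S g by (intro sum_bounded_above) (auto simp: q_def abs_minus_commute)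
    also have "\<dots> \<le> real (N + 1) * (1 / G)" using S by (intro mult_right_mono) auto
    also have "\<dots> = 1 / K" unfolding G_def of_nat_mult using K by (simp del: of_nat_add of_nat_Suc)
    finally have 2: "norm (csum k (PB q S) - csum k (PB p S)) \<le> 1 / K" .
    have "norm (csum k (PB (\<lambda>i. M (cls i)) S) - csum k (PB p S)) \<le> 4 / K + 1 / K"
      using 1 2 by (rule norm_diff_triangle_le)
    then show ?thesis by simp
  qed
  have I: "norm (csum k (PB (\<lambda>i. M (cls i)) I) - csum k (PB p I)) \<le> 5 / K"
    using card by (intro one M_def) auto
  have J: "norm (csum k (PB (\<lambda>i. M (cls i)) J) - csum k (PB p J)) \<le> 5 / K"
    using card by (intro one MJ) auto
  have "PB (\<lambda>i. M (cls i)) I = PB (\<lambda>i. M (cls i)) J"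
    using fin cnt by (intro PB_class_eq) (auto simp: cls_def)
  then have "norm (csum k (PB p I) - csum k (PB p J)) \<le> 5 / K + 5 / K"
    using I J by (metis norm_diff_triangle_le norm_minus_commute)
  then show ?thesis by simp
qed

section \<open>From generating functions to the objective value\<close>

lemma prob_bernoulli_sum_ge:
  fixes p :: "nat \<Rightarrow> real"
  assumes "finite I" "\<And>i. i \<in> I \<Longrightarrow> 0 \<le> p i \<and> p i \<le> 1"
  shows "complex_of_real (measure_pmf.prob (Pi_pmf I False (\<lambda>i. bernoulli_pmf (p i)))
      {\<omega>. (\<Sum>i\<in>I. of_bool (\<omega> i) :: nat) \<ge> k}) = 1 - csum k (PB p I)"
  using assms
proof (induction I arbitrary: k rule: finite_induct)
  case empty
  then show ?case by (cases k) (auto simp: csum_def sum.lessThan_Suc_shift)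
next
  case (insert i I)
  let ?D = "\<lambda>I. Pi_pmf I False (\<lambda>i. bernoulli_pmf (p i))"
  let ?P = "\<lambda>I k. measure_pmf.prob (?D I) {\<omega>. (\<Sum>i\<in>I. of_bool (\<omega> i) :: nat) \<ge> k}"
  have p: "0 \<le> p i" "p i \<le> 1" using insert by auto
  show ?case
  proof (cases k)
    case 0
    then show ?thesis by simp
  next
    case (Suc l)
    have s: "(\<Sum>j\<in>insert i I. of_bool ((f(i := y)) j) :: nat) = of_bool y + (\<Sum>j\<in>I. of_bool (f j))" for f y
    proof -
      have "(\<Sum>j\<in>I. of_bool ((f(i := y)) j) :: nat) = (\<Sum>j\<in>I. of_bool (f j))"
        using insert.hyps by (intro sum.cong) auto
      then show ?thesis using insert.hyps by (subst sum.insert) (simp_all only: fun_upd_same not_False_eq_True)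
    qed
    have v: "(\<lambda>f. f(i := y)) -` {\<omega>. (\<Sum>j\<in>insert i I. of_bool (\<omega> j) :: nat) \<ge> k}
        = {\<omega>. (\<Sum>j\<in>I. of_bool (\<omega> j) :: nat) \<ge> (if y then l else k)}" for y
      unfolding vimage_def mem_Collect_eq s by (auto simp: Suc)
    have "?D (insert i I) = bernoulli_pmf (p i) \<bind> (\<lambda>y. map_pmf (\<lambda>f. f(i := y)) (?D I))"
      using insert.hyps by (subst Pi_pmf_insert') (auto simp: map_pmf_def)
    then have "?P (insert i I) k = measure_pmf.expectation (bernoulli_pmf (p i))
        (\<lambda>y. measure_pmf.prob (map_pmf (\<lambda>f. f(i := y)) (?D I)) {\<omega>. (\<Sum>j\<in>insert i I. of_bool (\<omega> j) :: nat) \<ge> k})"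
      by (simp only: measure_pmf_bind)
        (rule measure_pmf.measure_bind[where N = "count_space UNIV"], auto intro: measure_pmf_in_subprob_algebra)
    also have "\<dots> = p i * ?P I l + (1 - p i) * ?P I k"
      unfolding measure_map_pmf v using p by (subst integral_bernoulli_pmf) auto
    \<comment> \<open>The same recursion as \<open>csum_linear_mult\<close>, so the induction closes
      by algebra.\<close>
    finally have e: "?P (insert i I) k = p i * ?P I l + (1 - p i) * ?P I k" .
    have IH: "complex_of_real (?P I k) = 1 - csum k (PB p I)" for k
      using insert by simp
    show ?thesis
      unfolding e of_real_add of_real_mult of_real_diff of_real_1 IH
      unfolding PB_insert[OF insert.hyps] Suc csum_linear_mult by (simp add: algebra_simps)
  qed
qed

text \<open>The profits live on all items; those outside \<open>I\<close> are marginalised out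
  first.\<close>

lemma mku_value_eq_csum:
  assumes "mku_instance X" "I \<subseteq> {1..nitems X}"
  shows "complex_of_real (mku_value X I) = 1 - csum (target X) (PB (iprob X) I)"
proof -
  have fin: "finite I" using assms finite_subset by auto
  have sub: "Pi_pmf I False (\<lambda>i. bernoulli_pmf (iprob X i)) =
      map_pmf (\<lambda>f x. if x \<in> I then f x else False) (profits X)"
    unfolding profits_def by (rule Pi_pmf_subset) (use assms in auto)
  have "(\<lambda>f x. if x \<in> I then f x else False) -` {\<omega>. (\<Sum>i\<in>I. of_bool (\<omega> i) :: nat) \<ge> target X}
      = {\<omega>. (\<Sum>i\<in>I. of_bool (\<omega> i) :: nat) \<ge> target X}"
    by (auto cong: sum.cong)
  then have "mku_value X I = measure_pmf.prob (Pi_pmf I False (\<lambda>i. bernoulli_pmf (iprob X i)))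
      {\<omega>. (\<Sum>i\<in>I. of_bool (\<omega> i) :: nat) \<ge> target X}"
    by (simp add: sub mku_value_def)
  then show ?thesis
    using prob_bernoulli_sum_ge[OF fin, of "iprob X" "target X"] assms
    by (auto simp: mku_instance_def)
qed

section \<open>Keys\<close>

lemma sum_digits_less:
  fixes D :: nat
  assumes "\<And>e. e < n \<Longrightarrow> a e < D"
  shows "(\<Sum>e<n. a e * D ^ e) < D ^ n"
  using assms
proof (induction n)
  case 0
  then show ?case by simp
next
  case (Suc n)
  have "(\<Sum>e<Suc n. a e * D ^ e) < a n * D ^ n + D ^ n" using Suc by simp
  also have "\<dots> = (a n + 1) * D ^ n" by simp
  also have "\<dots> \<le> D * D ^ n" using Suc.prems[of n] by (intro mult_right_mono) auto
  finally show ?case by simp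
qed

text \<open>The lower digits sum to less than \<open>D ^ n\<close>, so division by
  \<open>D ^ n\<close> isolates the leading digit.\<close>

lemma sum_digits_unique:
  fixes D :: nat
  assumes "(\<Sum>e<n. a e * D ^ e) = (\<Sum>e<n. b e * D ^ e)"
    and "\<And>e. e < n \<Longrightarrow> a e < D" "\<And>e. e < n \<Longrightarrow> b e < D" "e < n"
  shows "a e = b e"
  using assms
proof (induction n)
  case 0
  then show ?case by simp
next
  case (Suc n)
  let ?s = "\<lambda>a. \<Sum>e<n. a e * D ^ e"
  have s: "?s a < D ^ n" "?s b < D ^ n" using Suc.prems by (auto intro: sum_digits_less)
  have D: "D ^ n > 0" using s(1) by linarith
  have eq: "?s a + a n * D ^ n = ?s b + b n * D ^ n" using Suc.prems by simp
  have "a n = (?s a + a n * D ^ n) div D ^ n" using s D by simp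
  also have "\<dots> = (?s b + b n * D ^ n) div D ^ n" by (simp only: eq)
  also have "\<dots> = b n" using s D by simp
  finally have n: "a n = b n" .
  then have "?s a = ?s b" using eq by simp
  then have "e < n \<Longrightarrow> a e = b e" using Suc.prems by (intro Suc.IH) auto
  then show ?case using n Suc.prems(4) by (cases "e = n") simp_all
qed

definition plevel :: "nat \<Rightarrow> mku \<Rightarrow> nat \<Rightarrow> nat" where
  "plevel K X i = nat \<lfloor>iprob X i * real (K * (nitems X + 1))\<rfloor>"

text \<open>For a valid instance and positive \<open>K\<close>, class \<open>K\<close> is reached
  only at probability 1.\<close>

definition pclass :: "nat \<Rightarrow> mku \<Rightarrow> nat \<Rightarrow> nat" where
  "pclass K X i = plevel K X i div (nitems X + 1)"

text \<open>Large enough to exclude carries: an item adds at most \<open>K * (n + 1) + 2\<close> to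
  a digit, and a set has at most \<open>n\<close> items.\<close>

definition base :: "nat \<Rightarrow> mku \<Rightarrow> nat" where
  "base K X = (K + 2) * (nitems X + 1) * (nitems X + 1)"

text \<open>The largest exponent in a key is \<open>m + 2 + 2 * K\<close>, for the sum of class
  \<open>K\<close>, and exponents start at 0.\<close>

definition ndigits :: "nat \<Rightarrow> mku \<Rightarrow> nat" where
  "ndigits K X = nblocks X + 2 * K + 3"

text \<open>In base \<^const>\<open>base\<close>, the digits \<open>1, \<dots>, m\<close> of the key of a set count the items in the blocks, and
  the digits \<open>m + 1 + 2 l\<close> and \<open>m + 2 + 2 l\<close> hold the number of items in class \<open>l\<close> and the sum of
  their rounded probabilities.\<close>

definition ikey :: "nat \<Rightarrow> mku \<Rightarrow> nat \<Rightarrow> nat" where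
  "ikey K X i = base K X ^ blk X i + base K X ^ (nblocks X + 1 + 2 * pclass K X i)
     + plevel K X i * base K X ^ (nblocks X + 2 + 2 * pclass K X i)"

definition digit :: "nat \<Rightarrow> mku \<Rightarrow> nat \<Rightarrow> nat \<Rightarrow> nat" where
  "digit K X i e = of_bool (e = blk X i) + of_bool (e = nblocks X + 1 + 2 * pclass K X i)
     + plevel K X i * of_bool (e = nblocks X + 2 + 2 * pclass K X i)"

lemma plevel_le:
  assumes "mku_instance X" "i \<in> {1..nitems X}"
  shows "plevel K X i \<le> K * (nitems X + 1)"
proof -
  have "iprob X i * real (K * (nitems X + 1)) \<le> 1 * real (K * (nitems X + 1))"
    using assms by (intro mult_right_mono) (auto simp: mku_instance_def)
  then have "\<lfloor>iprob X i * real (K * (nitems X + 1))\<rfloor> \<le> int (K * (nitems X + 1))"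
    by (simp only: mult_1 floor_le_iff)
  then show ?thesis by (simp only: plevel_def nat_le_iff)
qed

lemma pclass_le:
  assumes "mku_instance X" "i \<in> {1..nitems X}"
  shows "pclass K X i \<le> K"
proof -
  have "pclass K X i \<le> K * (nitems X + 1) div (nitems X + 1)"
    unfolding pclass_def by (intro div_le_mono plevel_le assms)
  also have "\<dots> = K" by (rule div_mult_self_is_m) simp
  finally show ?thesis .
qed

lemma plevel_approx:
  assumes "mku_instance X" "i \<in> {1..nitems X}" "K > 0"
  shows "\<bar>iprob X i - plevel K X i / real (K * (nitems X + 1))\<bar> \<le> 1 / real (K * (nitems X + 1))"
proof -
  let ?G = "real (K * (nitems X + 1))"
  have G: "?G > 0" unfolding of_nat_0_less_iff using assms by simp
  have "0 \<le> iprob X i * ?G" using assms by (auto simp: mku_instance_def)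
  then have "real (plevel K X i) = of_int \<lfloor>iprob X i * ?G\<rfloor>"
    unfolding plevel_def by (subst of_nat_nat) (simp_all only: zero_le_floor)
  then have "\<bar>iprob X i * ?G - plevel K X i\<bar> \<le> 1" by linarith
  then have "\<bar>iprob X i * ?G - plevel K X i\<bar> / ?G \<le> 1 / ?G"
    using G by (intro divide_right_mono) auto
  moreover have "\<bar>iprob X i * ?G - plevel K X i\<bar> / ?G = \<bar>(iprob X i * ?G - plevel K X i) / ?G\<bar>"
    using G by simp
  moreover have "(iprob X i * ?G - plevel K X i) / ?G = iprob X i - plevel K X i / ?G"
    using G by (simp only: diff_divide_distrib) simp
  ultimately show ?thesis by (simp only:)
qed

text \<open>Makes the dynamic program refer from a key to a strictly smaller one.\<close>

lemma ikey_pos: "ikey K X i > 0"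
proof -
  have "0 < base K X ^ blk X i" by (simp add: base_def)
  then show ?thesis by (simp add: ikey_def)
qed

lemma ikey_digits:
  assumes "mku_instance X" "i \<in> {1..nitems X}"
  shows "ikey K X i = (\<Sum>e<ndigits K X. digit K X i e * base K X ^ e)"
proof -
  have "blk X i \<le> nblocks X" using assms by (auto simp: mku_instance_def)
  then have e: "blk X i < ndigits K X" "nblocks X + 1 + 2 * pclass K X i < ndigits K X"
    "nblocks X + 2 + 2 * pclass K X i < ndigits K X"
    using pclass_le[OF assms, of K] by (simp_all add: ndigits_def)
  have 1: "(\<Sum>e<ndigits K X. of_bool (e = a) * base K X ^ e) = base K X ^ a" if "a < ndigits K X" for a
    using that by (subst sum.mono_neutral_right[of _ "{a}"]) auto
  have 2: "(\<Sum>e<ndigits K X. (c * of_bool (e = a)) * base K X ^ e) = c * base K X ^ a" if "a < ndigits K X" for a c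
    unfolding mult.assoc sum_distrib_left[symmetric] using 1[OF that] by simp
  show ?thesis
    unfolding ikey_def digit_def distrib_right sum.distrib 1[OF e(1)] 1[OF e(2)] 2[OF e(3)] ..
qed

lemma sum_ikey_digits:
  assumes "mku_instance X" "I \<subseteq> {1..nitems X}"
  shows "(\<Sum>i\<in>I. ikey K X i) = (\<Sum>e<ndigits K X. (\<Sum>i\<in>I. digit K X i e) * base K X ^ e)"
proof -
  have "(\<Sum>i\<in>I. ikey K X i) = (\<Sum>i\<in>I. \<Sum>e<ndigits K X. digit K X i e * base K X ^ e)"
    using assms by (intro sum.cong ikey_digits) auto
  also have "\<dots> = (\<Sum>e<ndigits K X. (\<Sum>i\<in>I. digit K X i e) * base K X ^ e)"
    unfolding sum_distrib_right by (rule sum.swap)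
  finally show ?thesis .
qed

lemma sum_digit_less:
  assumes "mku_instance X" "I \<subseteq> {1..nitems X}"
  shows "(\<Sum>i\<in>I. digit K X i e) < base K X"
proof -
  let ?n = "nitems X"
  have "digit K X i e \<le> 2 + K * (?n + 1)" if "i \<in> I" for i
  proof -
    have "plevel K X i * of_bool b \<le> K * (?n + 1)" for b
      using plevel_le[of X i K] assms that by (cases b) auto
    then show ?thesis
      unfolding digit_def by (intro add_mono) (auto intro: order_trans[of _ "1 + 1"] add_mono)
  qed
  then have "(\<Sum>i\<in>I. digit K X i e) \<le> card I * (2 + K * (?n + 1))"
    using sum_bounded_above[of I "\<lambda>i. digit K X i e" "2 + K * (?n + 1)"] by simp
  also have "\<dots> \<le> ?n * ((K + 2) * (?n + 1))"
    using card_mono[OF _ assms(2)] by (intro mult_mono) auto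
  also have "\<dots> < base K X" by (simp add: base_def)
  finally show ?thesis .
qed

lemma sum_ikey_less:
  assumes "mku_instance X" "I \<subseteq> {1..nitems X}"
  shows "(\<Sum>i\<in>I. ikey K X i) < base K X ^ ndigits K X"
  unfolding sum_ikey_digits[OF assms] by (intro sum_digits_less sum_digit_less assms)

lemma sum_of_bool_eq_card:
  assumes "finite I"
  shows "(\<Sum>i\<in>I. of_bool (P i)) = card {i\<in>I. P i}"
  using assms by (simp add: Int_def)

text \<open>Without carries, equal keys have equal digits. The digits up to \<open>m\<close> give
  the block counts, the others the class counts and class sums that the analytic comparison
  requires.\<close>

lemma same_key_solutions:
  assumes X: "mku_instance X" and I: "I \<subseteq> {1..nitems X}" and J: "J \<subseteq> {1..nitems X}"
    and eq: "(\<Sum>i\<in>I. ikey K X i) = (\<Sum>i\<in>J. ikey K X i)"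
    and K: "even K" "K \<ge> 4"
  shows "\<And>j. j \<in> {1..nblocks X} \<Longrightarrow> card (I \<inter> block X j) = card (J \<inter> block X j)"
    and "\<bar>mku_value X I - mku_value X J\<bar> \<le> 10 / K"
proof -
  let ?n = "nitems X" and ?m = "nblocks X"
  have fin: "finite I" "finite J" using I J finite_subset by auto
  have dig: "(\<Sum>i\<in>I. digit K X i e) = (\<Sum>i\<in>J. digit K X i e)" if "e < ndigits K X" for e
    using eq[unfolded sum_ikey_digits[OF X I] sum_ikey_digits[OF X J]]
    by (rule sum_digits_unique[OF _ _ _ that]) (intro sum_digit_less X I J)+
  have blk: "blk X i \<le> ?m" if "i \<in> {1..?n}" for i
    using X that by (auto simp: mku_instance_def)
  show "card (I \<inter> block X j) = card (J \<inter> block X j)" if j: "j \<in> {1..?m}" for j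
  proof -
    have "(\<Sum>i\<in>A. digit K X i j) = card (A \<inter> block X j)" if A: "A \<subseteq> {1..?n}" for A
    proof -
      have "(\<Sum>i\<in>A. digit K X i j) = (\<Sum>i\<in>A. of_bool (blk X i = j))"
        using j by (intro sum.cong) (auto simp: digit_def)
      also have "\<dots> = card {i\<in>A. blk X i = j}"
        using A finite_subset by (intro sum_of_bool_eq_card) auto
      also have "{i\<in>A. blk X i = j} = A \<inter> block X j" using A by (auto simp: block_def)
      finally show ?thesis .
    qed
    then show ?thesis using dig[of j] I J j by (simp add: ndigits_def)
  qed
  have cnt: "card {i\<in>I. plevel K X i div (?n + 1) = c} = card {i\<in>J. plevel K X i div (?n + 1) = c}"
    and tot: "(\<Sum>i\<in>{i\<in>I. plevel K X i div (?n + 1) = c}. plevel K X i) = (\<Sum>i\<in>{i\<in>J. plevel K X i div (?n + 1) = c}. plevel K X i)" for c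
  proof -
    have e: "(\<Sum>i\<in>A. digit K X i (?m + 1 + 2 * c)) = card {i\<in>A. plevel K X i div (?n + 1) = c}"
        "(\<Sum>i\<in>A. digit K X i (?m + 2 + 2 * c)) = (\<Sum>i\<in>{i\<in>A. plevel K X i div (?n + 1) = c}. plevel K X i)"
      if A: "A \<subseteq> {1..?n}" for A
    proof -
      have finA: "finite A" using A finite_subset by auto
      have "digit K X i (?m + 1 + 2 * c) = of_bool (pclass K X i = c)" if "i \<in> A" for i
      proof -
        have "?m + 1 + 2 * c \<noteq> blk X i" using blk[of i] that A by auto
        \<comment> \<open>Counts and sums of classes sit at digits of different parity relative to
          \<open>m\<close>.\<close>
        moreover have "?m + 1 + 2 * c \<noteq> ?m + 2 + 2 * pclass K X i" by presburger
        ultimately show ?thesis by (auto simp: digit_def)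
      qed
      then have "(\<Sum>i\<in>A. digit K X i (?m + 1 + 2 * c)) = (\<Sum>i\<in>A. of_bool (pclass K X i = c))" by simp
      then show "(\<Sum>i\<in>A. digit K X i (?m + 1 + 2 * c)) = card {i\<in>A. plevel K X i div (?n + 1) = c}"
        using sum_of_bool_eq_card[OF finA, of "\<lambda>i. pclass K X i = c"] by (simp add: pclass_def)
      have "digit K X i (?m + 2 + 2 * c) = (if pclass K X i = c then plevel K X i else 0)" if "i \<in> A" for i
      proof -
        have "?m + 2 + 2 * c \<noteq> blk X i" using blk[of i] that A by auto
        moreover have "?m + 2 + 2 * c \<noteq> ?m + 1 + 2 * pclass K X i" by presburger
        ultimately show ?thesis by (auto simp: digit_def)
      qed
      then have "(\<Sum>i\<in>A. digit K X i (?m + 2 + 2 * c)) = (\<Sum>i\<in>A. if pclass K X i = c then plevel K X i else 0)" by simp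
      also have "\<dots> = (\<Sum>i\<in>{i\<in>A. pclass K X i = c}. plevel K X i)"
        using finA by (rule sum.inter_filter[symmetric])
      finally show "(\<Sum>i\<in>A. digit K X i (?m + 2 + 2 * c)) = (\<Sum>i\<in>{i\<in>A. plevel K X i div (?n + 1) = c}. plevel K X i)"
        by (simp only: pclass_def)
    qed
    show "card {i\<in>I. plevel K X i div (?n + 1) = c} = card {i\<in>J. plevel K X i div (?n + 1) = c}"
        "(\<Sum>i\<in>{i\<in>I. plevel K X i div (?n + 1) = c}. plevel K X i) = (\<Sum>i\<in>{i\<in>J. plevel K X i div (?n + 1) = c}. plevel K X i)"
    proof -
      consider (le) "c \<le> K" | (gt) "c > K" by linarith
      then have "card {i\<in>I. plevel K X i div (?n + 1) = c} = card {i\<in>J. plevel K X i div (?n + 1) = c} \<and>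
        (\<Sum>i\<in>{i\<in>I. plevel K X i div (?n + 1) = c}. plevel K X i) = (\<Sum>i\<in>{i\<in>J. plevel K X i div (?n + 1) = c}. plevel K X i)"
      proof cases
        case le
        then have "?m + 1 + 2 * c < ndigits K X" "?m + 2 + 2 * c < ndigits K X" by (auto simp: ndigits_def)
        then show ?thesis using dig unfolding e[OF I, symmetric] e[OF J, symmetric] by simp
      next
        \<comment> \<open>Classes above \<open>K\<close> lie outside the digits, but they are
          empty.\<close>
        case gt
        have "{i\<in>A. plevel K X i div (?n + 1) = c} = {}" if "A \<subseteq> {1..?n}" for A
          using pclass_le[OF X, of _ K] that gt unfolding pclass_def by fastforce
        from this[OF I] this[OF J] show ?thesis by (simp only: card.empty sum.empty)
      qed
      then show "card {i\<in>I. plevel K X i div (?n + 1) = c} = card {i\<in>J. plevel K X i div (?n + 1) = c}"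
        "(\<Sum>i\<in>{i\<in>I. plevel K X i div (?n + 1) = c}. plevel K X i) = (\<Sum>i\<in>{i\<in>J. plevel K X i div (?n + 1) = c}. plevel K X i)"
        by auto
    qed
  qed
  have IJ: "I \<union> J \<subseteq> {1..?n}" using I J by simp
  have "norm (csum (target X) (PB (iprob X) I) - csum (target X) (PB (iprob X) J)) \<le> 10 / K"
  proof (rule norm_csum_PB_same_classes_le[where g = "plevel K X" and N = ?n])
    show "card I \<le> ?n" "card J \<le> ?n" using card_mono[OF _ I] card_mono[OF _ J] by auto
    show "0 \<le> iprob X i \<and> iprob X i \<le> 1" if "i \<in> I \<union> J" for i
      using X IJ that by (auto simp: mku_instance_def)
    show "plevel K X i \<le> K * (?n + 1) \<and> \<bar>iprob X i - plevel K X i / real (K * (?n + 1))\<bar> \<le> 1 / real (K * (?n + 1))"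
      if "i \<in> I \<union> J" for i
      using that IJ K by (intro conjI plevel_le plevel_approx X) auto
  qed (use fin K cnt tot in auto)
  moreover have "csum (target X) (PB (iprob X) A) = 1 - complex_of_real (mku_value X A)" if "A \<subseteq> {1..?n}" for A
    using mku_value_eq_csum[OF X that] by simp
  ultimately have "norm (complex_of_real (mku_value X J - mku_value X I)) \<le> 10 / K"
    using I J by simp
  then show "\<bar>mku_value X I - mku_value X J\<bar> \<le> 10 / K"
    by (simp only: norm_of_real abs_minus_commute)
qed

section \<open>Tail probabilities by recursion\<close>

definition tailp :: "('a \<Rightarrow> real) \<Rightarrow> 'a set \<Rightarrow> nat \<Rightarrow> real" where
  "tailp p I k = Re (1 - csum k (PB p I))"

lemma tailp_0 [simp]: "tailp p I 0 = 1"
  by (simp add: tailp_def)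

lemma tailp_empty [simp]: "tailp p {} (Suc k) = 0"
  by (simp add: tailp_def csum_def sum.lessThan_Suc_shift)

text \<open>Conditioning on item \<open>i\<close>; this is the recursion that the program
  executes.\<close>

lemma tailp_insert:
  assumes "finite I" "i \<notin> I"
  shows "tailp p (insert i I) (Suc k) = p i * tailp p I k + (1 - p i) * tailp p I (Suc k)"
  unfolding tailp_def PB_insert[OF assms] csum_linear_mult by (simp add: algebra_simps)

text \<open>Covers targets above the number of items, for which the program keeps no table
  entry.\<close>

lemma tailp_eq_0:
  assumes "finite I" "card I < k"
  shows "tailp p I k = 0"
  using assms
proof (induction I arbitrary: k rule: finite_induct)
  case empty
  then show ?case by (cases k) auto
next
  case (insert i I)
  then show ?case by (cases k) (auto simp: tailp_insert)
qed

lemma mku_value_eq_tailp: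
  assumes "mku_instance X" "I \<subseteq> {1..nitems X}"
  shows "mku_value X I = tailp (iprob X) I (target X)"
  unfolding tailp_def mku_value_eq_csum[OF assms, symmetric] by simp

section \<open>Total correctness with running time\<close>

primrec nwrites :: "com \<Rightarrow> vname set" where
  "nwrites Skip = {}"
| "nwrites (NAssign x a e) = {x}"
| "nwrites (RAssign x a e) = {}"
| "nwrites (Seq c d) = nwrites c \<union> nwrites d"
| "nwrites (Cond b c d) = nwrites c \<union> nwrites d"
| "nwrites (While b c) = nwrites c"

primrec rwrites :: "com \<Rightarrow> vname set" where
  "rwrites Skip = {}"
| "rwrites (NAssign x a e) = {}"
| "rwrites (RAssign x a e) = {x}"
| "rwrites (Seq c d) = rwrites c \<union> rwrites d"
| "rwrites (Cond b c d) = rwrites c \<union> rwrites d"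
| "rwrites (While b c) = rwrites c"

lemma mem_upd [simp]:
  "nmem (nupd x i v s) = (nmem s)(x := (nmem s x)(i := v))" "rmem (nupd x i v s) = rmem s"
  "rmem (rupd x i w s) = (rmem s)(x := (rmem s x)(i := w))" "nmem (rupd x i w s) = nmem s"
  by (simp_all add: nupd_def rupd_def)

definition frame :: "vname set \<Rightarrow> vname set \<Rightarrow> state \<Rightarrow> state \<Rightarrow> bool" where
  "frame A B s s' \<longleftrightarrow> (\<forall>z. z \<notin> A \<longrightarrow> nmem s' z = nmem s z) \<and> (\<forall>z. z \<notin> B \<longrightarrow> rmem s' z = rmem s z)"

lemma frameN: "frame A B s s' \<Longrightarrow> z \<notin> A \<Longrightarrow> nmem s' z = nmem s z"
  by (simp add: frame_def)

lemma runs_frame: "runs c s t s' \<Longrightarrow> frame (nwrites c) (rwrites c) s s'"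
  by (induction rule: runs.induct) (auto simp: frame_def)

text \<open>An upper bound for the running time, valid if every loop makes at most \<open>W\<close> iterations.\<close>

primrec time_bound :: "nat \<Rightarrow> com \<Rightarrow> nat" where
  "time_bound W Skip = 1"
| "time_bound W (NAssign x a e) = 1 + ncost a + ncost e"
| "time_bound W (RAssign x a e) = 1 + ncost a + rcost e"
| "time_bound W (Seq c d) = time_bound W c + time_bound W d"
| "time_bound W (Cond b c d) = 1 + bcost b + (time_bound W c + time_bound W d)"
| "time_bound W (While b c) = (W + 1) * (1 + bcost b + time_bound W c)"

primrec depth :: "com \<Rightarrow> nat" where
  "depth Skip = 0"
| "depth (NAssign x a e) = 0"
| "depth (RAssign x a e) = 0"
| "depth (Seq c d) = max (depth c) (depth d)"
| "depth (Cond b c d) = max (depth c) (depth d)"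
| "depth (While b c) = Suc (depth c)"

text \<open>Every level of loop nesting contributes one factor \<open>W + 1\<close>, and the
  coefficient depends on the program text alone.\<close>

lemma time_bound_le: "time_bound W c \<le> time_bound 0 c * (W + 1) ^ depth c"
proof (induction c)
  case (Seq c d)
  let ?e = "max (depth c) (depth d)"
  have "time_bound 0 c * (W + 1) ^ depth c \<le> time_bound 0 c * (W + 1) ^ ?e" "time_bound 0 d * (W + 1) ^ depth d \<le> time_bound 0 d * (W + 1) ^ ?e"
    by (intro mult_left_mono power_increasing; simp)+
  with Seq show ?case by (simp only: time_bound.simps depth.simps distrib_right)
next
  case (Cond b c d)
  let ?e = "max (depth c) (depth d)"
  have "time_bound 0 c * (W + 1) ^ depth c \<le> time_bound 0 c * (W + 1) ^ ?e" "time_bound 0 d * (W + 1) ^ depth d \<le> time_bound 0 d * (W + 1) ^ ?e"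
    by (intro mult_left_mono power_increasing; simp)+
  moreover have "(1 + bcost b) * 1 \<le> (1 + bcost b) * (W + 1) ^ ?e" by (intro mult_left_mono) auto
  ultimately have "(1 + bcost b) * 1 + (time_bound W c + time_bound W d)
      \<le> (1 + bcost b) * (W + 1) ^ ?e + (time_bound 0 c * (W + 1) ^ ?e + time_bound 0 d * (W + 1) ^ ?e)"
    using Cond by linarith
  then show ?case by (simp only: time_bound.simps depth.simps distrib_right mult_1_right)
next
  case (While b c)
  have "(1 + bcost b) * 1 \<le> (1 + bcost b) * (W + 1) ^ depth c" by (intro mult_left_mono) auto
  with While have "1 + bcost b + time_bound W c \<le> (1 + bcost b + time_bound 0 c) * (W + 1) ^ depth c"
    by (simp only: distrib_right mult_1_right)
  then have "(W + 1) * (1 + bcost b + time_bound W c) \<le> (W + 1) * ((1 + bcost b + time_bound 0 c) * (W + 1) ^ depth c)"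
    by (rule mult_left_mono) simp
  then show ?case by (simp only: time_bound.simps depth.simps power_Suc mult_ac add_0 mult_1)
qed auto

text \<open>Termination within the syntactic bound is part of the predicate. Correctness proofs thus
  only have to check that loop limits stay below \<open>W\<close>; the running time is then read off
  the program text.\<close>

definition wp :: "nat \<Rightarrow> com \<Rightarrow> (state \<Rightarrow> bool) \<Rightarrow> state \<Rightarrow> bool" where
  "wp W c Q s \<longleftrightarrow> (\<exists>t s'. runs c s t s' \<and> t \<le> time_bound W c \<and> Q s')"

text \<open>The frame comes for free from the written variables, so specifications need only mention
  what changes.\<close>

lemma wp_conseq: "wp W c P s \<Longrightarrow> (\<And>s'. frame (nwrites c) (rwrites c) s s' \<Longrightarrow> P s' \<Longrightarrow> Q s') \<Longrightarrow> wp W c Q s"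
  unfolding wp_def using runs_frame by blast

lemma wp_Skip [simp]: "wp W Skip Q s \<longleftrightarrow> Q s"
  unfolding wp_def using runs.Skip[of s] by (fastforce elim: runs_SkipE)

lemma wp_NAssign [simp]: "wp W (NAssign x a e) Q s \<longleftrightarrow> Q (nupd x (nval a s) (nval e s) s)"
  unfolding wp_def by (auto intro!: exI runs.NAssign elim: runs_NAssignE)

lemma wp_RAssign [simp]: "wp W (RAssign x a e) Q s \<longleftrightarrow> Q (rupd x (nval a s) (rval e s) s)"
  unfolding wp_def by (auto intro!: exI runs.RAssign elim: runs_RAssignE)

lemma wp_Seq: "wp W c (wp W d Q) s \<Longrightarrow> wp W (Seq c d) Q s"
  unfolding wp_def time_bound.simps by (meson runs.Seq add_mono)

lemma wp_Seq': "wp W c P s \<Longrightarrow> (\<And>s'. frame (nwrites c) (rwrites c) s s' \<Longrightarrow> P s' \<Longrightarrow> wp W d Q s') \<Longrightarrow> wp W (Seq c d) Q s"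
  by (rule wp_Seq) (rule wp_conseq)

lemma wp_Cond:
  assumes "bval b s \<Longrightarrow> wp W c Q s" "\<not> bval b s \<Longrightarrow> wp W d Q s"
  shows "wp W (Cond b c d) Q s"
proof (cases "bval b s")
  case True
  then obtain t s' where "runs c s t s'" "t \<le> time_bound W c" "Q s'" using assms by (auto simp: wp_def)
  with runs.CondTrue[OF True, of c t s' d] show ?thesis
    unfolding wp_def by (intro exI[of _ "1 + bcost b + t"] exI[of _ s']) auto
next
  case False
  then obtain t s' where "runs d s t s'" "t \<le> time_bound W d" "Q s'" using assms by (auto simp: wp_def)
  with runs.CondFalse[OF False, of d t s' c] show ?thesis
    unfolding wp_def by (intro exI[of _ "1 + bcost b + t"] exI[of _ s']) auto
qed

abbreviation V :: "vname \<Rightarrow> nexp" where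
  "V x \<equiv> NRead x (NConst 0)"

definition For :: "vname \<Rightarrow> vname \<Rightarrow> com \<Rightarrow> com" where
  "For x y c = Seq (NAssign x (NConst 0) (NConst 0))
     (While (BNot (NLe (V y) (V x))) (Seq c (NAssign x (NConst 0) (NAdd (V x) (NConst 1)))))"

text \<open>The 16 units are 3 for the initial assignment, 7 for the test and 6 for the
  increment.\<close>

lemma For_simps [simp]:
  "nwrites (For x y c) = insert x (nwrites c)" "rwrites (For x y c) = rwrites c"
  "time_bound 0 (For x y c) = time_bound 0 c + 16" "depth (For x y c) = Suc (depth c)"
  by (auto simp: For_def)

text \<open>By \<open>stable\<close> the invariant ignores the counter, hence survives its reset and
  increment. The frame refers to the state before the loop, so facts about untouched memory stay out
  of the invariant.\<close>

lemma wp_For: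
  assumes h: "nmem s y 0 = h" "h \<le> W"
    and xy: "x \<noteq> y" "x \<notin> nwrites c" "y \<notin> nwrites c"
    and I0: "I 0 s"
    and stable: "\<And>i s v. I i s \<Longrightarrow> I i (nupd x 0 v s)"
    and step: "\<And>i s'. i < h \<Longrightarrow> I i s' \<Longrightarrow> nmem s' x 0 = i \<Longrightarrow> frame (insert x (nwrites c)) (rwrites c) s s' \<Longrightarrow>
      wp W c (I (Suc i)) s'"
    and post: "\<And>s'. I h s' \<Longrightarrow> frame (insert x (nwrites c)) (rwrites c) s s' \<Longrightarrow> Q s'"
  shows "wp W (For x y c) Q s"
proof -
  let ?b = "BNot (NLe (V y) (V x))" and ?inc = "NAssign x (NConst 0) (NAdd (V x) (NConst 1))"
  let ?F = "frame (insert x (nwrites c)) (rwrites c) s"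
  let ?U = "1 + bcost ?b + time_bound W (Seq c ?inc)"
  \<comment> \<open>Induction on the number \<open>d\<close> of remaining iterations; the additional
    unit of \<open>?U\<close> pays for the final failing test.\<close>
  have loop: "\<exists>t s''. runs (While ?b (Seq c ?inc)) s' t s'' \<and> t \<le> (d + 1) * ?U \<and> I h s'' \<and> ?F s''"
    if "i + d = h" "I i s'" "nmem s' x 0 = i" "?F s'" for d i s'
    using that
  proof (induction d arbitrary: i s')
    case 0
    have "nmem s' y 0 = h" using 0 h xy by (simp add: frame_def)
    then have "\<not> bval ?b s'" using 0 by simp
    from runs.WhileFalse[OF this, of "Seq c ?inc"] show ?case using 0 by fastforce
  next
    case (Suc d)
    have y: "nmem s' y 0 = h" using Suc.prems h xy by (simp add: frame_def)
    have b: "bval ?b s'" using Suc.prems y by simp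
    have "wp W c (I (Suc i)) s'" using Suc.prems by (intro step) auto
    then obtain t s1 where r: "runs c s' t s1" "t \<le> time_bound W c" "I (Suc i) s1" by (auto simp: wp_def)
    let ?s2 = "nupd x 0 (Suc i) s1"
    have f: "frame (nwrites c) (rwrites c) s' s1" by (rule runs_frame[OF r(1)])
    have x1: "nmem s1 x 0 = i" using frameN[OF f xy(2)] Suc.prems by simp
    have "runs ?inc s1 (1 + ncost (NConst 0) + ncost (NAdd (V x) (NConst 1))) ?s2"
      using runs.NAssign[of x "NConst 0" "NAdd (V x) (NConst 1)" s1] x1 by simp
    from runs.Seq[OF r(1) this]
    have r2: "runs (Seq c ?inc) s' (t + (1 + ncost (NConst 0) + ncost (NAdd (V x) (NConst 1)))) ?s2" .
    have "?F ?s2" using f Suc.prems(4) by (auto simp: frame_def)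
    moreover have "I (Suc i) ?s2" using r by (intro stable)
    ultimately obtain u s3 where u: "runs (While ?b (Seq c ?inc)) ?s2 u s3" "u \<le> (d + 1) * ?U" "I h s3" "?F s3"
      using Suc.IH[of "Suc i" ?s2] Suc.prems by auto
    have "1 + bcost ?b + (t + (1 + ncost (NConst 0) + ncost (NAdd (V x) (NConst 1)))) + u \<le> (Suc d + 1) * ?U"
      using r(2) u(2) by simp
    with runs.WhileTrue[OF b r2 u(1)] u(3,4) show ?case by blast
  qed
  let ?s0 = "nupd x 0 0 s"
  obtain t s' where t: "runs (While ?b (Seq c ?inc)) ?s0 t s'" "t \<le> (h + 1) * ?U" "I h s'" "?F s'"
    using loop[of 0 h ?s0] stable[OF I0] by (auto simp: frame_def)
  have "runs (NAssign x (NConst 0) (NConst 0)) s (1 + ncost (NConst 0) + ncost (NConst 0)) ?s0"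
    using runs.NAssign[of x "NConst 0" "NConst 0" s] by simp
  from runs.Seq[OF this t(1)]
  have "runs (For x y c) s (1 + ncost (NConst 0) + ncost (NConst 0) + t) s'" by (simp add: For_def)
  moreover have "(h + 1) * ?U \<le> (W + 1) * ?U" using h by (intro mult_right_mono) auto
  then have "1 + ncost (NConst 0) + ncost (NConst 0) + t \<le> time_bound W (For x y c)"
    using t(2) by (simp add: For_def)
  ultimately show ?thesis
    unfolding wp_def using post[OF t(3,4)] by blast
qed

lemma wp_SeqN:
  "wp W d Q (nupd x (nval a s) (nval e s) s) \<Longrightarrow> wp W (Seq (NAssign x a e) d) Q s"
  by (rule wp_Seq) simp

lemma wp_SeqR:
  "wp W d Q (rupd x (nval a s) (rval e s) s) \<Longrightarrow> wp W (Seq (RAssign x a e) d) Q s"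
  by (rule wp_Seq) simp

section \<open>The program\<close>

definition env0 :: "mku \<Rightarrow> state \<Rightarrow> bool" where
  "env0 X s \<longleftrightarrow> nmem s ''n'' 0 = nitems X \<and> nmem s ''m'' 0 = nblocks X \<and>
     nmem s ''k'' 0 = target X \<and> nmem s ''j0'' 0 = exact X \<and>
     (\<forall>i\<in>{1..nitems X}. nmem s ''blk'' i = blk X i \<and> rmem s ''q'' i = isize X i \<and> rmem s ''p'' i = iprob X i) \<and>
     (\<forall>j\<in>{1..nblocks X}. nmem s ''Delta'' j = quota X j) \<and> rmem s ''Q'' 0 = capacity X"

definition nkeys :: "nat \<Rightarrow> mku \<Rightarrow> nat" where
  "nkeys K X = base K X ^ ndigits K X"

definition env1 :: "nat \<Rightarrow> mku \<Rightarrow> state \<Rightarrow> bool" where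
  "env1 K X s \<longleftrightarrow> env0 X s \<and> nmem s ''n1'' 0 = nitems X + 1 \<and> nmem s ''K'' 0 = K \<and>
     nmem s ''G'' 0 = K * (nitems X + 1) \<and> nmem s ''B'' 0 = nkeys K X \<and>
     (\<forall>e\<le>ndigits K X. nmem s ''pw'' e = base K X ^ e)"

definition env2 :: "nat \<Rightarrow> mku \<Rightarrow> state \<Rightarrow> bool" where
  "env2 K X s \<longleftrightarrow> env1 K X s \<and> (\<forall>i\<in>{1..nitems X}. nmem s ''key'' i = ikey K X i)"

lemma env1_frame:
  assumes "frame A B s s'" "env1 K X s"
    "A \<inter> {''n'', ''m'', ''k'', ''j0'', ''blk'', ''Delta'', ''n1'', ''K'', ''G'', ''B'', ''pw''} = {}"
    "B \<inter> {''Q'', ''q'', ''p''} = {}"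
  shows "env1 K X s'"
proof -
  have "nmem s' z = nmem s z" if "z \<in> {''n'', ''m'', ''k'', ''j0'', ''blk'', ''Delta'', ''n1'', ''K'', ''G'', ''B'', ''pw''}" for z
    using assms that by (auto simp: frame_def)
  moreover have "rmem s' z = rmem s z" if "z \<in> {''Q'', ''q'', ''p''}" for z
    using assms that by (auto simp: frame_def)
  ultimately show ?thesis using assms(2) by (simp add: env1_def env0_def)
qed

lemma env2_frame:
  assumes "frame A B s s'" "env2 K X s"
    "A \<inter> {''n'', ''m'', ''k'', ''j0'', ''blk'', ''Delta'', ''n1'', ''K'', ''G'', ''B'', ''pw''} = {}"
    "''key'' \<notin> A" "B \<inter> {''Q'', ''q'', ''p''} = {}"
  shows "env2 K X s'"
  using env1_frame[OF assms(1) _ assms(3,5)] frameN[OF assms(1,4)] assms(2) by (simp add: env2_def)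

text \<open>Every loop limit of the program is at most the number of keys, so \<open>nkeys\<close>
  can serve as \<open>W\<close> throughout.\<close>

lemma nkeys_bounds:
  assumes "mku_instance X"
  shows "nitems X + 1 \<le> nkeys K X" "nitems X \<le> nkeys K X" "nblocks X \<le> nkeys K X"
    "K \<le> nkeys K X" "K * (nitems X + 1) \<le> nkeys K X" "ndigits K X \<le> nkeys K X"
proof -
  have b: "2 \<le> base K X" by (simp add: base_def)
  have "base K X ^ 1 \<le> nkeys K X"
    unfolding nkeys_def using b by (intro power_increasing) (auto simp: ndigits_def)
  then have B: "base K X \<le> nkeys K X" by simp
  have G: "(K + 2) * (nitems X + 1) \<le> base K X" by (simp add: base_def)
  show "K * (nitems X + 1) \<le> nkeys K X" "nitems X + 1 \<le> nkeys K X" "nitems X \<le> nkeys K X"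
    using G B by (auto simp: algebra_simps)
  have "ndigits K X < 2 ^ ndigits K X" by (rule less_exp)
  also have "\<dots> \<le> nkeys K X" unfolding nkeys_def using b by (intro power_mono) auto
  finally show d: "ndigits K X \<le> nkeys K X" by simp
  then show "nblocks X \<le> nkeys K X" "K \<le> nkeys K X" by (auto simp: ndigits_def)
qed

definition init :: "nat \<Rightarrow> com" where
  "init K =
    Seq (NAssign ''n1'' (NConst 0) (NAdd (V ''n'') (NConst 1)))
    (Seq (NAssign ''K'' (NConst 0) (NConst K))
    (Seq (NAssign ''G'' (NConst 0) (NMul (V ''K'') (V ''n1'')))
    (Seq (NAssign ''D'' (NConst 0) (NMul (NMul (NAdd (V ''K'') (NConst 2)) (V ''n1'')) (V ''n1'')))
    (Seq (NAssign ''E'' (NConst 0) (NAdd (NAdd (V ''m'') (NMul (NConst 2) (V ''K''))) (NConst 3)))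
    (Seq (NAssign ''pw'' (NConst 0) (NConst 1))
    (Seq (For ''e'' ''E'' (NAssign ''pw'' (NAdd (V ''e'') (NConst 1)) (NMul (NRead ''pw'' (V ''e'')) (V ''D''))))
    (NAssign ''B'' (NConst 0) (NRead ''pw'' (V ''E'')))))))))"

lemma wp_init:
  assumes X: "mku_instance X" and s: "env0 X s"
  shows "wp (nkeys K X) (init K) (env1 K X) s"
  unfolding init_def
  apply (rule wp_SeqN)+
  apply (rule wp_Seq)
  apply (rule wp_For[where h = "ndigits K X" and I = "\<lambda>i s. nmem s ''D'' 0 = base K X \<and> (\<forall>e\<le>i. nmem s ''pw'' e = base K X ^ e)"])
  subgoal using s by (simp add: env0_def ndigits_def)
  subgoal by (rule nkeys_bounds[OF X])
  subgoal by simp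
  subgoal by simp
  subgoal by simp
  subgoal using s by (simp add: env0_def base_def)
  subgoal by simp
  subgoal for i s' by (auto simp: le_Suc_eq)
  subgoal for s'
    using s by (simp add: frame_def env1_def env0_def nkeys_def ndigits_def)
  done

text \<open>The floor in \<open>plevel\<close> by linear search: real comparisons are the only way
  to extract a natural number from a real.\<close>

definition key_g :: com where
  "key_g = For ''a'' ''G''
    (Cond (RLe (ROfNat (NAdd (V ''a'') (NConst 1))) (RMul (RRead ''p'' (NAdd (V ''i'') (NConst 1))) (ROfNat (V ''G''))))
      (NAssign ''g'' (NConst 0) (NAdd (V ''a'') (NConst 1))) Skip)"

text \<open>Division by \<open>n + 1\<close> in the same manner, as natural expressions have no
  quotient.\<close>

definition key_l :: com where
  "key_l = For ''a'' ''K''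
    (Cond (NLe (NMul (NAdd (V ''a'') (NConst 1)) (V ''n1'')) (V ''g''))
      (NAssign ''l'' (NConst 0) (NAdd (V ''a'') (NConst 1))) Skip)"

definition key_item :: com where
  "key_item = Seq (NAssign ''g'' (NConst 0) (NConst 0)) (Seq key_g (Seq (NAssign ''l'' (NConst 0) (NConst 0)) (Seq key_l
    (NAssign ''key'' (NAdd (V ''i'') (NConst 1))
      (NAdd (NAdd (NRead ''pw'' (NRead ''blk'' (NAdd (V ''i'') (NConst 1))))
        (NRead ''pw'' (NAdd (NAdd (V ''m'') (NConst 1)) (NMul (NConst 2) (V ''l'')))))
        (NMul (V ''g'') (NRead ''pw'' (NAdd (NAdd (V ''m'') (NConst 2)) (NMul (NConst 2) (V ''l''))))))))))"

definition keys :: com where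
  "keys = For ''i'' ''n'' key_item"

lemma keys_writes [simp]:
  "nwrites key_g = {''a'', ''g''}" "rwrites key_g = {}" "nwrites key_l = {''a'', ''l''}" "rwrites key_l = {}"
  "nwrites key_item = {''a'', ''g'', ''l'', ''key''}" "rwrites key_item = {}"
  "nwrites keys = {''i'', ''a'', ''g'', ''l'', ''key''}" "rwrites keys = {}"
  by (auto simp: key_g_def key_l_def key_item_def keys_def)

lemma Suc_le_plevel_iff:
  "Suc a \<le> plevel K X i \<longleftrightarrow> real (Suc a) \<le> iprob X i * real (K * (nitems X + 1))"
  unfolding plevel_def by linarith

lemma Suc_le_pclass_iff:
  "Suc a \<le> pclass K X i \<longleftrightarrow> Suc a * (nitems X + 1) \<le> plevel K X i"
  unfolding pclass_def by (rule less_eq_div_iff_mult_less_eq) simp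

lemma wp_key_g:
  assumes X: "mku_instance X" and s: "env1 K X s" and i: "nmem s ''i'' 0 = i" "i < nitems X" and g: "nmem s ''g'' 0 = 0"
  shows "wp (nkeys K X) key_g (\<lambda>s. nmem s ''g'' 0 = plevel K X (i + 1)) s"
  unfolding key_g_def
  \<comment> \<open>The values that pass the test form an initial segment, so the last assignment
    made is the minimum in the invariant.\<close>
  apply (rule wp_For[where h = "K * (nitems X + 1)" and I = "\<lambda>a s. nmem s ''g'' 0 = min a (plevel K X (i + 1))"])
  subgoal using s by (simp add: env1_def)
  subgoal by (rule nkeys_bounds[OF X])
  subgoal by simp
  subgoal by simp
  subgoal by simp
  subgoal using g by simp
  subgoal by simp
  subgoal premises prems for a s'
  proof -
    have e: "env1 K X s'" by (rule env1_frame[OF prems(4) s]) auto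
    have i': "nmem s' ''i'' 0 = i" using prems(4) i by (simp add: frame_def)
    have p: "rmem s' ''p'' (Suc i) = iprob X (Suc i)" using e i by (simp add: env1_def env0_def)
    have G: "nmem s' ''G'' 0 = K * (nitems X + 1)" using e by (simp add: env1_def)
    show ?thesis
      by (rule wp_Cond) (use Suc_le_plevel_iff[of a K X "Suc i"] prems(2,3) i' p G in \<open>auto simp: min_def\<close>)
  qed
  subgoal for s' using plevel_le[OF X, of "i + 1" K] i by simp
  done

lemma wp_key_l:
  assumes X: "mku_instance X" and s: "env1 K X s" and i: "i < nitems X"
    and g: "nmem s ''g'' 0 = plevel K X (i + 1)" and l: "nmem s ''l'' 0 = 0"
  shows "wp (nkeys K X) key_l (\<lambda>s. nmem s ''l'' 0 = pclass K X (i + 1)) s"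
  unfolding key_l_def
  apply (rule wp_For[where h = K and I = "\<lambda>a s. nmem s ''l'' 0 = min a (pclass K X (i + 1))"])
  subgoal using s by (simp add: env1_def)
  subgoal by (rule nkeys_bounds[OF X])
  subgoal by simp
  subgoal by simp
  subgoal by simp
  subgoal using l by simp
  subgoal by simp
  subgoal premises prems for a s'
  proof -
    have e: "nmem s' ''n1'' 0 = nitems X + 1" using s prems(4) by (simp add: env1_def frame_def)
    have g': "nmem s' ''g'' 0 = plevel K X (i + 1)" using prems(4) g by (simp add: frame_def)
    show ?thesis
      by (rule wp_Cond) (use Suc_le_pclass_iff[of a K X "Suc i"] prems(2,3) e g' in \<open>auto simp: min_def\<close>)
  qed
  subgoal for s' using pclass_le[OF X, of "i + 1" K] i by simp
  done

lemma wp_key_item: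
  assumes X: "mku_instance X" and s: "env1 K X s" and i: "nmem s ''i'' 0 = i" "i < nitems X"
  shows "wp (nkeys K X) key_item (\<lambda>s'. nmem s' ''key'' = (nmem s ''key'')(Suc i := ikey K X (Suc i))) s"
  unfolding key_item_def
proof (rule wp_SeqN)
  let ?s1 = "nupd ''g'' (nval (NConst 0) s) (nval (NConst 0) s) s"
  have e1: "env1 K X ?s1" using s by (simp add: env1_def env0_def)
  show "wp (nkeys K X) (Seq key_g (Seq (NAssign ''l'' (NConst 0) (NConst 0)) (Seq key_l
    (NAssign ''key'' (NAdd (V ''i'') (NConst 1))
      (NAdd (NAdd (NRead ''pw'' (NRead ''blk'' (NAdd (V ''i'') (NConst 1))))
        (NRead ''pw'' (NAdd (NAdd (V ''m'') (NConst 1)) (NMul (NConst 2) (V ''l'')))))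
        (NMul (V ''g'') (NRead ''pw'' (NAdd (NAdd (V ''m'') (NConst 2)) (NMul (NConst 2) (V ''l''))))))))))
    (\<lambda>s'. nmem s' ''key'' = (nmem s ''key'')(Suc i := ikey K X (Suc i))) ?s1"
    apply (rule wp_Seq'[OF wp_key_g[OF X e1, of i]])
    subgoal using i by simp
    subgoal using i by simp
    subgoal by simp
    subgoal premises p1 for s2
    proof (rule wp_SeqN, rule wp_Seq'[OF wp_key_l[OF X, where i = i]])
      let ?s3 = "nupd ''l'' (nval (NConst 0) s2) (nval (NConst 0) s2) s2"
      have e2: "env1 K X s2" by (rule env1_frame[OF p1(1) e1]) auto
      show e3: "env1 K X ?s3" using e2 by (simp add: env1_def env0_def)
      show "i < nitems X" by fact
      show "nmem ?s3 ''g'' 0 = plevel K X (i + 1)" using p1(2) by simp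
      show "nmem ?s3 ''l'' 0 = 0" by simp
      fix s4 assume f: "frame (nwrites key_l) (rwrites key_l) ?s3 s4" and l: "nmem s4 ''l'' 0 = pclass K X (i + 1)"
      have e4: "env1 K X s4" by (rule env1_frame[OF f e3]) auto
      have ii: "Suc i \<in> {1..nitems X}" using i by simp
      have "blk X (Suc i) \<le> nblocks X" using X ii by (simp add: mku_instance_def)
      then have blk: "blk X (Suc i) \<le> ndigits K X" by (simp add: ndigits_def)
      have pclass: "pclass K X (Suc i) \<le> K" by (rule pclass_le[OF X ii])
      have "nmem s4 ''i'' 0 = i" "nmem s4 ''g'' 0 = plevel K X (i + 1)" "nmem s4 ''key'' = nmem s ''key''"
        using f p1 i by (simp_all add: frame_def)
      moreover have "nmem s4 ''blk'' (Suc i) = blk X (Suc i)" "nmem s4 ''m'' 0 = nblocks X"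
        using e4 ii by (simp_all add: env1_def env0_def)
      moreover have "nmem s4 ''pw'' e = base K X ^ e" if "e \<le> ndigits K X" for e
        using e4 that by (simp add: env1_def)
      ultimately show "wp (nkeys K X) (NAssign ''key'' (NAdd (V ''i'') (NConst 1))
      (NAdd (NAdd (NRead ''pw'' (NRead ''blk'' (NAdd (V ''i'') (NConst 1))))
        (NRead ''pw'' (NAdd (NAdd (V ''m'') (NConst 1)) (NMul (NConst 2) (V ''l'')))))
        (NMul (V ''g'') (NRead ''pw'' (NAdd (NAdd (V ''m'') (NConst 2)) (NMul (NConst 2) (V ''l'')))))))
        (\<lambda>s'. nmem s' ''key'' = (nmem s ''key'')(Suc i := ikey K X (Suc i))) s4"
        using l blk pclass by (simp add: ikey_def ndigits_def)
    qed
    done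
qed

lemma wp_keys:
  assumes X: "mku_instance X" and s: "env1 K X s"
  shows "wp (nkeys K X) keys (env2 K X) s"
  unfolding keys_def
  apply (rule wp_For[where h = "nitems X" and I = "\<lambda>i s. \<forall>j\<in>{1..i}. nmem s ''key'' j = ikey K X j"])
  subgoal using s by (simp add: env1_def env0_def)
  subgoal by (rule nkeys_bounds[OF X])
  subgoal by simp
  subgoal by simp
  subgoal by simp
  subgoal by simp
  subgoal by simp
  subgoal premises p for i s'
  proof -
    have e: "env1 K X s'" by (rule env1_frame[OF p(4) s]) auto
    show ?thesis
      by (rule wp_conseq[OF wp_key_item[OF X e p(3,1)]]) (use p(2) in \<open>auto simp: le_Suc_eq\<close>)
  qed
  subgoal premises p for s'
  proof -
    have "env1 K X s'" by (rule env1_frame[OF p(2) s]) auto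
    then show ?thesis using p(1) by (simp add: env2_def)
  qed
  done

subsection \<open>Dynamic programming over keys\<close>

text \<open>Stated for plain values instead of a state, so that the two update lemmas are purely
  combinatorial. The size \<open>z\<close> and the set \<open>S\<close> carry meaning only if the
  entry is present.\<close>

definition best_entry :: "nat \<Rightarrow> mku \<Rightarrow> nat \<Rightarrow> nat \<Rightarrow> bool \<Rightarrow> real \<Rightarrow> nat set \<Rightarrow> bool" where
  "best_entry K X i y P z S \<longleftrightarrow>
    (if P then S \<subseteq> {1..i} \<and> sum (ikey K X) S = y \<and> z = sum (isize X) S \<and>
        (\<forall>I\<subseteq>{1..i}. sum (ikey K X) I = y \<longrightarrow> z \<le> sum (isize X) I)
     else \<forall>I\<subseteq>{1..i}. sum (ikey K X) I \<noteq> y)"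

lemma best_entryD:
  "best_entry K X i y P z S \<Longrightarrow> I \<subseteq> {1..i} \<Longrightarrow> sum (ikey K X) I = y \<Longrightarrow> P \<and> z \<le> sum (isize X) I"
  unfolding best_entry_def by (metis (full_types))

lemma subset_Suc_cases:
  assumes "I \<subseteq> {1..Suc i}"
  obtains "I \<subseteq> {1..i}" | J where "J \<subseteq> {1..i}" "I = insert (Suc i) J" "Suc i \<notin> J" "finite J"
proof (cases "Suc i \<in> I")
  case True
  have J: "I - {Suc i} \<subseteq> {1..i}" using assms by (auto simp: le_Suc_eq)
  then have "finite (I - {Suc i})" by (rule finite_subset) simp
  with J True that(2)[of "I - {Suc i}"] show ?thesis by auto
next
  case False
  then have "I \<subseteq> {1..i}" using assms by (auto simp: le_Suc_eq)
  then show ?thesis by (rule that)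
qed

text \<open>A set of the first \<open>i + 1\<close> items either avoids the new item, and the old
  entry covers it, or arises from some \<open>J\<close> by inserting it, and \<open>new\<close>
  covers it.\<close>

lemma best_entry_keep:
  assumes A: "best_entry K X i y P z S"
    and new: "\<And>J. J \<subseteq> {1..i} \<Longrightarrow> ikey K X (Suc i) + sum (ikey K X) J = y \<Longrightarrow>
      P \<and> z \<le> isize X (Suc i) + sum (isize X) J"
  shows "best_entry K X (Suc i) y P z S"
proof (cases P)
  case True
  have "z \<le> sum (isize X) I" if "I \<subseteq> {1..Suc i}" "sum (ikey K X) I = y" for I
    using that(1)
  proof (cases rule: subset_Suc_cases)
    case 1
    then show ?thesis using A[unfolded best_entry_def if_P[OF True]] that by blast
  next
    case (2 J)
    then show ?thesis using new[of J] that by simp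
  qed
  moreover have "S \<subseteq> {1..Suc i}" using A True by (fastforce simp: best_entry_def)
  ultimately show ?thesis using A True by (simp add: best_entry_def)
next
  case False
  have "sum (ikey K X) I \<noteq> y" if "I \<subseteq> {1..Suc i}" for I
    using that(1)
  proof (cases rule: subset_Suc_cases)
    case 1
    then show ?thesis using A False that by (simp add: best_entry_def)
  next
    case (2 J)
    then show ?thesis using new[of J] that False by auto
  qed
  then show ?thesis using False by (simp add: best_entry_def)
qed

text \<open>Sets with the new item reduce to the entry at the remaining key. Sets without it are no
  smaller, because \<open>better\<close> says that the old entry is absent or strictly
  larger.\<close>

lemma best_entry_take:
  assumes A: "best_entry K X i y P z S"
    and B: "best_entry K X i (y - ikey K X (Suc i)) True z' S'"
    and k: "ikey K X (Suc i) \<le> y" and better: "\<not> (P \<and> z \<le> z' + isize X (Suc i))"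
  shows "best_entry K X (Suc i) y True (z' + isize X (Suc i)) (insert (Suc i) S')"
proof -
  have S': "S' \<subseteq> {1..i}" "sum (ikey K X) S' = y - ikey K X (Suc i)" "z' = sum (isize X) S'"
    and min: "\<And>I. I \<subseteq> {1..i} \<Longrightarrow> sum (ikey K X) I = y - ikey K X (Suc i) \<Longrightarrow> z' \<le> sum (isize X) I"
    using B by (auto simp: best_entry_def)
  have fin: "finite S'" "Suc i \<notin> S'" using S'(1) finite_subset by fastforce+
  have "z' + isize X (Suc i) \<le> sum (isize X) I" if "I \<subseteq> {1..Suc i}" "sum (ikey K X) I = y" for I
    using that(1)
  proof (cases rule: subset_Suc_cases)
    case 1
    then have "P \<and> z \<le> sum (isize X) I" using A that by (auto simp: best_entry_def split: if_splits)
    then show ?thesis using better by linarith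
  next
    case (2 J)
    then show ?thesis using min[of J] that by auto
  qed
  moreover have "insert (Suc i) S' \<subseteq> {1..Suc i}" using S'(1) by fastforce
  ultimately show ?thesis using S' fin k by (auto simp: best_entry_def)
qed

text \<open>\<open>memb\<close> is a flattened matrix with one row of length \<open>n + 1\<close>
  per key. Storing whole sets avoids a backtracking pass.\<close>

definition rowset :: "mku \<Rightarrow> state \<Rightarrow> nat \<Rightarrow> nat set" where
  "rowset X s y = {j\<in>{1..nitems X}. nmem s ''memb'' (y * (nitems X + 1) + j) \<noteq> 0}"

lemma row_index_eq_iff:
  fixes n :: nat
  assumes "a < n" "b < n"
  shows "r * n + a = y * n + b \<longleftrightarrow> r = y \<and> a = b"
proof
  assume e: "r * n + a = y * n + b"
  have "(r * n + a) div n = r" "(y * n + b) div n = y" using assms by auto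
  with e have "r = y" by metis
  then show "r = y \<and> a = b" using e by simp
qed simp

definition dp_copy_row :: com where
  "dp_copy_row = For ''j'' ''n1'' (NAssign ''memb'' (NAdd (NMul (V ''y'') (V ''n1'')) (V ''j''))
      (NRead ''memb'' (NAdd (NMul (V ''z'') (V ''n1'')) (V ''j''))))"

definition dp_take :: com where
  "dp_take = Seq (NAssign ''pres'' (V ''y'') (NConst 1))
    (Seq (RAssign ''size'' (V ''y'') (RAdd (RRead ''size'' (V ''z'')) (RRead ''q'' (NAdd (V ''i'') (NConst 1)))))
    (Seq dp_copy_row
    (NAssign ''memb'' (NAdd (NMul (V ''y'') (V ''n1'')) (NAdd (V ''i'') (NConst 1))) (NConst 1))))"

definition dp_step :: com where
  "dp_step = Seq (NAssign ''y'' (NConst 0) (NSub (NSub (V ''B'') (NConst 1)) (V ''c'')))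
    (Cond (NLe (NRead ''key'' (NAdd (V ''i'') (NConst 1))) (V ''y''))
      (Seq (NAssign ''z'' (NConst 0) (NSub (V ''y'') (NRead ''key'' (NAdd (V ''i'') (NConst 1)))))
      (Cond (BAnd (NLe (NConst 1) (NRead ''pres'' (V ''z'')))
          (BNot (BAnd (NLe (NConst 1) (NRead ''pres'' (V ''y'')))
            (RLe (RRead ''size'' (V ''y'')) (RAdd (RRead ''size'' (V ''z'')) (RRead ''q'' (NAdd (V ''i'') (NConst 1))))))))
        dp_take Skip)) Skip)"

definition dp :: com where
  "dp = Seq (NAssign ''pres'' (NConst 0) (NConst 1)) (For ''i'' ''n'' (For ''c'' ''B'' dp_step))"

lemma dp_writes [simp]:
  "nwrites dp_copy_row = {''j'', ''memb''}" "rwrites dp_copy_row = {}"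
  "nwrites dp_take = {''pres'', ''j'', ''memb''}" "rwrites dp_take = {''size''}"
  "nwrites dp_step = {''y'', ''z'', ''pres'', ''j'', ''memb''}" "rwrites dp_step = {''size''}"
  "nwrites dp = {''i'', ''c'', ''y'', ''z'', ''pres'', ''j'', ''memb''}" "rwrites dp = {''size''}"
  by (auto simp: dp_copy_row_def dp_take_def dp_step_def dp_def)

lemma wp_dp_copy_row:
  assumes X: "mku_instance X" and n1: "nmem s ''n1'' 0 = nitems X + 1"
    and y: "nmem s ''y'' 0 = y" and z: "nmem s ''z'' 0 = z" "z \<noteq> y"
  shows "wp (nkeys K X) dp_copy_row (\<lambda>s'. \<forall>r. \<forall>a<nitems X + 1. nmem s' ''memb'' (r * (nitems X + 1) + a) =
    (if r = y then nmem s ''memb'' (z * (nitems X + 1) + a) else nmem s ''memb'' (r * (nitems X + 1) + a))) s"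
  unfolding dp_copy_row_def
  apply (rule wp_For[where h = "nitems X + 1" and I = "\<lambda>j s'. \<forall>r. \<forall>a<nitems X + 1. nmem s' ''memb'' (r * (nitems X + 1) + a) =
    (if r = y \<and> a < j then nmem s ''memb'' (z * (nitems X + 1) + a) else nmem s ''memb'' (r * (nitems X + 1) + a))"])
  subgoal by (rule n1)
  subgoal by (rule nkeys_bounds[OF X])
  subgoal by simp
  subgoal by simp
  subgoal by simp
  subgoal by simp
  subgoal by simp
  subgoal premises p for j s'
  proof -
    have v: "nmem s' ''y'' 0 = y" "nmem s' ''z'' 0 = z" "nmem s' ''n1'' 0 = nitems X + 1"
      using p(4) y z n1 by (simp_all add: frame_def)
    \<comment> \<open>The source row is still intact, since only row \<open>y\<close> is written and
      \<open>z \<noteq> y\<close>.\<close>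
    have m: "nmem s' ''memb'' (z * (nitems X + 1) + j) = nmem s ''memb'' (z * (nitems X + 1) + j)"
      using p(1,2) z by auto
    show ?thesis
      unfolding wp_NAssign nval.simps p(3) v m mem_upd fun_upd_same
    proof (intro allI impI)
      fix r a assume a: "a < nitems X + 1"
      have "r * (nitems X + 1) + a = y * (nitems X + 1) + j \<longleftrightarrow> r = y \<and> a = j"
        by (rule row_index_eq_iff[OF a p(1)])
      then show "((nmem s' ''memb'')(y * (nitems X + 1) + j := nmem s ''memb'' (z * (nitems X + 1) + j))) (r * (nitems X + 1) + a)
        = (if r = y \<and> a < Suc j then nmem s ''memb'' (z * (nitems X + 1) + a) else nmem s ''memb'' (r * (nitems X + 1) + a))"
        unfolding fun_upd_apply using p(2)[rule_format, OF a, of r] by auto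
    qed
  qed
  subgoal for s' by auto
  done

lemma wp_dp_take:
  assumes X: "mku_instance X" and e: "env2 K X s" and i: "nmem s ''i'' 0 = i" "i < nitems X"
    and y: "nmem s ''y'' 0 = y" and z: "nmem s ''z'' 0 = z" "z \<noteq> y"
  shows "wp (nkeys K X) dp_take (\<lambda>s'. nmem s' ''pres'' = (nmem s ''pres'')(y := 1) \<and>
    rmem s' ''size'' = (rmem s ''size'')(y := rmem s ''size'' z + isize X (Suc i)) \<and>
    (\<forall>r. rowset X s' r = (if r = y then insert (Suc i) (rowset X s z) else rowset X s r))) s"
proof -
  have n1: "nmem s ''n1'' 0 = nitems X + 1" and q: "rmem s ''q'' (Suc i) = isize X (Suc i)"
    using e i by (auto simp: env2_def env1_def env0_def)
  show ?thesis
    unfolding dp_take_def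
    apply (rule wp_SeqN)
    apply (rule wp_SeqR)
    apply (rule wp_Seq'[OF wp_dp_copy_row[OF X, of _ y z]])
    subgoal using n1 by simp
    subgoal using y by simp
    subgoal using z by simp
    subgoal using z by simp
    subgoal premises p for s'
    proof -
      have v: "nmem s' ''y'' 0 = y" "nmem s' ''i'' 0 = i" "nmem s' ''n1'' 0 = nitems X + 1"
        using p(1) y i n1 by (simp_all add: frame_def)
      have w: "nmem s' ''pres'' = (nmem s ''pres'')(y := 1)"
        "rmem s' ''size'' = (rmem s ''size'')(y := rmem s ''size'' z + isize X (Suc i))"
        using p(1) y z i q by (simp_all add: frame_def)
      have memb: "nmem s' ''memb'' (r * (nitems X + 1) + a) =
          (if r = y then nmem s ''memb'' (z * (nitems X + 1) + a) else nmem s ''memb'' (r * (nitems X + 1) + a))"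
        if "a < nitems X + 1" for r a
        using p(2) that by simp
      let ?s = "nupd ''memb'' (y * (nitems X + 1) + Suc i) 1 s'"
      have "rowset X ?s r = (if r = y then insert (Suc i) (rowset X s z) else rowset X s r)" for r
      proof -
        have m: "nmem ?s ''memb'' (r * (nitems X + 1) + a) = (if r = y \<and> a = Suc i then 1 else
          if r = y then nmem s ''memb'' (z * (nitems X + 1) + a) else nmem s ''memb'' (r * (nitems X + 1) + a))"
          if "a \<in> {1..nitems X}" for a
        proof -
          have a: "a < nitems X + 1" using that by simp
          have "r * (nitems X + 1) + a = y * (nitems X + 1) + Suc i \<longleftrightarrow> r = y \<and> a = Suc i"
            by (rule row_index_eq_iff[OF a]) (use i in simp)
          then show ?thesis unfolding mem_upd fun_upd_apply using memb[OF a, of r] by auto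
        qed
        have "rowset X ?s r = {a\<in>{1..nitems X}. (if r = y \<and> a = Suc i then 1 else
          if r = y then nmem s ''memb'' (z * (nitems X + 1) + a) else nmem s ''memb'' (r * (nitems X + 1) + a)) \<noteq> 0}"
          unfolding rowset_def by (intro Collect_cong conj_cong refl) (simp only: m)
        also have "\<dots> = (if r = y then insert (Suc i) (rowset X s z) else rowset X s r)"
          using i by (auto simp: rowset_def)
        finally show ?thesis .
      qed
      then show ?thesis using v w by simp
    qed
    done
qed

text \<open>During the pass for item \<open>i + 1\<close>, the topmost \<open>c\<close> keys already
  take this item into account.\<close>

definition dp_table :: "nat \<Rightarrow> mku \<Rightarrow> nat \<Rightarrow> nat \<Rightarrow> state \<Rightarrow> bool" where
  "dp_table K X i c s \<longleftrightarrow> (\<forall>y<nkeys K X. best_entry K X (if nkeys K X - c \<le> y then Suc i else i) y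
     (nmem s ''pres'' y \<noteq> 0) (rmem s ''size'' y) (rowset X s y))"

text \<open>Keys are positive and the table is updated in descending order, so the entry of
  \<open>y - key\<close> still refers to the previous items.\<close>

lemma wp_dp_step:
  assumes X: "mku_instance X" and e: "env2 K X s" and i: "nmem s ''i'' 0 = i" "i < nitems X"
    and c: "nmem s ''c'' 0 = c" "c < nkeys K X" and tab: "dp_table K X i c s"
  shows "wp (nkeys K X) dp_step (dp_table K X i (Suc c)) s"
proof -
  define y where "y = nkeys K X - 1 - c"
  have y: "y < nkeys K X" "nkeys K X - c = Suc y" "nkeys K X - Suc c = y" using c by (auto simp: y_def)
  let ?k = "ikey K X (Suc i)" and ?q = "isize X (Suc i)"
  let ?be = "\<lambda>s i y. best_entry K X i y (nmem s ''pres'' y \<noteq> 0) (rmem s ''size'' y) (rowset X s y)"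
  have v: "nmem s ''B'' 0 = nkeys K X" "nmem s ''key'' (Suc i) = ?k" "rmem s ''q'' (Suc i) = ?q"
    using e i by (auto simp: env2_def env1_def env0_def)
  have old: "?be s i y" using tab y unfolding dp_table_def by auto
  have low: "?be s i x" if "x < y" for x
    using tab[unfolded dp_table_def, rule_format, of x] y that by simp
  \<comment> \<open>The threshold moves past the key \<open>y\<close> alone, so all other entries
    carry over.\<close>
  have upd: "dp_table K X i (Suc c) s'"
    if "?be s' (Suc i) y"
      "\<And>x. x \<noteq> y \<Longrightarrow> nmem s' ''pres'' x = nmem s ''pres'' x \<and> rmem s' ''size'' x = rmem s ''size'' x \<and> rowset X s' x = rowset X s x"
    for s'
    unfolding dp_table_def y(3)
  proof (intro allI impI)
    fix x assume x: "x < nkeys K X"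
    show "?be s' (if y \<le> x then Suc i else i) x"
    proof (cases "x = y")
      case True
      then show ?thesis using that(1) by simp
    next
      case False
      then have "(Suc y \<le> x) = (y \<le> x)" by auto
      then show ?thesis
        using tab[unfolded dp_table_def y(2), rule_format, OF x] that(2)[OF False] by simp
    qed
  qed
  have rs: "rowset X (nupd ''y'' a b t) = rowset X t" "rowset X (nupd ''z'' a b t) = rowset X t" for a b t
    by (auto simp: rowset_def fun_eq_iff)
  let ?s1 = "nupd ''y'' 0 y s"
  let ?s2 = "nupd ''z'' 0 (y - ?k) ?s1"
  have e1: "env2 K X ?s2" using e by (simp add: env2_def env1_def env0_def)
  have s1: "nupd ''y'' (nval (NConst 0) s) (nval (NSub (NSub (V ''B'') (NConst 1)) (V ''c'')) s) s = ?s1"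
    using v c by (simp add: y_def)
  have s2: "nupd ''z'' (nval (NConst 0) ?s1) (nval (NSub (V ''y'') (NRead ''key'' (NAdd (V ''i'') (NConst 1)))) ?s1) ?s1 = ?s2"
    using v i by simp
  have zy: "y - ?k < y" if "?k \<le> y" using ikey_pos[of K X "Suc i"] that by simp
  show ?thesis
    unfolding dp_step_def
    apply (rule wp_SeqN)
    unfolding s1
    apply (rule wp_Cond)
    subgoal premises p
    proof (rule wp_SeqN, unfold s2, rule wp_Cond)
      have k: "?k \<le> y" using p v i by simp
      note zl = low[OF zy[OF k]]
      assume "bval (BAnd (NLe (NConst 1) (NRead ''pres'' (V ''z'')))
          (BNot (BAnd (NLe (NConst 1) (NRead ''pres'' (V ''y'')))
            (RLe (RRead ''size'' (V ''y'')) (RAdd (RRead ''size'' (V ''z'')) (RRead ''q'' (NAdd (V ''i'') (NConst 1)))))))) ?s2"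
      then have b: "nmem s ''pres'' (y - ?k) \<noteq> 0"
        "\<not> (nmem s ''pres'' y \<noteq> 0 \<and> rmem s ''size'' y \<le> rmem s ''size'' (y - ?k) + ?q)"
        using i v by (simp_all add: Suc_le_eq)
      have be: "best_entry K X (Suc i) y True (rmem s ''size'' (y - ?k) + ?q) (insert (Suc i) (rowset X s (y - ?k)))"
        using zl b(1) by (intro best_entry_take[OF old _ k b(2)]) simp
      show "wp (nkeys K X) dp_take (dp_table K X i (Suc c)) ?s2"
        apply (rule wp_conseq[OF wp_dp_take[OF X e1, of i y "y - ?k"]])
        subgoal using i by simp
        subgoal using i by simp
        subgoal by simp
        subgoal by simp
        subgoal using zy[OF k] by simp
        subgoal for s' using be by (intro upd) (auto simp: rs)
        done
    next
      have k: "?k \<le> y" using p v i by simp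
      note zl = low[OF zy[OF k]]
      assume "\<not> bval (BAnd (NLe (NConst 1) (NRead ''pres'' (V ''z'')))
          (BNot (BAnd (NLe (NConst 1) (NRead ''pres'' (V ''y'')))
            (RLe (RRead ''size'' (V ''y'')) (RAdd (RRead ''size'' (V ''z'')) (RRead ''q'' (NAdd (V ''i'') (NConst 1)))))))) ?s2"
      then have b: "nmem s ''pres'' (y - ?k) = 0 \<or>
        (nmem s ''pres'' y \<noteq> 0 \<and> rmem s ''size'' y \<le> rmem s ''size'' (y - ?k) + ?q)"
        using i v by (auto simp: Suc_le_eq)
      have "?be s (Suc i) y"
      proof (rule best_entry_keep[OF old])
        fix J assume J: "J \<subseteq> {1..i}" "?k + sum (ikey K X) J = y"
        then have Jz: "sum (ikey K X) J = y - ?k" by simp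
        show "nmem s ''pres'' y \<noteq> 0 \<and> rmem s ''size'' y \<le> ?q + sum (isize X) J"
          using b best_entryD[OF zl J(1) Jz] by auto
      qed
      then show "wp (nkeys K X) Skip (dp_table K X i (Suc c)) ?s2"
        unfolding wp_Skip by (intro upd) (simp_all add: rs)
    qed
    subgoal premises p
    proof -
      have k: "\<not> ?k \<le> y" using p v i by simp
      have "?be s (Suc i) y"
        by (rule best_entry_keep[OF old]) (use k in auto)
      then show ?thesis unfolding wp_Skip by (intro upd) (simp_all add: rs)
    qed
    done
qed

lemma wp_dp:
  assumes X: "mku_instance X" and e: "env2 K X s"
    and zero: "nmem s ''pres'' = (\<lambda>_. 0)" "nmem s ''memb'' = (\<lambda>_. 0)" "rmem s ''size'' = (\<lambda>_. 0)"
  shows "wp (nkeys K X) dp (dp_table K X (nitems X) 0) s"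
  unfolding dp_def
  apply (rule wp_SeqN)
  apply (rule wp_For[where h = "nitems X" and I = "\<lambda>i. dp_table K X i 0"])
  subgoal using e by (simp add: env2_def env1_def env0_def)
  subgoal by (rule nkeys_bounds[OF X])
  subgoal by simp
  subgoal by simp
  subgoal by simp
  \<comment> \<open>Without items only the empty set is available, with key 0 and size 0; zeroed
    memory encodes precisely this once \<open>pres\<close> is set at 0.\<close>
  subgoal
    using zero ikey_pos[of K X]
    by (auto simp: dp_table_def best_entry_def rowset_def)
  subgoal by (simp add: dp_table_def rowset_def)
  subgoal premises p for i s'
  proof -
    have e': "env2 K X s'" by (rule env2_frame[OF p(4)]) (use e in \<open>auto simp: env2_def env1_def env0_def\<close>)
    show ?thesis
      apply (rule wp_For[where h = "nkeys K X" and I = "\<lambda>c. dp_table K X i c"])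
      subgoal using e' by (simp add: env2_def env1_def)
      subgoal by simp
      subgoal by simp
      subgoal by simp
      subgoal by simp
      subgoal by (rule p(2))
      subgoal by (simp add: dp_table_def rowset_def)
      subgoal premises r for c s''
      proof -
        have e'': "env2 K X s''" by (rule env2_frame[OF r(4) e']) auto
        have "nmem s'' ''i'' 0 = i" using r(4) p(3) by (simp add: frame_def)
        then show ?thesis using e'' p(1) r(1,2,3) by (intro wp_dp_step[OF X]) auto
      qed
      \<comment> \<open>After a full pass every key is updated, which is the table of the next item
        with \<open>c = 0\<close>.\<close>
      subgoal by (simp add: dp_table_def)
      done
  qed
  subgoal .
  done

subsection \<open>Selection of the best feasible entry\<close>

lemma rowset_frame: "frame A B s s' \<Longrightarrow> ''memb'' \<notin> A \<Longrightarrow> rowset X s' = rowset X s"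
  by (simp add: rowset_def frame_def fun_eq_iff)

lemma rowset_subset: "rowset X s y \<subseteq> {1..nitems X}"
  by (auto simp: rowset_def)

lemma mem_rowset:
  assumes "i < nitems X"
  shows "Suc i \<in> rowset X s c \<longleftrightarrow> nmem s ''memb'' (c * (nitems X + 1) + (i + 1)) \<noteq> 0"
  using assms by (simp add: rowset_def)

definition member :: bexp where
  "member = NLe (NConst 1) (NRead ''memb'' (NAdd (NMul (V ''c'') (V ''n1'')) (NAdd (V ''i'') (NConst 1))))"

lemma bval_member:
  assumes "env2 K X s" "nmem s ''c'' 0 = c" "nmem s ''i'' 0 = i" "i < nitems X"
  shows "bval member s \<longleftrightarrow> Suc i \<in> rowset X s c"
proof -
  have "nmem s ''n1'' 0 = nitems X + 1" using assms(1) by (simp add: env2_def env1_def)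
  then show ?thesis
    unfolding mem_rowset[OF assms(4)] member_def bval.simps nval.simps assms(2,3) by (simp only: One_nat_def Suc_le_eq neq0_conv)
qed

section \<open>Checking the quotas of a stored set\<close>

definition count_reset :: com where
  "count_reset = For ''j'' ''m'' (NAssign ''cnt'' (NAdd (V ''j'') (NConst 1)) (NConst 0))"

definition count_items :: com where
  "count_items = For ''i'' ''n'' (Cond member
     (NAssign ''cnt'' (NRead ''blk'' (NAdd (V ''i'') (NConst 1)))
       (NAdd (NRead ''cnt'' (NRead ''blk'' (NAdd (V ''i'') (NConst 1)))) (NConst 1))) Skip)"

text \<open>The loop counter runs through \<open>0, ..., m - 1\<close>: the guard skips 0, and block
  \<open>m\<close> carries no constraint. Equality with \<open>j0\<close> is spelled out as two
  inequalities.\<close>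

definition violated :: bexp where
  "violated = BAnd (NLe (NConst 1) (V ''j''))
     (BNot (BAnd (NLe (NRead ''Delta'' (V ''j'')) (NRead ''cnt'' (V ''j'')))
       (BNot (BAnd (BAnd (NLe (V ''j'') (V ''j0'')) (NLe (V ''j0'') (V ''j'')))
         (BNot (NLe (NRead ''cnt'' (V ''j'')) (NRead ''Delta'' (V ''j''))))))))"

definition check_blocks :: com where
  "check_blocks = For ''j'' ''m'' (Cond violated (NAssign ''ok'' (NConst 0) (NConst 0)) Skip)"

definition check :: com where
  "check = Seq count_reset (Seq count_items (Seq (NAssign ''ok'' (NConst 0) (NConst 1)) check_blocks))"

lemma check_writes [simp]:
  "nwrites count_reset = {''j'', ''cnt''}" "rwrites count_reset = {}"
  "nwrites count_items = {''i'', ''cnt''}" "rwrites count_items = {}"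
  "nwrites check_blocks = {''j'', ''ok''}" "rwrites check_blocks = {}"
  "nwrites check = {''i'', ''j'', ''cnt'', ''ok''}" "rwrites check = {}"
  by (auto simp: count_reset_def count_items_def check_blocks_def check_def)

lemma wp_count_reset:
  assumes X: "mku_instance X" and e: "env2 K X s"
  shows "wp (nkeys K X) count_reset (\<lambda>s'. \<forall>j\<in>{1..nblocks X}. nmem s' ''cnt'' j = 0) s"
  unfolding count_reset_def
  apply (rule wp_For[where h = "nblocks X" and I = "\<lambda>i s. \<forall>j\<in>{1..i}. nmem s ''cnt'' j = 0"])
  subgoal using e by (simp add: env2_def env1_def env0_def)
  subgoal by (rule nkeys_bounds[OF X])
  subgoal by simp
  subgoal by simp
  subgoal by simp
  subgoal by simp
  subgoal by simp
  subgoal by (auto simp: le_Suc_eq)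
  subgoal .
  done

lemma card_Int_atMost_Suc:
  assumes "i < nitems X"
  shows "card (S \<inter> {1..Suc i} \<inter> block X j) =
    card (S \<inter> {1..i} \<inter> block X j) + (if Suc i \<in> S \<and> blk X (Suc i) = j then 1 else 0)"
proof (cases "Suc i \<in> S \<and> blk X (Suc i) = j")
  case True
  then have "S \<inter> {1..Suc i} \<inter> block X j = insert (Suc i) (S \<inter> {1..i} \<inter> block X j)"
    using assms by (auto simp: block_def le_Suc_eq)
  then show ?thesis using True by simp
next
  case False
  then have "S \<inter> {1..Suc i} \<inter> block X j = S \<inter> {1..i} \<inter> block X j"
    by (auto simp: block_def le_Suc_eq)
  then show ?thesis using False by simp
qed

lemma wp_count_items:
  assumes X: "mku_instance X" and e: "env2 K X s" and c: "nmem s ''c'' 0 = c"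
    and cnt: "\<forall>j\<in>{1..nblocks X}. nmem s ''cnt'' j = 0"
  shows "wp (nkeys K X) count_items
    (\<lambda>s'. \<forall>j\<in>{1..nblocks X}. nmem s' ''cnt'' j = card (rowset X s c \<inter> block X j)) s"
  unfolding count_items_def
  apply (rule wp_For[where h = "nitems X" and
      I = "\<lambda>i s'. \<forall>j\<in>{1..nblocks X}. nmem s' ''cnt'' j = card (rowset X s c \<inter> {1..i} \<inter> block X j)"])
  subgoal using e by (simp add: env2_def env1_def env0_def)
  subgoal by (rule nkeys_bounds[OF X])
  subgoal by simp
  subgoal by simp
  subgoal by simp
  subgoal using cnt by simp
  subgoal by simp
  subgoal premises p for i s'
  proof -
    have e': "env2 K X s'" by (rule env2_frame[OF p(4) e]) auto
    have c': "nmem s' ''c'' 0 = c" using p(4) c by (simp add: frame_def)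
    have R: "rowset X s' = rowset X s" by (rule rowset_frame[OF p(4)]) auto
    have b: "nmem s' ''blk'' (Suc i) = blk X (Suc i)" "blk X (Suc i) \<in> {1..nblocks X}"
      using e' p(1) X by (auto simp: env2_def env1_def env0_def mku_instance_def)
    note step = card_Int_atMost_Suc[OF p(1), of "rowset X s c"]
    show ?thesis
    proof (rule wp_Cond; unfold bval_member[OF e' c' p(3,1)] R)
      assume m: "Suc i \<in> rowset X s c"
      show "wp (nkeys K X) (NAssign ''cnt'' (NRead ''blk'' (NAdd (V ''i'') (NConst 1)))
        (NAdd (NRead ''cnt'' (NRead ''blk'' (NAdd (V ''i'') (NConst 1)))) (NConst 1)))
        (\<lambda>s'. \<forall>j\<in>{1..nblocks X}. nmem s' ''cnt'' j = card (rowset X s c \<inter> {1..Suc i} \<inter> block X j)) s'"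
        unfolding step using m b p(2,3) by simp
    next
      assume m: "Suc i \<notin> rowset X s c"
      show "wp (nkeys K X) Skip
        (\<lambda>s'. \<forall>j\<in>{1..nblocks X}. nmem s' ''cnt'' j = card (rowset X s c \<inter> {1..Suc i} \<inter> block X j)) s'"
        unfolding step using m p(2) by simp
    qed
  qed
  subgoal using rowset_subset[of X s c] by (simp add: Int_absorb2)
  done

lemma wp_check_blocks:
  assumes X: "mku_instance X" and e: "env2 K X s" and ok: "nmem s ''ok'' 0 \<noteq> 0"
  shows "wp (nkeys K X) check_blocks (\<lambda>s'. nmem s' ''ok'' 0 \<noteq> 0 \<longleftrightarrow>
    (\<forall>j\<in>{1..<nblocks X}. quota X j \<le> nmem s ''cnt'' j \<and> (j = exact X \<longrightarrow> nmem s ''cnt'' j \<le> quota X j))) s"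
  unfolding check_blocks_def
  apply (rule wp_For[where h = "nblocks X" and I = "\<lambda>i s'. nmem s' ''ok'' 0 \<noteq> 0 \<longleftrightarrow>
    (\<forall>j\<in>{1..<i}. quota X j \<le> nmem s ''cnt'' j \<and> (j = exact X \<longrightarrow> nmem s ''cnt'' j \<le> quota X j))"])
  subgoal using e by (simp add: env2_def env1_def env0_def)
  subgoal by (rule nkeys_bounds[OF X])
  subgoal by simp
  subgoal by simp
  subgoal by simp
  subgoal using ok by simp
  subgoal by simp
  subgoal premises p for j s'
  proof -
    have e': "env2 K X s'" by (rule env2_frame[OF p(4) e]) auto
    have v: "nmem s' ''cnt'' = nmem s ''cnt''" "nmem s' ''j0'' 0 = exact X"
      using p(4) e' by (simp_all add: frame_def env2_def env1_def env0_def)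
    let ?G = "\<lambda>j. quota X j \<le> nmem s ''cnt'' j \<and> (j = exact X \<longrightarrow> nmem s ''cnt'' j \<le> quota X j)"
    have "nmem s' ''Delta'' j = quota X j" if "j \<noteq> 0"
      using that e' p(1) by (simp add: env2_def env1_def env0_def)
    then have bad: "bval violated s' \<longleftrightarrow> j \<noteq> 0 \<and> \<not> ?G j"
      using p(3) v by (cases "j = 0") (auto simp: violated_def)
    have split: "(\<forall>a\<in>{1..<Suc j}. ?G a) \<longleftrightarrow> (j \<noteq> 0 \<longrightarrow> ?G j) \<and> (\<forall>a\<in>{1..<j}. ?G a)"
    proof (cases "j = 0")
      case False
      then have "{1..<Suc j} = insert j {1..<j}" by auto
      then show ?thesis using False by simp
    qed simp
    show ?thesis
      unfolding split
    proof (rule wp_Cond)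
      assume "bval violated s'"
      then show "wp (nkeys K X) (NAssign ''ok'' (NConst 0) (NConst 0))
        (\<lambda>s'. nmem s' ''ok'' 0 \<noteq> 0 \<longleftrightarrow> (j \<noteq> 0 \<longrightarrow> ?G j) \<and> (\<forall>a\<in>{1..<j}. ?G a)) s'"
        unfolding bad wp_NAssign mem_upd fun_upd_same nval.simps by blast
    next
      assume "\<not> bval violated s'"
      then show "wp (nkeys K X) Skip
        (\<lambda>s'. nmem s' ''ok'' 0 \<noteq> 0 \<longleftrightarrow> (j \<noteq> 0 \<longrightarrow> ?G j) \<and> (\<forall>a\<in>{1..<j}. ?G a)) s'"
        unfolding bad wp_Skip p(2) by blast
    qed
  qed
  subgoal .
  done

lemma wp_check:
  assumes X: "mku_instance X" and e: "env2 K X s" and c: "nmem s ''c'' 0 = c"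
  shows "wp (nkeys K X) check (\<lambda>s'. nmem s' ''ok'' 0 \<noteq> 0 \<longleftrightarrow>
    (\<forall>j\<in>{1..nblocks X - 1}. j \<noteq> exact X \<longrightarrow> card (rowset X s c \<inter> block X j) \<ge> quota X j) \<and>
    card (rowset X s c \<inter> block X (exact X)) = quota X (exact X)) s"
  unfolding check_def
  apply (rule wp_Seq'[OF wp_count_reset[OF X e]])
  subgoal premises p for s1
  proof -
    have e1: "env2 K X s1" by (rule env2_frame[OF p(1) e]) auto
    have c1: "nmem s1 ''c'' 0 = c" using p(1) c by (simp add: frame_def)
    have R: "rowset X s1 = rowset X s" by (rule rowset_frame[OF p(1)]) auto
    show ?thesis
      apply (rule wp_Seq'[OF wp_count_items[OF X e1 c1 p(2)]])
      subgoal premises q for s2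
      proof (rule wp_SeqN, rule wp_conseq[OF wp_check_blocks[OF X]])
        let ?s = "nupd ''ok'' (nval (NConst 0) s2) (nval (NConst 1) s2) s2"
        have "env2 K X s2" by (rule env2_frame[OF q(1) e1]) auto
        then show "env2 K X ?s" by (simp add: env2_def env1_def env0_def)
        show "nmem ?s ''ok'' 0 \<noteq> 0" by simp
        fix s3
        assume ok: "nmem s3 ''ok'' 0 \<noteq> 0 \<longleftrightarrow>
          (\<forall>j\<in>{1..<nblocks X}. quota X j \<le> nmem ?s ''cnt'' j \<and> (j = exact X \<longrightarrow> nmem ?s ''cnt'' j \<le> quota X j))"
        have cnt: "nmem ?s ''cnt'' j = card (rowset X s c \<inter> block X j)" if "j \<in> {1..<nblocks X}" for j
          using q(2) that R by simp
        have ex: "exact X \<in> {1..<nblocks X}" using X by (auto simp: mku_instance_def)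
        have iv: "{1..nblocks X - 1} = {1..<nblocks X}" using X by (auto simp: mku_instance_def)
        have "(\<forall>j\<in>{1..<nblocks X}. quota X j \<le> nmem ?s ''cnt'' j \<and> (j = exact X \<longrightarrow> nmem ?s ''cnt'' j \<le> quota X j)) \<longleftrightarrow>
          (\<forall>j\<in>{1..<nblocks X}. quota X j \<le> card (rowset X s c \<inter> block X j) \<and> (j = exact X \<longrightarrow> card (rowset X s c \<inter> block X j) \<le> quota X j))"
          by (intro ball_cong refl) (simp only: cnt)
        also have "\<dots> \<longleftrightarrow> (\<forall>j\<in>{1..<nblocks X}. j \<noteq> exact X \<longrightarrow> quota X j \<le> card (rowset X s c \<inter> block X j)) \<and>
          card (rowset X s c \<inter> block X (exact X)) = quota X (exact X)"
          using ex by (metis le_antisym order_refl)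
        finally show "nmem s3 ''ok'' 0 \<noteq> 0 \<longleftrightarrow>
          (\<forall>j\<in>{1..nblocks X - 1}. j \<noteq> exact X \<longrightarrow> card (rowset X s c \<inter> block X j) \<ge> quota X j) \<and>
          card (rowset X s c \<inter> block X (exact X)) = quota X (exact X)"
          unfolding ok iv .
      qed
      done
  qed
  done

section \<open>Evaluating the objective exactly by the tail recursion\<close>

definition tail_reset :: com where
  "tail_reset = For ''j'' ''n'' (RAssign ''t'' (NAdd (V ''j'') (NConst 1)) (ROfNat (NConst 0)))"

text \<open>The index \<open>a = n - j\<close> descends, so entry \<open>a - 1\<close> still belongs
  to the set without the new item.\<close>

definition tail_item :: com where
  "tail_item = For ''j'' ''n'' (Seq (NAssign ''a'' (NConst 0) (NSub (V ''n'') (V ''j'')))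
    (RAssign ''t'' (V ''a'') (RAdd
      (RMul (RRead ''p'' (NAdd (V ''i'') (NConst 1))) (RRead ''t'' (NSub (V ''a'') (NConst 1))))
      (RMul (RSub (ROfNat (NConst 1)) (RRead ''p'' (NAdd (V ''i'') (NConst 1)))) (RRead ''t'' (V ''a''))))))"

definition tail_items :: com where
  "tail_items = For ''i'' ''n'' (Cond member tail_item Skip)"

definition evaluate :: com where
  "evaluate = Seq tail_reset (Seq (RAssign ''t'' (NConst 0) (ROfNat (NConst 1))) (Seq tail_items
    (Cond (NLe (V ''k'') (V ''n'')) (RAssign ''val'' (NConst 0) (RRead ''t'' (V ''k'')))
      (RAssign ''val'' (NConst 0) (ROfNat (NConst 0))))))"

lemma evaluate_writes [simp]:
  "nwrites tail_reset = {''j''}" "rwrites tail_reset = {''t''}"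
  "nwrites tail_item = {''j'', ''a''}" "rwrites tail_item = {''t''}"
  "nwrites tail_items = {''i'', ''j'', ''a''}" "rwrites tail_items = {''t''}"
  "nwrites evaluate = {''i'', ''j'', ''a''}" "rwrites evaluate = {''t'', ''val''}"
  by (auto simp: tail_reset_def tail_item_def tail_items_def evaluate_def)

lemma wp_tail_reset:
  assumes X: "mku_instance X" and e: "env2 K X s"
  shows "wp (nkeys K X) tail_reset (\<lambda>s'. \<forall>j\<in>{1..nitems X}. rmem s' ''t'' j = 0) s"
  unfolding tail_reset_def
  apply (rule wp_For[where h = "nitems X" and I = "\<lambda>i s. \<forall>j\<in>{1..i}. rmem s ''t'' j = 0"])
  subgoal using e by (simp add: env2_def env1_def env0_def)
  subgoal by (rule nkeys_bounds[OF X])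
  subgoal by simp
  subgoal by simp
  subgoal by simp
  subgoal by simp
  subgoal by simp
  subgoal by (auto simp: le_Suc_eq)
  subgoal .
  done

lemma wp_tail_item:
  assumes X: "mku_instance X" and e: "env2 K X s" and i: "nmem s ''i'' 0 = i" "i < nitems X"
    and A: "finite A" "Suc i \<notin> A"
    and t: "\<forall>b\<le>nitems X. rmem s ''t'' b = tailp (iprob X) A b"
  shows "wp (nkeys K X) tail_item (\<lambda>s'. \<forall>b\<le>nitems X. rmem s' ''t'' b = tailp (iprob X) (insert (Suc i) A) b) s"
  unfolding tail_item_def
  apply (rule wp_For[where h = "nitems X" and I = "\<lambda>j s'. \<forall>b\<le>nitems X. rmem s' ''t'' b =
      (if nitems X - j < b then tailp (iprob X) (insert (Suc i) A) b else tailp (iprob X) A b)"])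
  subgoal using e by (simp add: env2_def env1_def env0_def)
  subgoal by (rule nkeys_bounds[OF X])
  subgoal by simp
  subgoal by simp
  subgoal by simp
  subgoal using t by simp
  subgoal by simp
  subgoal premises p for j s'
  proof -
    have e': "env2 K X s'" by (rule env2_frame[OF p(4) e]) auto
    define d where "d = nitems X - j - 1"
    have d: "nitems X - j = Suc d" "nitems X - Suc j = d" "Suc d \<le> nitems X" using p(1) by (auto simp: d_def)
    have v: "nmem s' ''n'' 0 = nitems X" "rmem s' ''p'' (Suc i) = iprob X (Suc i)" "nmem s' ''i'' 0 = i"
      using e' i p(4) by (simp_all add: env2_def env1_def env0_def frame_def)
    have old: "rmem s' ''t'' d = tailp (iprob X) A d" "rmem s' ''t'' (Suc d) = tailp (iprob X) A (Suc d)"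
      using p(2) d by auto
    show ?thesis
    proof (rule wp_SeqN, unfold wp_RAssign, intro allI impI)
      fix b assume b: "b \<le> nitems X"
      show "rmem (rupd ''t'' (nval (V ''a'') (nupd ''a'' (nval (NConst 0) s') (nval (NSub (V ''n'') (V ''j'')) s') s'))
         (rval (RAdd
      (RMul (RRead ''p'' (NAdd (V ''i'') (NConst 1))) (RRead ''t'' (NSub (V ''a'') (NConst 1))))
      (RMul (RSub (ROfNat (NConst 1)) (RRead ''p'' (NAdd (V ''i'') (NConst 1)))) (RRead ''t'' (V ''a''))))
           (nupd ''a'' (nval (NConst 0) s') (nval (NSub (V ''n'') (V ''j'')) s') s'))
         (nupd ''a'' (nval (NConst 0) s') (nval (NSub (V ''n'') (V ''j'')) s') s')) ''t'' b =
        (if nitems X - Suc j < b then tailp (iprob X) (insert (Suc i) A) b else tailp (iprob X) A b)"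
      proof (cases "b = Suc d")
        case True
        then show ?thesis using v p(3) d old tailp_insert[OF A] by simp
      next
        case False
        then have "(d < b) = (Suc d < b)" by auto
        then show ?thesis using v p(3) d False p(2)[rule_format, OF b] by simp
      qed
    qed
  qed
  subgoal for s'
  proof (intro allI impI)
    fix b assume "\<forall>b\<le>nitems X. rmem s' ''t'' b =
      (if nitems X - nitems X < b then tailp (iprob X) (insert (Suc i) A) b else tailp (iprob X) A b)" "b \<le> nitems X"
    \<comment> \<open>Entry 0 is never rewritten, but the tail at 0 is 1 for every set.\<close>
    then show "rmem s' ''t'' b = tailp (iprob X) (insert (Suc i) A) b" by (cases b) auto
  qed
  done

lemma wp_tail_items:
  assumes X: "mku_instance X" and e: "env2 K X s" and c: "nmem s ''c'' 0 = c"
    and t: "\<forall>b\<le>nitems X. rmem s ''t'' b = tailp (iprob X) {} b"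
  shows "wp (nkeys K X) tail_items (\<lambda>s'. \<forall>b\<le>nitems X. rmem s' ''t'' b = tailp (iprob X) (rowset X s c) b) s"
  unfolding tail_items_def
  apply (rule wp_For[where h = "nitems X" and
      I = "\<lambda>i s'. \<forall>b\<le>nitems X. rmem s' ''t'' b = tailp (iprob X) (rowset X s c \<inter> {1..i}) b"])
  subgoal using e by (simp add: env2_def env1_def env0_def)
  subgoal by (rule nkeys_bounds[OF X])
  subgoal by simp
  subgoal by simp
  subgoal by simp
  subgoal using t by simp
  subgoal by simp
  subgoal premises p for i s'
  proof -
    have e': "env2 K X s'" by (rule env2_frame[OF p(4) e]) auto
    have c': "nmem s' ''c'' 0 = c" using p(4) c by (simp add: frame_def)
    have R: "rowset X s' = rowset X s" by (rule rowset_frame[OF p(4)]) auto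
    show ?thesis
    proof (rule wp_Cond; unfold bval_member[OF e' c' p(3,1)] R)
      assume m: "Suc i \<in> rowset X s c"
      have "rowset X s c \<inter> {1..Suc i} = insert (Suc i) (rowset X s c \<inter> {1..i})"
        using m by (auto simp: le_Suc_eq)
      then show "wp (nkeys K X) tail_item
        (\<lambda>s'. \<forall>b\<le>nitems X. rmem s' ''t'' b = tailp (iprob X) (rowset X s c \<inter> {1..Suc i}) b) s'"
        using wp_tail_item[OF X e' p(3,1) _ _ p(2)] by simp
    next
      assume m: "Suc i \<notin> rowset X s c"
      have "rowset X s c \<inter> {1..Suc i} = rowset X s c \<inter> {1..i}"
        using m by (auto simp: le_Suc_eq)
      then show "wp (nkeys K X) Skip
        (\<lambda>s'. \<forall>b\<le>nitems X. rmem s' ''t'' b = tailp (iprob X) (rowset X s c \<inter> {1..Suc i}) b) s'"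
        using p(2) by simp
    qed
  qed
  subgoal using rowset_subset[of X s c] by (simp add: Int_absorb2)
  done

lemma wp_evaluate:
  assumes X: "mku_instance X" and e: "env2 K X s" and c: "nmem s ''c'' 0 = c"
  shows "wp (nkeys K X) evaluate (\<lambda>s'. rmem s' ''val'' 0 = mku_value X (rowset X s c)) s"
  unfolding evaluate_def
  apply (rule wp_Seq'[OF wp_tail_reset[OF X e]])
  subgoal premises p for s1
  proof (rule wp_SeqR)
    let ?s2 = "rupd ''t'' (nval (NConst 0) s1) (rval (ROfNat (NConst 1)) s1) s1"
    have e1: "env2 K X s1" by (rule env2_frame[OF p(1) e]) auto
    then have e2: "env2 K X ?s2" by (simp add: env2_def env1_def env0_def)
    have c2: "nmem ?s2 ''c'' 0 = c" using p(1) c by (simp add: frame_def)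
    have R: "rowset X ?s2 = rowset X s" using rowset_frame[OF p(1), of X] by (simp add: rowset_def fun_eq_iff)
    have t: "\<forall>b\<le>nitems X. rmem ?s2 ''t'' b = tailp (iprob X) {} b"
    proof (intro allI impI)
      fix b assume "b \<le> nitems X"
      then show "rmem ?s2 ''t'' b = tailp (iprob X) {} b" using p(2) by (cases b) auto
    qed
    have card: "card (rowset X s c) \<le> nitems X"
      using card_mono[OF _ rowset_subset[of X s c]] by simp
    have fin: "finite (rowset X s c)" by (rule finite_subset[OF rowset_subset]) simp
    show "wp (nkeys K X) (Seq tail_items
    (Cond (NLe (V ''k'') (V ''n'')) (RAssign ''val'' (NConst 0) (RRead ''t'' (V ''k'')))
      (RAssign ''val'' (NConst 0) (ROfNat (NConst 0))))) (\<lambda>s'. rmem s' ''val'' 0 = mku_value X (rowset X s c)) ?s2"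
      apply (rule wp_Seq'[OF wp_tail_items[OF X e2 c2 t]])
      subgoal premises q for s3
      proof -
        have e3: "env2 K X s3" by (rule env2_frame[OF q(1) e2]) auto
        then have "nmem s3 ''k'' 0 = target X" "nmem s3 ''n'' 0 = nitems X" by (simp_all add: env2_def env1_def env0_def)
        then show ?thesis
          unfolding mku_value_eq_tailp[OF X rowset_subset]
          using q(2)[unfolded R] tailp_eq_0[OF fin, of "target X" "iprob X"] card
          by (intro wp_Cond) auto
      qed
      done
  qed
  done

section \<open>Scanning the keys for the best feasible set\<close>

definition save_row :: com where
  "save_row = For ''j'' ''n1'' (NAssign ''out'' (V ''j'') (NRead ''memb'' (NAdd (NMul (V ''c'') (V ''n1'')) (V ''j''))))"

definition save :: com where
  "save = Seq (NAssign ''found'' (NConst 0) (NConst 1))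
    (Seq (RAssign ''best'' (NConst 0) (RRead ''val'' (NConst 0))) save_row)"

definition candidate :: bexp where
  "candidate = BAnd (NLe (NConst 1) (NRead ''pres'' (V ''c''))) (RLe (RRead ''size'' (V ''c'')) (RRead ''Q'' (NConst 0)))"

definition no_gain :: bexp where
  "no_gain = BAnd (NLe (NConst 1) (V ''found'')) (RLe (RRead ''val'' (NConst 0)) (RRead ''best'' (NConst 0)))"

definition scan_step :: com where
  "scan_step = Cond candidate
    (Seq check (Cond (NLe (NConst 1) (V ''ok'')) (Seq evaluate (Cond no_gain Skip save)) Skip)) Skip"

definition scan :: com where
  "scan = Seq (NAssign ''found'' (NConst 0) (NConst 0)) (For ''c'' ''B'' scan_step)"

lemma scan_writes [simp]:
  "nwrites save_row = {''j'', ''out''}" "rwrites save_row = {}"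
  "nwrites save = {''j'', ''out'', ''found''}" "rwrites save = {''best''}"
  "nwrites scan_step = {''i'', ''j'', ''a'', ''cnt'', ''ok'', ''out'', ''found''}" "rwrites scan_step = {''t'', ''val'', ''best''}"
  by (auto simp: save_row_def save_def scan_step_def)

lemma wp_save_row:
  assumes X: "mku_instance X" and e: "env2 K X s" and c: "nmem s ''c'' 0 = c"
  shows "wp (nkeys K X) save_row (\<lambda>s'. mku_output X s' = rowset X s c) s"
  unfolding save_row_def
  apply (rule wp_For[where h = "nitems X + 1" and I = "\<lambda>j s'. \<forall>a<j. nmem s' ''out'' a = nmem s ''memb'' (c * (nitems X + 1) + a)"])
  subgoal using e by (simp add: env2_def env1_def)
  subgoal by (rule nkeys_bounds[OF X])
  subgoal by simp
  subgoal by simp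
  subgoal by simp
  subgoal by simp
  subgoal by simp
  subgoal premises p for j s'
  proof -
    have e': "env2 K X s'" by (rule env2_frame[OF p(4) e]) auto
    then have n1: "nmem s' ''n1'' 0 = nitems X + 1" by (simp add: env2_def env1_def)
    have v: "nmem s' ''c'' 0 = c" "nmem s' ''memb'' = nmem s ''memb''" using p(4) c by (simp_all add: frame_def)
    show ?thesis
      unfolding wp_NAssign nval.simps p(3) v n1 mem_upd fun_upd_same using p(2) by (auto simp: less_Suc_eq)
  qed
  subgoal premises p for s'
  proof -
    have "nmem s' ''out'' a = nmem s ''memb'' (c * (nitems X + 1) + a)" if "a \<in> {1..nitems X}" for a
      using p(1) that by simp
    then show ?thesis
      unfolding mku_output_def rowset_def by (intro Collect_cong conj_cong refl) (simp only:)
  qed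
  done

lemma wp_save:
  assumes X: "mku_instance X" and e: "env2 K X s" and c: "nmem s ''c'' 0 = c"
  shows "wp (nkeys K X) save (\<lambda>s'. nmem s' ''found'' 0 \<noteq> 0 \<and> rmem s' ''best'' 0 = rmem s ''val'' 0 \<and>
    mku_output X s' = rowset X s c) s"
  unfolding save_def
  apply (rule wp_SeqN)
  apply (rule wp_SeqR)
  apply (rule wp_conseq[OF wp_save_row[OF X, where c = c]])
  subgoal using e by (simp add: env2_def env1_def env0_def)
  subgoal using c by simp
  subgoal for s' by (simp add: frame_def rowset_def)
  done

text \<open>The feasible keys \<open>F\<close> and stored sets \<open>R\<close> are fixed
  parameters, since scanning leaves the table unchanged. The flag \<open>found\<close> replaces an
  initial value for \<open>best\<close>.\<close>

definition scan_inv :: "mku \<Rightarrow> (nat \<Rightarrow> bool) \<Rightarrow> (nat \<Rightarrow> nat set) \<Rightarrow> nat \<Rightarrow> state \<Rightarrow> bool" where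
  "scan_inv X F R c s \<longleftrightarrow>
    (if nmem s ''found'' 0 = 0 then \<forall>y<c. \<not> F y
     else mku_solution X (mku_output X s) \<and> rmem s ''best'' 0 = mku_value X (mku_output X s) \<and>
       (\<forall>y<c. F y \<longrightarrow> mku_value X (R y) \<le> rmem s ''best'' 0))"

lemma scan_inv_cong:
  assumes "nmem s' ''found'' 0 = nmem s ''found'' 0" "nmem s' ''out'' = nmem s ''out''" "rmem s' ''best'' 0 = rmem s ''best'' 0"
  shows "scan_inv X F R c s' = scan_inv X F R c s"
  using assms by (simp add: scan_inv_def mku_output_def)

lemma wp_scan_step:
  assumes X: "mku_instance X" and e: "env2 K X s" and c: "nmem s ''c'' 0 = c"
    and R: "R = rowset X s" and F: "\<And>y. F y \<longleftrightarrow> nmem s ''pres'' y \<noteq> 0 \<and> mku_solution X (R y)"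
    and size: "nmem s ''pres'' c \<noteq> 0 \<Longrightarrow> rmem s ''size'' c = sum (isize X) (R c)"
    and inv: "scan_inv X F R c s"
  shows "wp (nkeys K X) scan_step (scan_inv X F R (Suc c)) s"
proof -
  have cand: "bval candidate s \<longleftrightarrow> nmem s ''pres'' c \<noteq> 0 \<and> sum (isize X) (R c) \<le> capacity X"
    using e c size by (auto simp: candidate_def env2_def env1_def env0_def Suc_le_eq)
  have skip: "scan_inv X F R (Suc c) s'" if "scan_inv X F R c s'" "\<not> F c" for s'
    using that by (auto simp: scan_inv_def less_Suc_eq)
  show ?thesis
    unfolding scan_step_def
  proof (rule wp_Cond)
    assume b: "\<not> bval candidate s"
    then have "\<not> F c" unfolding cand F by (auto simp: mku_solution_def)
    then show "wp (nkeys K X) Skip (scan_inv X F R (Suc c)) s" using skip inv by simp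
  next
    assume b: "bval candidate s"
    show "wp (nkeys K X) (Seq check (Cond (NLe (NConst 1) (V ''ok'')) (Seq evaluate (Cond no_gain Skip save)) Skip))
      (scan_inv X F R (Suc c)) s"
    proof (rule wp_Seq'[OF wp_check[OF X e c]])
      fix s1 assume f: "frame (nwrites check) (rwrites check) s s1"
        and ok: "nmem s1 ''ok'' 0 \<noteq> 0 \<longleftrightarrow>
          (\<forall>j\<in>{1..nblocks X - 1}. j \<noteq> exact X \<longrightarrow> card (rowset X s c \<inter> block X j) \<ge> quota X j) \<and>
          card (rowset X s c \<inter> block X (exact X)) = quota X (exact X)"
      have e1: "env2 K X s1" by (rule env2_frame[OF f e]) auto
      have c1: "nmem s1 ''c'' 0 = c" using f c by (simp add: frame_def)
      have R1: "rowset X s1 = R" unfolding R by (rule rowset_frame[OF f]) auto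
      have inv1: "scan_inv X F R c s1"
        using inv f by (subst scan_inv_cong[of _ s]) (simp_all add: frame_def)
      have ok': "nmem s1 ''ok'' 0 \<noteq> 0 \<longleftrightarrow> F c"
        unfolding ok F mku_solution_def using b rowset_subset[of X s c] by (auto simp: cand R)
      show "wp (nkeys K X) (Cond (NLe (NConst 1) (V ''ok'')) (Seq evaluate (Cond no_gain Skip save)) Skip)
        (scan_inv X F R (Suc c)) s1"
      proof (rule wp_Cond)
        assume "\<not> bval (NLe (NConst 1) (V ''ok'')) s1"
        then have "\<not> F c" unfolding ok'[symmetric] by simp
        then show "wp (nkeys K X) Skip (scan_inv X F R (Suc c)) s1" using skip inv1 by simp
      next
        assume "bval (NLe (NConst 1) (V ''ok'')) s1"
        then have Fc: "F c" unfolding ok'[symmetric] by simp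
        show "wp (nkeys K X) (Seq evaluate (Cond no_gain Skip save)) (scan_inv X F R (Suc c)) s1"
        proof (rule wp_Seq'[OF wp_evaluate[OF X e1 c1]])
          fix s2 assume f2: "frame (nwrites evaluate) (rwrites evaluate) s1 s2"
            and val: "rmem s2 ''val'' 0 = mku_value X (rowset X s1 c)"
          have e2: "env2 K X s2" by (rule env2_frame[OF f2 e1]) auto
          have c2: "nmem s2 ''c'' 0 = c" using f2 c1 by (simp add: frame_def)
          have R2: "rowset X s2 = R" using rowset_frame[OF f2, of X] R1 by simp
          have inv2: "scan_inv X F R c s2"
            using inv1 f2 by (subst scan_inv_cong[of _ s1]) (simp_all add: frame_def)
          show "wp (nkeys K X) (Cond no_gain Skip save) (scan_inv X F R (Suc c)) s2"
          proof (rule wp_Cond)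
            assume "bval no_gain s2"
            then have "nmem s2 ''found'' 0 \<noteq> 0" "mku_value X (R c) \<le> rmem s2 ''best'' 0"
              using val R1 by (auto simp: no_gain_def)
            then show "wp (nkeys K X) Skip (scan_inv X F R (Suc c)) s2"
              using inv2 by (auto simp: scan_inv_def less_Suc_eq)
          next
            assume "\<not> bval no_gain s2"
            then have ng: "nmem s2 ''found'' 0 = 0 \<or> rmem s2 ''best'' 0 < mku_value X (R c)"
              using val R1 by (auto simp: no_gain_def)
            \<comment> \<open>If nothing had been found, the invariant excludes feasible keys below
              \<open>c\<close>; otherwise the old best value is beaten.\<close>
            have "mku_value X (R y) \<le> mku_value X (R c)" if "F y" "y < Suc c" for y
            proof (cases "y = c")
              case False
              then have "y < c" using that by simp
              then have "nmem s2 ''found'' 0 \<noteq> 0 \<and> mku_value X (R y) \<le> rmem s2 ''best'' 0"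
                using inv2 that(1) unfolding scan_inv_def by metis
              then show ?thesis using ng by simp
            qed simp
            moreover have "mku_solution X (R c)" using Fc F by simp
            ultimately show "wp (nkeys K X) save (scan_inv X F R (Suc c)) s2"
              by (intro wp_conseq[OF wp_save[OF X e2 c2]]) (simp add: scan_inv_def val R1 R2)
          qed
        qed
      qed
    qed
  qed
qed

lemma wp_scan:
  assumes X: "mku_instance X" and e: "env2 K X s" and tab: "dp_table K X (nitems X) 0 s"
    and K: "even K" "K \<ge> 4"
  shows "wp (nkeys K X) scan (\<lambda>s'. \<forall>J. mku_solution X J \<longrightarrow>
    mku_solution X (mku_output X s') \<and> mku_value X J - 10 / K \<le> mku_value X (mku_output X s')) s"
proof -
  define R where "R = rowset X s"
  define F where "F y \<longleftrightarrow> nmem s ''pres'' y \<noteq> 0 \<and> mku_solution X (R y)" for y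
  have be: "best_entry K X (nitems X) y (nmem s ''pres'' y \<noteq> 0) (rmem s ''size'' y) (R y)" if "y < nkeys K X" for y
    using tab[unfolded dp_table_def, rule_format, OF that] that by (simp add: R_def)
  \<comment> \<open>The set stored under the key of \<open>J\<close> has the block counts of
    \<open>J\<close> and no larger size, hence is feasible, and its value is within
    \<open>10 / K\<close>.\<close>
  have cover: "\<exists>y<nkeys K X. F y \<and> mku_value X J - 10 / K \<le> mku_value X (R y)" if J: "mku_solution X J" for J
  proof -
    let ?y = "sum (ikey K X) J"
    have Jn: "J \<subseteq> {1..nitems X}" using J by (simp add: mku_solution_def)
    have y: "?y < nkeys K X" unfolding nkeys_def by (rule sum_ikey_less[OF X Jn])
    have pres: "nmem s ''pres'' ?y \<noteq> 0" and le: "rmem s ''size'' ?y \<le> sum (isize X) J"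
      using best_entryD[OF be[OF y] Jn refl] by auto
    have Ry: "R ?y \<subseteq> {1..nitems X}" "sum (ikey K X) (R ?y) = ?y" "rmem s ''size'' ?y = sum (isize X) (R ?y)"
      using be[OF y] unfolding best_entry_def if_P[OF pres] by auto
    have ex: "exact X \<in> {1..nblocks X}" "{1..nblocks X - 1} \<subseteq> {1..nblocks X}"
      using X by (auto simp: mku_instance_def)
    note cnt = same_key_solutions(1)[OF X Ry(1) Jn Ry(2) K]
    have "mku_solution X (R ?y)"
      using J Ry le cnt[OF ex(1)] cnt ex(2) unfolding mku_solution_def by (auto dest: subsetD)
    moreover have "\<bar>mku_value X (R ?y) - mku_value X J\<bar> \<le> 10 / K"
      by (rule same_key_solutions(2)[OF X Ry(1) Jn Ry(2) K])
    ultimately show ?thesis using y pres by (intro exI[of _ ?y]) (auto simp: F_def)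
  qed
  show ?thesis
    unfolding scan_def
    apply (rule wp_SeqN)
    apply (rule wp_For[where h = "nkeys K X" and I = "scan_inv X F R"])
    subgoal using e by (simp add: env2_def env1_def)
    subgoal by simp
    subgoal by simp
    subgoal by simp
    subgoal by simp
    subgoal by (simp add: scan_inv_def)
    subgoal for c s v by (subst scan_inv_cong[of _ s]) simp_all
    subgoal premises p for c s'
    proof -
      have f: "frame ({''found''} \<union> insert ''c'' (nwrites scan_step)) (rwrites scan_step) s s'"
        using p(4) by (auto simp: frame_def)
      have e': "env2 K X s'" by (rule env2_frame[OF f e]) auto
      have R': "rowset X s' = R" unfolding R_def by (rule rowset_frame[OF f]) auto
      have v: "nmem s' ''pres'' = nmem s ''pres''" "rmem s' ''size'' = rmem s ''size''"
        using f by (simp_all add: frame_def)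
      have "rmem s' ''size'' c = sum (isize X) (R c)" if "nmem s' ''pres'' c \<noteq> 0"
        using be[OF p(1)] that unfolding v best_entry_def by simp
      then show ?thesis
        using p(2) R' by (intro wp_scan_step[OF X e' p(3)]) (auto simp: F_def v)
    qed
    subgoal premises p for s'
    proof (intro allI impI)
      fix J assume J: "mku_solution X J"
      then obtain y where y: "y < nkeys K X" "F y" "mku_value X J - 10 / K \<le> mku_value X (R y)"
        using cover by blast
      then have "nmem s' ''found'' 0 \<noteq> 0" using p(1) unfolding scan_inv_def by metis
      then have "mku_solution X (mku_output X s')" "mku_value X (R y) \<le> mku_value X (mku_output X s')"
        using p(1) y unfolding scan_inv_def by auto
      then show "mku_solution X (mku_output X s') \<and> mku_value X J - 10 / K \<le> mku_value X (mku_output X s')"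
        using y by simp
    qed
    done
qed

definition mku_prog :: "nat \<Rightarrow> com" where
  "mku_prog K = Seq (init K) (Seq keys (Seq dp scan))"

lemma init_writes [simp]:
  "nwrites (init K) = {''n1'', ''K'', ''G'', ''D'', ''E'', ''pw'', ''e'', ''B''}" "rwrites (init K) = {}"
  by (auto simp: init_def)

lemma wp_mku_prog:
  assumes X: "mku_instance X" and K: "even K" "K \<ge> 4"
  shows "wp (nkeys K X) (mku_prog K) (\<lambda>s'. \<forall>J. mku_solution X J \<longrightarrow>
    mku_solution X (mku_output X s') \<and> mku_value X J - 10 / K \<le> mku_value X (mku_output X s')) (mku_input X)"
  unfolding mku_prog_def
proof (rule wp_Seq'[OF wp_init[OF X]])
  show "env0 X (mku_input X)" by (simp add: env0_def mku_input_def)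
  fix s1 assume f1: "frame (nwrites (init K)) (rwrites (init K)) (mku_input X) s1" and e1: "env1 K X s1"
  show "wp (nkeys K X) (Seq keys (Seq dp scan)) (\<lambda>s'. \<forall>J. mku_solution X J \<longrightarrow>
    mku_solution X (mku_output X s') \<and> mku_value X J - 10 / K \<le> mku_value X (mku_output X s')) s1"
  proof (rule wp_Seq'[OF wp_keys[OF X e1]])
    fix s2 assume f2: "frame (nwrites keys) (rwrites keys) s1 s2" and e2: "env2 K X s2"
    have "nmem s2 ''pres'' = (\<lambda>_. 0)" "nmem s2 ''memb'' = (\<lambda>_. 0)" "rmem s2 ''size'' = (\<lambda>_. 0)"
      using f1 f2 by (simp_all add: frame_def mku_input_def)
    note dp = wp_dp[OF X e2 this]
    show "wp (nkeys K X) (Seq dp scan) (\<lambda>s'. \<forall>J. mku_solution X J \<longrightarrow>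
      mku_solution X (mku_output X s') \<and> mku_value X J - 10 / K \<le> mku_value X (mku_output X s')) s2"
    proof (rule wp_Seq'[OF dp])
      fix s3 assume f3: "frame (nwrites dp) (rwrites dp) s2 s3" and tab: "dp_table K X (nitems X) 0 s3"
      have "env2 K X s3" by (rule env2_frame[OF f3 e2]) auto
      then show "wp (nkeys K X) scan (\<lambda>s'. \<forall>J. mku_solution X J \<longrightarrow>
        mku_solution X (mku_output X s') \<and> mku_value X J - 10 / K \<le> mku_value X (mku_output X s')) s3"
        by (rule wp_scan[OF X _ tab K])
    qed
  qed
qed

section \<open>Running time\<close>

text \<open>\<open>K\<close> occurs only as a constant of unit cost, so the time coefficient does
  not depend on it; this allows \<open>C\<close> to be chosen before \<open>\<epsilon>\<close>. The
  deepest nesting is items, keys and row copying, or keys, items and tail entries.\<close>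

lemma mku_prog_cost:
  "time_bound 0 (mku_prog K) = time_bound 0 (mku_prog 0)" "depth (mku_prog K) = 3"
  by (simp_all add: mku_prog_def init_def keys_def key_item_def key_g_def key_l_def dp_def dp_step_def
      dp_take_def dp_copy_row_def scan_def scan_step_def check_def count_reset_def count_items_def
      check_blocks_def evaluate_def tail_reset_def tail_item_def tail_items_def save_def save_row_def)

text \<open>Each factor of \<open>base\<close> is bounded by a power of \<open>N \<ge> 2\<close>:
  \<open>N ^ (K + 1)\<close> for \<open>K + 2\<close> and \<open>N ^ 2\<close> for each
  \<open>n + 1\<close>.\<close>

lemma nkeys_le:
  fixes X :: mku and N :: nat
  defines "N \<equiv> max 2 (nitems X)"
  shows "nkeys K X \<le> N ^ ((K + 5) * ndigits K X)"
proof -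
  have N: "2 \<le> N" by (simp add: N_def)
  have "K + 2 \<le> 2 ^ (K + 1)" using less_exp[of "K + 1"] by simp
  also have "\<dots> \<le> N ^ (K + 1)" using N by (intro power_mono) auto
  finally have 1: "K + 2 \<le> N ^ (K + 1)" .
  have "nitems X + 1 \<le> 2 * N" by (simp add: N_def)
  also have "\<dots> \<le> N ^ 2" using N by (simp add: power2_eq_square)
  finally have 2: "nitems X + 1 \<le> N ^ 2" .
  have "base K X \<le> N ^ (K + 1) * N ^ 2 * N ^ 2"
    unfolding base_def by (intro mult_mono 1 2) auto
  also have "\<dots> = N ^ (K + 1 + 2 + 2)" by (simp only: power_add)
  also have "K + 1 + 2 + 2 = K + 5" by simp
  finally have "base K X ^ ndigits K X \<le> (N ^ (K + 5)) ^ ndigits K X" by (intro power_mono) auto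
  then show ?thesis by (simp add: nkeys_def power_mult)
qed

text \<open>Constants move into the exponent: \<open>c \<le> 2 ^ c\<close>, and adding 1 at most
  doubles.\<close>

lemma steps_le:
  fixes X :: mku and N c :: nat
  defines "N \<equiv> max 2 (nitems X)"
  shows "c * (nkeys K X + 1) ^ 3 \<le> N ^ (c + 3 * (1 + (K + 5) * ndigits K X))"
proof -
  let ?e = "(K + 5) * ndigits K X"
  have N: "2 \<le> N" by (simp add: N_def)
  have "c \<le> 2 ^ c" by (simp add: less_imp_le less_exp)
  also have "\<dots> \<le> N ^ c" using N by (intro power_mono) auto
  finally have 1: "c \<le> N ^ c" .
  have "1 \<le> N ^ ?e" using N by (intro one_le_power) simp
  then have "nkeys K X + 1 \<le> 2 * N ^ ?e"
    using nkeys_le[of K X] unfolding N_def by linarith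
  also have "\<dots> \<le> N ^ (1 + ?e)" using N by simp
  finally have "(nkeys K X + 1) ^ 3 \<le> (N ^ (1 + ?e)) ^ 3" by (intro power_mono) auto
  also have "\<dots> = N ^ (3 * (1 + ?e))" by (simp only: power_mult[symmetric] mult.commute)
  finally have "c * (nkeys K X + 1) ^ 3 \<le> N ^ c * N ^ (3 * (1 + ?e))" using 1 by (intro mult_mono) auto
  then show ?thesis by (simp only: power_add)
qed

text \<open>The exponent is of order \<open>m / \<epsilon>^2\<close>, which is at most
  \<open>m^5 / \<epsilon>^5\<close> because \<open>m\<close> and \<open>1 / \<epsilon>\<close> are
  at least 1. The constant is \<open>1431 = 3 + 3 * 476\<close>.\<close>

lemma exponent_le:
  fixes \<epsilon> :: real and c m K :: nat
  assumes e: "0 < \<epsilon>" "\<epsilon> < 1" and m: "1 \<le> m" and K: "real K \<le> 12 / \<epsilon>"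
  shows "real (c + 3 * (1 + (K + 5) * (m + 2 * K + 3))) \<le> (real c + 1431) * real m ^ 5 / \<epsilon> ^ 5"
proof -
  define x where "x = 1 / \<epsilon>"
  have x: "1 \<le> x" "real K \<le> 12 * x" using e K by (simp_all add: x_def)
  have mx: "real m \<le> real m * x" "x \<le> real m * x" using x m by (simp_all add: mult_le_cancel_left1 mult_le_cancel_right1)
  \<comment> \<open>Here \<open>17 = 12 + 5\<close> and \<open>28 = 1 + 24 + 3\<close>; their
    product is 476.\<close>
  have "real (K + 5) \<le> 17 * x" "real (m + 2 * K + 3) \<le> 28 * (real m * x)" using x mx by linarith+
  then have "real (K + 5) * real (m + 2 * K + 3) \<le> (17 * x) * (28 * (real m * x))"
    using x by (intro mult_mono) auto
  then have 1: "real ((K + 5) * (m + 2 * K + 3)) \<le> 476 * (real m * x\<^sup>2)"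
    by (simp only: of_nat_mult) (simp add: power2_eq_square mult_ac)
  have mm: "1 \<le> real m" using m by simp
  have le: "real m * x\<^sup>2 \<le> real m ^ 5 * x ^ 5"
    using x mm power_increasing[of 1 5 "real m"] by (intro mult_mono power_increasing) auto
  have "1 \<le> real m * x\<^sup>2" 
    using mult_mono[of 1 "real m" 1 "x\<^sup>2"] mm one_le_power[OF x(1), of 2] by simp
  then have "(real c + 3) * 1 \<le> (real c + 3) * (real m * x\<^sup>2)" by (intro mult_left_mono) auto
  moreover have "real (c + 3 * (1 + P)) = (real c + 3) * 1 + 3 * real P" for P by simp
  ultimately have "real (c + 3 * (1 + (K + 5) * (m + 2 * K + 3))) \<le> (real c + 3) * (real m * x\<^sup>2) + 3 * (476 * (real m * x\<^sup>2))"
    using 1 by (smt (verit))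
  also have "\<dots> = (real c + 1431) * (real m * x\<^sup>2)" by (simp add: algebra_simps)
  also have "\<dots> \<le> (real c + 1431) * (real m ^ 5 * x ^ 5)" using le by (intro mult_left_mono) auto
  finally show ?thesis by (simp add: x_def power_divide)
qed

theorem theorem6:
  shows "\<exists>C>0. \<forall>\<epsilon>::real. 0 < \<epsilon> \<and> \<epsilon> < 1 \<longrightarrow>
    (\<exists>prog. \<forall>X. mku_instance X \<longrightarrow>
      (\<exists>t s. runs prog (mku_input X) t s \<and>
             real t \<le> mku_time C \<epsilon> X \<and>
             ((\<exists>I. mku_solution X I) \<longrightarrow>
                mku_opt X \<in> {0..1} \<and>
                mku_solution X (mku_output X s) \<and>
                mku_value X (mku_output X s) \<ge> mku_opt X - \<epsilon>)))"
proof (intro exI[of _ "real (time_bound 0 (mku_prog 0)) + 1431"] conjI allI impI)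
  fix \<epsilon> :: real assume e: "0 < \<epsilon> \<and> \<epsilon> < 1"
  let ?c = "time_bound 0 (mku_prog 0)"
  \<comment> \<open>The factor 2 makes \<open>K\<close> even, and
    \<open>K \<ge> 10 / \<epsilon>\<close> brings the error \<open>10 / K\<close> down to
    \<open>\<epsilon>\<close>. Rounding up adds less than 2, which is below
    \<open>2 / \<epsilon>\<close>, hence \<open>K \<le> 12 / \<epsilon>\<close>.\<close>
  define K where "K = 2 * nat \<lceil>5 / \<epsilon>\<rceil>"
  have "5 < 5 / \<epsilon>" using e by (simp add: field_simps)
  then have K: "even K" "K \<ge> 4" "10 / \<epsilon> \<le> real K" "real K \<le> 12 / \<epsilon>"
  proof -
    assume 5: "5 < 5 / \<epsilon>"
    have r: "real (nat \<lceil>5 / \<epsilon>\<rceil>) = of_int \<lceil>5 / \<epsilon>\<rceil>" using 5 by simp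
    show "even K" by (simp add: K_def)
    have rK: "real K = 2 * of_int \<lceil>5 / \<epsilon>\<rceil>" unfolding K_def of_nat_mult r by simp
    have c: "5 / \<epsilon> \<le> of_int \<lceil>5 / \<epsilon>\<rceil>" "of_int \<lceil>5 / \<epsilon>\<rceil> < 5 / \<epsilon> + 1" by linarith+
    have "10 / \<epsilon> = 2 * (5 / \<epsilon>)" "12 / \<epsilon> = 2 * (5 / \<epsilon>) + 2 / 5 * (5 / \<epsilon>)" by simp_all
    then show "10 / \<epsilon> \<le> real K" "real K \<le> 12 / \<epsilon>" using rK c 5 by linarith+
    have "4 \<le> real K" using rK c 5 by linarith
    then show "K \<ge> 4" by simp
  qed
  have Ke: "10 / real K \<le> \<epsilon>" using K e by (simp add: field_simps)
  show "\<exists>prog. \<forall>X. mku_instance X \<longrightarrow>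
      (\<exists>t s. runs prog (mku_input X) t s \<and>
             real t \<le> mku_time (real ?c + 1431) \<epsilon> X \<and>
             ((\<exists>I. mku_solution X I) \<longrightarrow>
                mku_opt X \<in> {0..1} \<and>
                mku_solution X (mku_output X s) \<and>
                mku_value X (mku_output X s) \<ge> mku_opt X - \<epsilon>))"
  proof (intro exI[of _ "mku_prog K"] allI impI)
    fix X assume X: "mku_instance X"
    let ?N = "max 2 (nitems X)"
    obtain t s where t: "runs (mku_prog K) (mku_input X) t s" "t \<le> time_bound (nkeys K X) (mku_prog K)"
      and sol: "\<And>J. mku_solution X J \<Longrightarrow>
        mku_solution X (mku_output X s) \<and> mku_value X J - 10 / K \<le> mku_value X (mku_output X s)"
      using wp_mku_prog[OF X K(1,2)] unfolding wp_def by blast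
    have "t \<le> ?c * (nkeys K X + 1) ^ 3"
      using t(2) time_bound_le[of "nkeys K X" "mku_prog K"] unfolding mku_prog_cost[of K] by linarith
    also have "\<dots> \<le> ?N ^ (?c + 3 * (1 + (K + 5) * ndigits K X))" by (rule steps_le)
    finally have "real t \<le> real (?N ^ (?c + 3 * (1 + (K + 5) * ndigits K X)))" by (rule of_nat_mono)
    also have "\<dots> = real ?N powr real (?c + 3 * (1 + (K + 5) * (nblocks X + 2 * K + 3)))"
      unfolding ndigits_def of_nat_power by (subst powr_realpow) simp_all
    also have "\<dots> \<le> real ?N powr ((real ?c + 1431) * real (nblocks X) ^ 5 / \<epsilon> ^ 5)"
      using e K X by (intro powr_mono exponent_le) (auto simp: mku_instance_def)
    also have "\<dots> \<le> mku_time (real ?c + 1431) \<epsilon> X" by (simp add: mku_time_def)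
    finally have time: "real t \<le> mku_time (real ?c + 1431) \<epsilon> X" .
    have "mku_opt X \<in> {0..1} \<and> mku_solution X (mku_output X s) \<and> mku_value X (mku_output X s) \<ge> mku_opt X - \<epsilon>"
      if "\<exists>I. mku_solution X I"
    proof -
      have "{I. mku_solution X I} \<subseteq> Pow {1..nitems X}" by (auto simp: mku_solution_def)
      then have "finite (mku_value X ` {I. mku_solution X I})" by (intro finite_imageI) (rule finite_subset, auto)
      moreover have "mku_value X ` {I. mku_solution X I} \<noteq> {}" using that by auto
      ultimately have "mku_opt X \<in> mku_value X ` {I. mku_solution X I}" unfolding mku_opt_def by (rule Max_in)
      then obtain J where J: "mku_solution X J" "mku_opt X = mku_value X J" by auto
      then have "mku_opt X \<in> {0..1}" by (simp add: mku_value_def)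
      then show ?thesis using sol[OF J(1)] J(2) Ke by auto
    qed
    with t(1) time show "\<exists>t s. runs (mku_prog K) (mku_input X) t s \<and>
             real t \<le> mku_time (real ?c + 1431) \<epsilon> X \<and>
             ((\<exists>I. mku_solution X I) \<longrightarrow>
                mku_opt X \<in> {0..1} \<and>
                mku_solution X (mku_output X s) \<and>
                mku_value X (mku_output X s) \<ge> mku_opt X - \<epsilon>)"
      by blast
  qed
qed simp

end
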